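(* Let $(\phi_t)$ be a holomorphic semigroup, not a group, in $\mathbb{D}$. Let $\tau\in\overline{\mathbb{D}}$ be the Denjoy-Wolff point of $(\phi_t)$ and $\mu$ its spectral value. Let $h$ be the Königs function of $(\phi_t)$. Suppose $\Delta$ is a hyperbolic petal for $(\phi_t)$, let $\sigma\in\partial\Delta$ be the unique repelling fixed point of $(\phi_t)$ contained in $\partial\Delta$, and let $\lambda\in(-\infty,0)$ be the repelling spectral value of $(\phi_t)$ at $\sigma$. (1) If $\tau\in\mathbb{D}$, then there exists $\theta_0\in[-\pi,\pi)$ such that $h(\Delta)$ is a maximal $\mu$-spirallike sector of $h(\mathbb{D})$ of center $e^{i\theta_0}$ and amplitude $-\frac{|\mu|^2\pi}{\lambda\operatorname{Re}\mu}$, i.e. $$h(\Delta)=\mathrm{Spir}\Bigl[\mu,-\frac{|\mu|^2\pi}{\lambda\operatorname{Re}\mu},\theta_0\Bigr].$$ (2) If $\tau\in\partial\mathbb{D}$, then there exists $z_0\in\mathbb{C}$ such that $h(\Delta)$ is a maximal strip in $h(\mathbb{D})$ of the form $$h(\Delta)=z_0+\mathbb{S}_{-\pi/\lambda}.$$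
   Context: $\mathbb{D}$ is the open unit disc in $\mathbb{C}$. A holomorphic semigroup in $\mathbb{D}$ is a family $(\phi_t)_{t\ge0}$ of holomorphic self-maps of $\mathbb{D}$ with $\phi_0=\mathrm{id}$, $\phi_{t+s}=\phi_t\circ\phi_s$, continuous in $t$ for uniform convergence on compacta. It is a group if $\phi_t$ is an automorphism of $\mathbb{D}$ for some (equivalently all) $t>0$. If it is not a group, the Denjoy-Wolff point is the unique $\tau\in\overline{\mathbb{D}}$ with $\phi_t\to\tau$ uniformly on compacta as $t\to+\infty$. The semigroup is elliptic if $\tau\in\mathbb{D}$; then $\phi_t'(\tau)=e^{-\mu t}$ with $\operatorname{Re}\mu>0$. If $\tau\in\partial\mathbb{D}$, then $\angle\lim_{z\to\tau}\phi_t'(z)=e^{-\mu t}$ with $\mu\ge0$ ($\angle\lim$ is the non-tangential limit); it is hyperbolic if $\mu>0$, parabolic if $\mu=0$. The number $\mu$ is the spectral value. $\sigma\in\partial\mathbb{D}$ is a repelling fixed point if $\angle\lim_{z\to\sigma}\phi_t(z)=\sigma$ and $\angle\lim_{z\to\sigma}\phi_t'(z)=e^{-\lambda t}$ for all $t\ge0$, with some $\lambda<0$ (repelling spectral value at $\sigma$). Petals are the connected components of the interior of $\bigcap_{t\ge0}\phi_t(\mathbb{D})$. A petal $\Delta$ is hyperbolic if $\partial\Delta$ contains a repelling fixed point of $(\phi_t)$ (which is then unique). For $\rho>0$, $\mathbb{S}_\rho=\{\zeta\in\mathbb{C}:0<\operatorname{Re}\zeta<\rho\}$. The Königs function of $(\phi_t)$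 is the univalent map $h:\mathbb{D}\to\mathbb{C}$ of its canonical model $(\Omega,h,\psi_t)$: $h\circ\phi_t=\psi_t\circ h$, $\bigcup_{t\ge0}\psi_t^{-1}(h(\mathbb{D}))=\Omega$, where $\Omega=\mathbb{C}$, $\psi_t(z)=e^{-\mu t}z$ in the elliptic case; $\Omega=\mathbb{S}_{\pi/\mu}$, $\psi_t(z)=z+it$ in the hyperbolic case; $\Omega\in\{\{\operatorname{Re}\zeta>0\},\{\operatorname{Re}\zeta<0\},\mathbb{C}\}$, $\psi_t(z)=z+it$ in the parabolic case (such a model exists and is unique up to isomorphism of models). For $\operatorname{Re}\mu>0$, $\alpha\in(0,\pi]$, $\theta_0\in[-\pi,\pi)$, the $\mu$-spirallike sector of amplitude $2\alpha$ and center $e^{i\theta_0}$ is $\mathrm{Spir}[\mu,2\alpha,\theta_0]=\{e^{t\mu+i\theta}:t\in\mathbb{R},\ \theta\in(\theta_0-\alpha,\theta_0+\alpha)\}$. A $\mu$-spirallike sector contained in $h(\mathbb{D})$ is maximal if it is not properly contained in another $\mu$-spirallike sector contained in $h(\mathbb{D})$. A strip $z_0+\mathbb{S}_\rho\subset h(\mathbb{D})$ is maximal if it is not properly contained in another strip $z_1+\mathbb{S}_r\subset h(\mathbb{D})$, $r>0$, $z_1\in\mathbb{C}$. *)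

theory Defs
  imports "HOL-Complex_Analysis.Complex_Analysis"
begin

text \<open>
  Self-maps of the unit disc and Koenigs functions are total functions on \<^typ>\<open>complex\<close>;
  only their values on the disc matter.  A family $(\phi_t)_{t \ge 0}$ is a function
  \<^typ>\<open>real \<Rightarrow> complex \<Rightarrow> complex\<close> of which only the values at $t \ge 0$ matter.
\<close>

abbreviation unit_disc :: "complex set" where
  "unit_disc \<equiv> ball 0 1"

abbreviation unit_circle :: "complex set" where
  "unit_circle \<equiv> sphere 0 1"


subsection \<open>Semigroups of holomorphic self-maps of the disc\<close>

definition holomorphic_semigroup :: "(real \<Rightarrow> complex \<Rightarrow> complex) \<Rightarrow> bool" where
  "holomorphic_semigroup \<phi> \<longleftrightarrow>
     (\<forall>t\<ge>0. \<phi> t holomorphic_on unit_disc \<and> \<phi> t ` unit_disc \<subseteq> unit_disc) \<and>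
     (\<forall>z\<in>unit_disc. \<phi> 0 z = z) \<and>
     (\<forall>t\<ge>0. \<forall>s\<ge>0. \<forall>z\<in>unit_disc. \<phi> (t + s) z = \<phi> t (\<phi> s z)) \<and>
     (\<forall>s\<ge>0. \<forall>K. compact K \<and> K \<subseteq> unit_disc \<longrightarrow> uniform_limit K \<phi> (\<phi> s) (at s within {0..}))"

definition disc_automorphism :: "(complex \<Rightarrow> complex) \<Rightarrow> bool" where
  "disc_automorphism f \<longleftrightarrow>
     f holomorphic_on unit_disc \<and> f ` unit_disc \<subseteq> unit_disc \<and>
     (\<exists>g. g holomorphic_on unit_disc \<and> g ` unit_disc \<subseteq> unit_disc \<and>
          (\<forall>z\<in>unit_disc. g (f z) = z \<and> f (g z) = z))"

definition holomorphic_group :: "(real \<Rightarrow> complex \<Rightarrow> complex) \<Rightarrow> bool" where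
  "holomorphic_group \<phi> \<longleftrightarrow> holomorphic_semigroup \<phi> \<and> (\<exists>t>0. disc_automorphism (\<phi> t))"

definition denjoy_wolff_point :: "(real \<Rightarrow> complex \<Rightarrow> complex) \<Rightarrow> complex \<Rightarrow> bool" where
  "denjoy_wolff_point \<phi> \<tau> \<longleftrightarrow>
     \<tau> \<in> cball 0 1 \<and>
     (\<forall>K. compact K \<and> K \<subseteq> unit_disc \<longrightarrow> uniform_limit K \<phi> (\<lambda>_. \<tau>) at_top)"


subsection \<open>Non-tangential limits and spectral values\<close>

definition stolz_region :: "complex \<Rightarrow> real \<Rightarrow> complex set" where
  "stolz_region \<sigma> M = {z \<in> unit_disc. norm (\<sigma> - z) < M * (1 - norm z)}"

definition nontangential_limit ::
    "(complex \<Rightarrow> complex) \<Rightarrow> complex \<Rightarrow> complex \<Rightarrow> bool" where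
  "nontangential_limit f \<sigma> l \<longleftrightarrow> (\<forall>M>1. (f \<longlongrightarrow> l) (at \<sigma> within stolz_region \<sigma> M))"

text \<open>The semigroup \<open>\<phi>\<close> with Denjoy-Wolff point \<open>\<tau>\<close> has spectral value \<open>\<mu>\<close>.  For
  \<open>\<tau>\<close> on the unit circle the spectral value is a non-negative real number.\<close>

definition spectral_value ::
    "(real \<Rightarrow> complex \<Rightarrow> complex) \<Rightarrow> complex \<Rightarrow> complex \<Rightarrow> bool" where
  "spectral_value \<phi> \<tau> \<mu> \<longleftrightarrow>
     (if \<tau> \<in> unit_disc
      then Re \<mu> > 0 \<and> (\<forall>t\<ge>0. deriv (\<phi> t) \<tau> = exp (- \<mu> * of_real t))
      else \<mu> \<in> \<real> \<and> Re \<mu> \<ge> 0 \<and>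
           (\<forall>t\<ge>0. nontangential_limit (deriv (\<phi> t)) \<tau> (exp (- \<mu> * of_real t))))"

text \<open>\<open>\<sigma>\<close> is a repelling fixed point of \<open>\<phi>\<close> with repelling spectral value \<open>l\<close>.\<close>

definition repelling_fixed_point ::
    "(real \<Rightarrow> complex \<Rightarrow> complex) \<Rightarrow> complex \<Rightarrow> real \<Rightarrow> bool" where
  "repelling_fixed_point \<phi> \<sigma> l \<longleftrightarrow>
     \<sigma> \<in> unit_circle \<and> l < 0 \<and>
     (\<forall>t\<ge>0. nontangential_limit (\<phi> t) \<sigma> \<sigma> \<and>
            nontangential_limit (deriv (\<phi> t)) \<sigma> (of_real (exp (- l * t))))"


subsection \<open>Petals\<close>

definition petal :: "(real \<Rightarrow> complex \<Rightarrow> complex) \<Rightarrow> complex set \<Rightarrow> bool" where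
  "petal \<phi> \<Delta> \<longleftrightarrow> \<Delta> \<in> components (interior (\<Inter>t\<in>{0..}. \<phi> t ` unit_disc))"

definition hyperbolic_petal :: "(real \<Rightarrow> complex \<Rightarrow> complex) \<Rightarrow> complex set \<Rightarrow> bool" where
  "hyperbolic_petal \<phi> \<Delta> \<longleftrightarrow>
     petal \<phi> \<Delta> \<and> (\<exists>\<sigma>\<in>frontier \<Delta>. \<exists>l. repelling_fixed_point \<phi> \<sigma> l)"


subsection \<open>Koenigs functions\<close>

definition vertical_strip :: "real \<Rightarrow> complex set" where
  "vertical_strip \<rho> = {\<zeta>. 0 < Re \<zeta> \<and> Re \<zeta> < \<rho>}"

definition holomorphic_model ::
    "(real \<Rightarrow> complex \<Rightarrow> complex) \<Rightarrow> complex set \<Rightarrow> (complex \<Rightarrow> complex) \<Rightarrow>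
     (real \<Rightarrow> complex \<Rightarrow> complex) \<Rightarrow> bool" where
  "holomorphic_model \<phi> \<Omega> h \<psi> \<longleftrightarrow>
     h holomorphic_on unit_disc \<and> inj_on h unit_disc \<and> h ` unit_disc \<subseteq> \<Omega> \<and>
     (\<forall>t\<ge>0. \<forall>z\<in>unit_disc. h (\<phi> t z) = \<psi> t (h z)) \<and>
     (\<Union>t\<in>{0..}. \<psi> t -` (h ` unit_disc) \<inter> \<Omega>) = \<Omega>"

text \<open>\<open>h\<close> is a Koenigs function of the semigroup \<open>\<phi>\<close> with Denjoy-Wolff point \<open>\<tau>\<close> and
  spectral value \<open>\<mu>\<close>.  The three branches are the elliptic, hyperbolic and parabolic case.
  No normalization is imposed: canonical models are unique only up to isomorphism.\<close>

definition koenigs_function ::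
    "(real \<Rightarrow> complex \<Rightarrow> complex) \<Rightarrow> complex \<Rightarrow> complex \<Rightarrow> (complex \<Rightarrow> complex) \<Rightarrow> bool" where
  "koenigs_function \<phi> \<tau> \<mu> h \<longleftrightarrow>
     (if \<tau> \<in> unit_disc
      then holomorphic_model \<phi> UNIV h (\<lambda>t z. exp (- \<mu> * of_real t) * z)
      else if Re \<mu> > 0
      then holomorphic_model \<phi> (vertical_strip (pi / Re \<mu>)) h (\<lambda>t z. z + \<i> * of_real t)
      else \<exists>\<Omega>\<in>{{\<zeta>. Re \<zeta> > 0}, {\<zeta>. Re \<zeta> < 0}, UNIV}.
             holomorphic_model \<phi> \<Omega> h (\<lambda>t z. z + \<i> * of_real t))"


subsection \<open>Maximal spirallike sectors and maximal strips\<close>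

text \<open>The second argument \<open>a\<close> is the full amplitude $2\alpha$.\<close>

definition Spir :: "complex \<Rightarrow> real \<Rightarrow> real \<Rightarrow> complex set" where
  "Spir \<mu> a \<theta>\<^sub>0 =
     {exp (of_real t * \<mu> + \<i> * of_real \<theta>) | t \<theta>. \<theta> \<in> {\<theta>\<^sub>0 - a / 2 <..< \<theta>\<^sub>0 + a / 2}}"

definition spirallike_sector_in :: "complex set \<Rightarrow> complex \<Rightarrow> real \<Rightarrow> real \<Rightarrow> bool" where
  "spirallike_sector_in U \<mu> a \<theta>\<^sub>0 \<longleftrightarrow>
     a \<in> {0<..2 * pi} \<and> \<theta>\<^sub>0 \<in> {-pi..<pi} \<and> Spir \<mu> a \<theta>\<^sub>0 \<subseteq> U"

definition maximal_spirallike_sector :: "complex set \<Rightarrow> complex \<Rightarrow> real \<Rightarrow> real \<Rightarrow> bool" where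
  "maximal_spirallike_sector U \<mu> a \<theta>\<^sub>0 \<longleftrightarrow>
     spirallike_sector_in U \<mu> a \<theta>\<^sub>0 \<and>
     \<not> (\<exists>b \<theta>\<^sub>1. spirallike_sector_in U \<mu> b \<theta>\<^sub>1 \<and> Spir \<mu> a \<theta>\<^sub>0 \<subset> Spir \<mu> b \<theta>\<^sub>1)"

definition strip_in :: "complex set \<Rightarrow> complex \<Rightarrow> real \<Rightarrow> bool" where
  "strip_in U z\<^sub>0 \<rho> \<longleftrightarrow> \<rho> > 0 \<and> (+) z\<^sub>0 ` vertical_strip \<rho> \<subseteq> U"

definition maximal_strip :: "complex set \<Rightarrow> complex \<Rightarrow> real \<Rightarrow> bool" where
  "maximal_strip U z\<^sub>0 \<rho> \<longleftrightarrow>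
     strip_in U z\<^sub>0 \<rho> \<and>
     \<not> (\<exists>z\<^sub>1 r. strip_in U z\<^sub>1 r \<and>
           (+) z\<^sub>0 ` vertical_strip \<rho> \<subset> (+) z\<^sub>1 ` vertical_strip r)"

end

(*
  In a suitable coordinate w (the Koenigs coordinate itself, or its logarithm divided by i mu in
  the elliptic case) the flow is w + it, so the petals are the maximal vertical strips over which
  the image of the disc contains full lines, and the point is to compute the width of the one
  attached to sigma.  Julia's inequality at sigma, differentiated in t, makes the generator G a
  function of positive real part up to the Poisson term; hence G(z)/(z - sigma) tends to -l
  non-tangentially, and the Koenigs coordinate is asymptotic to (i/|l|) log there.  So the images
  of the rays that end at sigma fill a strip of width pi/|l|.  Conversely, by Schwarz-Pick the
  image of a ray close to the boundary of the disc is close to points outside the image of the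
  disc, so the strip cannot be wider.  Finally, Julia's inequality at the Denjoy-Wolff point (or
  the Schwarz lemma) makes Im w monotone along the horocyclic direction, so Im w tends to minus
  infinity at sigma without restriction on the approach; this singles out the petal with sigma in
  its boundary.
*)

theory Submission
  imports Defs
begin

subsection \<open>The Schwarz-Pick lemma and Julia's inequality\<close>

text \<open>The obstacle is tangential approach: the asymptotics of the coordinate hold only in
  cones at sigma, while the petal may approach sigma from any direction. The disc is therefore
  uniformized by a half-plane with sigma at 0 and the Denjoy-Wolff point at infinity. Horodiscs (or
  pseudo-hyperbolic discs) at that point become half-planes, and Im w grows along horizontal rays,
  so a point near 0 outside a cone is dominated by one inside it. The width is the opening angle pi
  of the half-plane at 0 divided by |l|: up to sign, arg v becomes Re w. Points missing from the
  image are found only close to the edges, so each edge is known up to an arbitrary error; openness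
  of the petal removes the error. In the elliptic case w is not single-valued on the image, and
  curves in the image of the petal are lifted through \<open>E\<close>. The image also omits some
  point other than 0; this keeps the Denjoy-Wolff point out of the petal and bounds the amplitude by
  2 pi. A rotation by theta moves w by theta/mu, whose real part is theta Re mu/|mu|^2; this factor
  converts the width into the amplitude.\<close>

lemma one_minus_norm_Moebius_sq:
  fixes z w :: complex
  assumes "1 - cnj w * z \<noteq> 0"
  shows "1 - (norm ((z - w) / (1 - cnj w * z)))\<^sup>2
           = (1 - (norm z)\<^sup>2) * (1 - (norm w)\<^sup>2) / (norm (1 - cnj w * z))\<^sup>2"
proof -
  have "(norm (1 - cnj w * z))\<^sup>2 - (norm (z - w))\<^sup>2 = (1 - (norm z)\<^sup>2) * (1 - (norm w)\<^sup>2)"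
    by (simp only: cmod_power2) (simp add: power2_eq_square algebra_simps)
  moreover have "(norm (1 - cnj w * z))\<^sup>2 \<noteq> 0" using assms by simp
  ultimately show ?thesis
    by (simp add: norm_divide power_divide field_simps)
qed

lemma one_minus_cnj_mult_nonzero:
  fixes z w :: complex
  assumes "norm z < 1" "norm w \<le> 1"
  shows "1 - cnj w * z \<noteq> 0"
proof
  assume "1 - cnj w * z = 0"
  then have "norm (cnj w * z) = 1" by (metis norm_one right_minus_eq)
  moreover have "norm w * norm z \<le> 1 * norm z" using assms by (intro mult_right_mono) auto
  ultimately show False using assms by (simp add: norm_mult)
qed

lemma norm_Moebius_less_1:
  fixes z w :: complex
  assumes "norm z < 1" "norm w < 1"
  shows "norm ((z - w) / (1 - cnj w * z)) < 1"
  using Moebius_function_norm_lt_1[of w z 0] assms by (simp add: Moebius_function_simple)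

text \<open>Conjugating \<open>f\<close> by the disc automorphisms that move \<open>w\<close> and
  \<open>f w\<close> to 0 reduces the claim to the Schwarz lemma.\<close>

lemma Schwarz_Pick:
  assumes f: "f holomorphic_on unit_disc" "f ` unit_disc \<subseteq> unit_disc"
    and z: "z \<in> unit_disc" and w: "w \<in> unit_disc"
  shows "norm ((f z - f w) / (1 - cnj (f w) * f z)) \<le> norm ((z - w) / (1 - cnj w * z))"
proof -
  define F where "F = Moebius_function 0 (f w) \<circ> f \<circ> Moebius_function 0 (- w)"
  have fw: "norm (f w) < 1" and w1: "norm w < 1" and z1: "norm z < 1" and mw: "norm (- w) < 1"
    using f w z by (auto simp: image_subset_iff)
  have m1: "Moebius_function 0 (- w) ` unit_disc \<subseteq> unit_disc"
    using Moebius_function_norm_lt_1[OF mw] by auto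
  have "F holomorphic_on unit_disc"
    unfolding F_def
    by (intro holomorphic_on_compose_gen[where t = unit_disc] f m1 Moebius_function_holomorphic mw fw)
  moreover have "F 0 = 0"
    by (simp add: F_def Moebius_function_of_zero Moebius_function_eq_zero)
  moreover have "norm (F x) < 1" if "norm x < 1" for x
    unfolding F_def o_def using f(2) that m1
    by (intro Moebius_function_norm_lt_1 fw) (auto simp: image_subset_iff)
  moreover have "norm (Moebius_function 0 w z) < 1"
    by (rule Moebius_function_norm_lt_1[OF w1 z1])
  ultimately have "norm (F (Moebius_function 0 w z)) \<le> norm (Moebius_function 0 w z)"
    by (rule Schwarz_Lemma(1))
  moreover have "Moebius_function 0 (- w) (Moebius_function 0 w z) = z"
    using Moebius_function_compose[of "-w" w z] w1 z1 by simp
  ultimately show ?thesis by (simp add: F_def Moebius_function_simple)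
qed

text \<open>The Schwarz lemma for \<open>g\<close> rescaled to the unit disc and followed by the
  automorphism that moves \<open>g w\<close> to 0. Read as a bound on \<open>d\<close>, it limits
  the size of a ball inside the domain of an inverse Koenigs function.\<close>

lemma Schwarz_Pick_deriv_ball:
  assumes g: "g holomorphic_on ball w d" "g ` ball w d \<subseteq> unit_disc" and d: "d > 0"
  shows "norm (deriv g w) * d \<le> 1 - (norm (g w))\<^sup>2"
proof -
  define F where "F = (\<lambda>x. Moebius_function 0 (g w) (g (w + of_real d * x)))"
  have gw: "norm (g w) < 1" using g d by (auto simp: image_subset_iff)
  have aff: "w + of_real d * x \<in> ball w d" if "norm x < 1" for x
    using that d by (simp add: dist_norm norm_mult)
  have "(g \<circ> (\<lambda>x. w + of_real d * x)) holomorphic_on unit_disc"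
    by (rule holomorphic_on_compose_gen[OF _ g(1)]) (auto intro!: holomorphic_intros aff)
  then have "(Moebius_function 0 (g w) \<circ> (g \<circ> (\<lambda>x. w + of_real d * x))) holomorphic_on unit_disc"
    by (rule holomorphic_on_compose_gen[OF _ Moebius_function_holomorphic[OF gw]])
       (use aff g in \<open>auto simp: image_subset_iff\<close>)
  then have "F holomorphic_on unit_disc" by (simp add: F_def o_def)
  moreover have "F 0 = 0" by (simp add: F_def Moebius_function_eq_zero)
  moreover have "norm (F x) < 1" if "norm x < 1" for x
    unfolding F_def using g(2) aff[OF that] by (intro Moebius_function_norm_lt_1 gw) (auto simp: image_subset_iff)
  ultimately have le: "norm (deriv F 0) \<le> 1"
    using Schwarz_Lemma(2)[of F 0] by auto
  have n0: "1 - (norm (g w))\<^sup>2 > 0"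
    using gw by (simp add: power_less_one_iff abs_square_less_1)
  have c0: "1 - cnj (g w) * g w = of_real (1 - (norm (g w))\<^sup>2)"
    using complex_norm_square[of "g w"] by (simp add: mult.commute)
  have a0: "1 - cnj (g w) * g w \<noteq> 0" using n0 unfolding c0 by (simp only: of_real_eq_0_iff)
  have dg: "(g has_field_derivative deriv g w) (at (w + of_real d * 0))"
    using holomorphic_derivI[OF g(1)] d by simp
  have 1: "((\<lambda>x. g (w + of_real d * x)) has_field_derivative deriv g w * of_real d) (at 0)"
    by (rule DERIV_chain2[where f = g and g = "\<lambda>x. w + of_real d * x", OF dg])
       (auto intro!: derivative_eq_intros)
  have 2: "((\<lambda>y. (y - g w) / (1 - cnj (g w) * y)) has_field_derivative
      1 / (1 - cnj (g w) * g w)) (at (g (w + of_real d * 0)))"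
    using a0 by (auto intro!: derivative_eq_intros)
  have "(F has_field_derivative 1 / (1 - cnj (g w) * g w) * (deriv g w * of_real d)) (at 0)"
    unfolding F_def Moebius_function_simple
    by (rule DERIV_chain2[where f = "\<lambda>y. (y - g w) / (1 - cnj (g w) * y)"
          and g = "\<lambda>x. g (w + of_real d * x)", OF 2 1])
  then have "deriv F 0 = deriv g w * of_real d / of_real (1 - (norm (g w))\<^sup>2)"
    unfolding c0 by (simp only: DERIV_imp_deriv) simp
  then have "norm (deriv F 0) = norm (deriv g w) * d / (1 - (norm (g w))\<^sup>2)"
    using n0 d by (simp only: norm_divide norm_mult norm_of_real abs_of_pos)
  with le n0 show ?thesis by (simp add: field_simps)
qed

text \<open>The real part of the following function is the Poisson kernel at \<open>\<omega>\<close>; its superlevel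
  sets are the horodiscs at \<open>\<omega>\<close>.\<close>

definition cayley :: "complex \<Rightarrow> complex \<Rightarrow> complex" where
  "cayley \<omega> z = (\<omega> + z) / (\<omega> - z)"

lemma Re_cayley:
  assumes "\<omega> \<in> unit_circle"
  shows "Re (cayley \<omega> z) = (1 - (norm z)\<^sup>2) / (norm (\<omega> - z))\<^sup>2"
proof -
  have "(norm \<omega>)\<^sup>2 = 1" using assms by simp
  moreover have "Re (cayley \<omega> z) = ((norm \<omega>)\<^sup>2 - (norm z)\<^sup>2) / (norm (\<omega> - z))\<^sup>2"
    by (simp only: cayley_def Re_divide cmod_power2) (simp add: power2_eq_square algebra_simps)
  ultimately show ?thesis by simp
qed

lemma disc_ne_circle: "z \<in> unit_disc \<Longrightarrow> \<omega> \<in> unit_circle \<Longrightarrow> z \<noteq> \<omega>"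
  by auto

lemma Re_cayley_pos:
  assumes "\<omega> \<in> unit_circle" "z \<in> unit_disc"
  shows "Re (cayley \<omega> z) > 0"
proof -
  have "(norm z)\<^sup>2 < 1" using assms by (simp add: abs_square_less_1)
  moreover have "(norm (\<omega> - z))\<^sup>2 > 0" using disc_ne_circle[OF assms(2,1)] by simp
  ultimately show ?thesis by (simp add: Re_cayley[OF assms(1)])
qed

lemma cayley_field_derivative:
  assumes "z \<noteq> \<omega>"
  shows "(cayley \<omega> has_field_derivative 2 * \<omega> / (\<omega> - z)\<^sup>2) (at z within S)"
proof -
  have "((\<lambda>z. (\<omega> + z) / (\<omega> - z)) has_field_derivative 2 * \<omega> / (\<omega> - z)\<^sup>2) (at z within S)"
    using assms by (auto intro!: derivative_eq_intros simp: power2_eq_square)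
  then show ?thesis by (simp add: cayley_def[abs_def])
qed

text \<open>Schwarz-Pick for the pair \<open>z\<close>, \<open>x n\<close>, rewritten with
  \<open>one_minus_norm_Moebius_sq\<close> and passed to the limit. Only one sequence is needed
  along which the ratio of the boundary distances stays under control; \<open>a\<close> is the
  resulting dilation coefficient.\<close>

lemma Julia_inequality:
  assumes f: "f holomorphic_on unit_disc" "f ` unit_disc \<subseteq> unit_disc"
    and \<omega>: "\<omega> \<in> unit_circle" and z: "z \<in> unit_disc"
    and x: "\<And>n::nat. x n \<in> unit_disc" "x \<longlonglongrightarrow> \<omega>" "(\<lambda>n. f (x n)) \<longlonglongrightarrow> \<omega>"
    and \<alpha>: "\<And>n. 1 - (norm (f (x n)))\<^sup>2 \<le> \<alpha> n * (1 - (norm (x n))\<^sup>2)" "\<alpha> \<longlonglongrightarrow> a"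
  shows "Re (cayley \<omega> z) \<le> a * Re (cayley \<omega> (f z))"
proof -
  have fz: "f z \<in> unit_disc" using f z by blast
  have sq: "(norm u)\<^sup>2 < 1" if "u \<in> unit_disc" for u :: complex
    using that by (simp add: abs_square_less_1)
  have le: "(norm (1 - cnj (f (x n)) * f z))\<^sup>2 * (1 - (norm z)\<^sup>2)
      \<le> \<alpha> n * ((norm (1 - cnj (x n) * z))\<^sup>2 * (1 - (norm (f z))\<^sup>2))" for n
  proof -
    have fx: "f (x n) \<in> unit_disc" using f x by blast
    have n1: "1 - cnj (f (x n)) * f z \<noteq> 0" "1 - cnj (x n) * z \<noteq> 0"
      using one_minus_cnj_mult_nonzero[of "f z" "f (x n)"] one_minus_cnj_mult_nonzero[of z "x n"]
        fx fz x(1)[of n] z by auto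
    have "(norm ((f z - f (x n)) / (1 - cnj (f (x n)) * f z)))\<^sup>2 \<le> (norm ((z - x n) / (1 - cnj (x n) * z)))\<^sup>2"
      by (intro power_mono Schwarz_Pick f z x) auto
    then have "(1 - (norm z)\<^sup>2) * (1 - (norm (x n))\<^sup>2) / (norm (1 - cnj (x n) * z))\<^sup>2
       \<le> (1 - (norm (f z))\<^sup>2) * (1 - (norm (f (x n)))\<^sup>2) / (norm (1 - cnj (f (x n)) * f z))\<^sup>2"
      using one_minus_norm_Moebius_sq[OF n1(1)] one_minus_norm_Moebius_sq[OF n1(2)] by linarith
    also have "\<dots> \<le> (1 - (norm (f z))\<^sup>2) * (\<alpha> n * (1 - (norm (x n))\<^sup>2)) / (norm (1 - cnj (f (x n)) * f z))\<^sup>2"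
      using sq[OF fz] by (intro divide_right_mono mult_left_mono \<alpha>(1)) auto
    finally have "(1 - (norm (x n))\<^sup>2) * ((1 - (norm z)\<^sup>2) / (norm (1 - cnj (x n) * z))\<^sup>2)
       \<le> (1 - (norm (x n))\<^sup>2) * (\<alpha> n * (1 - (norm (f z))\<^sup>2) / (norm (1 - cnj (f (x n)) * f z))\<^sup>2)"
      by (simp add: mult_ac)
    \<comment> \<open>The cancelled factor tends to 0 with n; without it the inequality has a
      nontrivial limit.\<close>
    then have "(1 - (norm z)\<^sup>2) / (norm (1 - cnj (x n) * z))\<^sup>2
       \<le> \<alpha> n * (1 - (norm (f z))\<^sup>2) / (norm (1 - cnj (f (x n)) * f z))\<^sup>2"
      using sq[OF x(1)[of n]] by (subst (asm) mult_le_cancel_left_pos) auto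
    then show ?thesis using n1 by (simp add: field_simps)
  qed
  have "(norm (1 - cnj \<omega> * f z))\<^sup>2 * (1 - (norm z)\<^sup>2)
      \<le> a * ((norm (1 - cnj \<omega> * z))\<^sup>2 * (1 - (norm (f z))\<^sup>2))"
  proof (rule LIMSEQ_le)
    show "(\<lambda>n. (norm (1 - cnj (f (x n)) * f z))\<^sup>2 * (1 - (norm z)\<^sup>2))
        \<longlonglongrightarrow> (norm (1 - cnj \<omega> * f z))\<^sup>2 * (1 - (norm z)\<^sup>2)"
      by (intro tendsto_intros x)
    show "(\<lambda>n. \<alpha> n * ((norm (1 - cnj (x n) * z))\<^sup>2 * (1 - (norm (f z))\<^sup>2)))
        \<longlonglongrightarrow> a * ((norm (1 - cnj \<omega> * z))\<^sup>2 * (1 - (norm (f z))\<^sup>2))"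
      by (intro tendsto_intros x \<alpha>)
  qed (use le in blast)
  moreover have "norm (1 - cnj \<omega> * u) = norm (\<omega> - u)" for u
  proof -
    have "cnj \<omega> * \<omega> = 1" using \<omega> complex_norm_square[of \<omega>] by (simp add: mult.commute)
    then have "1 - cnj \<omega> * u = cnj \<omega> * (\<omega> - u)" by (simp add: algebra_simps)
    then show ?thesis using \<omega> by (simp add: norm_mult)
  qed
  moreover have "norm (\<omega> - z) > 0" "norm (\<omega> - f z) > 0"
    using disc_ne_circle[OF z \<omega>] disc_ne_circle[OF fz \<omega>] by auto
  ultimately show ?thesis by (simp add: Re_cayley[OF \<omega>] field_simps)
qed

text \<open>A Harnack-type bound: the Cayley transform \<open>f\<close> centred at
  \<open>q w\<close> is a self-map of the disc with \<open>f w = 0\<close>, so Schwarz-Pick applies.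
  The factor \<open>Re (q w)\<close> is kept explicit because the base point will be chosen to make
  it small compared with the Poisson kernel.\<close>

lemma norm_le_of_Re_pos:
  assumes q: "q holomorphic_on unit_disc" "\<And>z. z \<in> unit_disc \<Longrightarrow> Re (q z) > 0"
    and z: "z \<in> unit_disc" and w: "w \<in> unit_disc"
  shows "norm (q z) \<le> norm (q w)
           + 4 * Re (q w) * (norm (1 - cnj w * z))\<^sup>2 / ((1 - (norm z)\<^sup>2) * (1 - (norm w)\<^sup>2))"
proof -
  define f where "f = (\<lambda>u. (q u - q w) / (q u + cnj (q w)))"
  have ne: "q u + cnj (q w) \<noteq> 0" if "u \<in> unit_disc" for u
    using q(2)[OF that] q(2)[OF w] by (auto simp: complex_eq_iff)
  have "f holomorphic_on unit_disc"
    unfolding f_def by (intro holomorphic_intros q ne)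
  moreover have "f ` unit_disc \<subseteq> unit_disc"
  proof clarify
    fix u :: complex assume u: "u \<in> unit_disc"
    have "(norm (q u + cnj (q w)))\<^sup>2 - (norm (q u - q w))\<^sup>2 = 4 * Re (q u) * Re (q w)"
      by (simp only: cmod_power2) (simp add: power2_eq_square algebra_simps)
    moreover have "Re (q u) * Re (q w) > 0" using q(2)[OF u] q(2)[OF w] by simp
    ultimately have "(norm (q u - q w))\<^sup>2 < (norm (q u + cnj (q w)))\<^sup>2" by linarith
    then have "norm (q u - q w) < norm (q u + cnj (q w))" by (rule power_less_imp_less_base) simp
    then show "f u \<in> unit_disc" using ne[OF u] by (simp add: f_def norm_divide divide_less_eq)
  qed
  moreover have "f w = 0" by (simp add: f_def)
  ultimately have "norm (f z) \<le> norm ((z - w) / (1 - cnj w * z))"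
    using Schwarz_Pick[of f z w] z w by simp
  moreover define t where "t = norm ((z - w) / (1 - cnj w * z))"
  ultimately have ft: "norm (f z) \<le> t" by simp
  have t: "0 \<le> t" "t < 1"
    using norm_Moebius_less_1[of z w] z w by (auto simp: t_def)
  have t2: "1 - t\<^sup>2 = (1 - (norm z)\<^sup>2) * (1 - (norm w)\<^sup>2) / (norm (1 - cnj w * z))\<^sup>2"
    unfolding t_def using z w
    by (intro one_minus_norm_Moebius_sq one_minus_cnj_mult_nonzero) auto
  have "norm (q z - q w) \<le> t * norm (q z + cnj (q w))"
    using ft ne[OF z] by (simp add: f_def norm_divide divide_le_eq)
  also have "q z + cnj (q w) = (q z - q w) + of_real (2 * Re (q w))"
    by (simp add: complex_eq_iff)
  also have "t * norm \<dots> \<le> t * (norm (q z - q w) + 2 * Re (q w))"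
    using t q(2)[OF w] by (intro mult_left_mono order.trans[OF norm_triangle_ineq]) auto
  finally have "(1 - t) * norm (q z - q w) \<le> 2 * t * Re (q w)"
    by (simp add: algebra_simps)
  \<comment> \<open>The factor 1 + t turns 1 - t into 1 - t^2, for which \<open>t2\<close> has a
    closed form.\<close>
  then have "(1 + t) * ((1 - t) * norm (q z - q w)) \<le> (1 + t) * (2 * t * Re (q w))"
    using t by (intro mult_left_mono) auto
  also have "\<dots> \<le> 2 * (2 * 1 * Re (q w))"
    using t q(2)[OF w] by (intro mult_mono) auto
  finally have "norm (q z - q w) * (1 - t\<^sup>2) \<le> 4 * Re (q w)"
    by (simp add: algebra_simps power2_eq_square)
  moreover have "1 - t\<^sup>2 > 0" using t by (simp add: abs_square_less_1)
  ultimately have "norm (q z - q w) \<le> 4 * Re (q w) / (1 - t\<^sup>2)"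
    by (simp add: field_simps)
  also have "\<dots> = 4 * Re (q w) * (norm (1 - cnj w * z))\<^sup>2 / ((1 - (norm z)\<^sup>2) * (1 - (norm w)\<^sup>2))"
    by (simp add: t2)
  finally show ?thesis
    using norm_triangle_sub[of "q z" "q w"] by linarith
qed

subsection \<open>Logarithmic behaviour at a boundary point of the half-plane\<close>

abbreviation right_half_plane :: "complex set" where
  "right_half_plane \<equiv> {v. 0 < Re v}"

lemma open_right_half_plane: "open right_half_plane"
  by (rule open_halfspace_Re_gt)

lemma convex_right_half_plane: "convex right_half_plane"
  by (rule convex_halfspace_Re_gt)

text \<open>These cones are the non-tangential regions at the boundary point 0 of the half-plane;
  convexity makes the mean value inequality available on them.\<close>

lemma convex_cone_Re: "convex {u::complex. norm u < M * Re u}"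
proof (rule convexI)
  fix x y :: complex and a b :: real
  assume xy: "x \<in> {u. norm u < M * Re u}" "y \<in> {u. norm u < M * Re u}"
    and ab: "0 \<le> a" "0 \<le> b" "a + b = 1"
  have "norm (a *\<^sub>R x + b *\<^sub>R y) \<le> a * norm x + b * norm y"
    using norm_triangle_ineq[of "a *\<^sub>R x" "b *\<^sub>R y"] ab by simp
  also have "\<dots> < a * (M * Re x) + b * (M * Re y)"
  proof (cases "a = 0")
    case True
    then show ?thesis using ab xy by simp
  next
    case False
    then show ?thesis using ab xy
      by (intro add_less_le_mono mult_strict_left_mono mult_left_mono) auto
  qed
  finally show "a *\<^sub>R x + b *\<^sub>R y \<in> {u. norm u < M * Re u}"
    by (simp add: algebra_simps)
qed

text \<open>The derivative of \<Psi> - c Ln is (v \<Psi>' - c)/v, which is o(1/|v|) in the cone.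
  Between points of modulus comparable to r the difference is thus o(1), although \<Psi> - c Ln
  itself need not have a limit. \<open>L\<close> fixes how comparable the moduli are.\<close>

lemma log_comparison:
  fixes \<Psi> :: "complex \<Rightarrow> complex" and c :: complex and M L \<eta> :: real
  assumes hol: "\<Psi> holomorphic_on right_half_plane"
    and lim: "((\<lambda>v. v * deriv \<Psi> v) \<longlongrightarrow> c) (at 0 within {v. norm v < M * Re v})"
    and M: "M > 0" and L: "L > 0" and \<eta>: "\<eta> > 0"
  shows "\<exists>R>0. \<forall>r v w. 0 < r \<longrightarrow> r < R \<longrightarrow> norm v < M * Re v \<longrightarrow> norm w < M * Re w \<longrightarrow>
           norm v \<le> r \<longrightarrow> norm w \<le> r \<longrightarrow> r \<le> L * norm v \<longrightarrow> r \<le> L * norm w \<longrightarrow>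
           norm ((\<Psi> v - c * Ln v) - (\<Psi> w - c * Ln w)) \<le> \<eta>"
proof -
  \<comment> \<open>The derivative will be at most \<epsilon> L M / r on a set of diameter at most
    2r, and the product is then \<eta>.\<close>
  define \<epsilon> where "\<epsilon> = \<eta> / (2 * L * M)"
  have \<epsilon>: "\<epsilon> > 0" using M L \<eta> by (simp add: \<epsilon>_def)
  obtain R where R: "R > 0"
    and Rlim: "\<And>v. norm v < M * Re v \<Longrightarrow> v \<noteq> 0 \<Longrightarrow> norm v < R \<Longrightarrow> norm (v * deriv \<Psi> v - c) < \<epsilon>"
    using lim \<epsilon> unfolding Lim_within by (auto simp: dist_norm)
  have "norm ((\<Psi> v - c * Ln v) - (\<Psi> w - c * Ln w)) \<le> \<eta>"
    if r: "0 < r" "r < R" and v: "norm v < M * Re v" "norm v \<le> r" "r \<le> L * norm v"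
      and w: "norm w < M * Re w" "norm w \<le> r" "r \<le> L * norm w" for r v w
  proof -
    \<comment> \<open>The last half-plane keeps \<open>S\<close> away from 0 without destroying
      convexity, which a lower bound on the modulus would do. Its constant comes from r <= L |u| and
      |u| < M Re u.\<close>
    define S where "S = {u. norm u < M * Re u} \<inter> cball 0 r \<inter> {u. Re u \<ge> r / (L * M)}"
    have "convex S"
      unfolding S_def by (intro convex_Int convex_cone_Re convex_cball convex_halfspace_Re_ge)
    moreover have "((\<lambda>u. \<Psi> u - c * Ln u) has_field_derivative (u * deriv \<Psi> u - c) / u) (at u within S)"
      and "norm ((u * deriv \<Psi> u - c) / u) \<le> \<epsilon> * L * M / r" if "u \<in> S" for u
    proof -
      have "r / (L * M) > 0" using r M L by simp
      then have u: "Re u > 0" "u \<noteq> 0" "norm u \<ge> r / (L * M)" "norm u < R" "norm u < M * Re u"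
        using that r complex_Re_le_cmod[of u] unfolding S_def by auto
      have "(\<Psi> has_field_derivative deriv \<Psi> u) (at u within S)"
        using holomorphic_derivI[OF hol open_right_half_plane] u(1) by auto
      moreover have "(Ln has_field_derivative inverse u) (at u within S)"
        by (rule has_field_derivative_at_within, rule has_field_derivative_Ln)
           (use u in \<open>auto simp: complex_nonpos_Reals_iff\<close>)
      ultimately show "((\<lambda>u. \<Psi> u - c * Ln u) has_field_derivative (u * deriv \<Psi> u - c) / u) (at u within S)"
        using DERIV_diff[OF _ DERIV_cmult, of \<Psi> "deriv \<Psi> u" u S Ln "inverse u" c] u(2)
        by (simp add: field_simps)
      have "norm ((u * deriv \<Psi> u - c) / u) \<le> \<epsilon> / (r / (L * M))"
        unfolding norm_divide using Rlim[OF u(5,2,4)] u(3) \<open>r / (L * M) > 0\<close> \<epsilon>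
        by (intro frac_le) auto
      then show "norm ((u * deriv \<Psi> u - c) / u) \<le> \<epsilon> * L * M / r" by simp
    qed
    moreover have "v \<in> S" "w \<in> S"
    proof -
      have "r \<le> L * M * Re u" if "norm u < M * Re u" "r \<le> L * norm u" for u
        using that mult_strict_left_mono[OF that(1) L] by (simp add: mult_ac)
      then show "v \<in> S" "w \<in> S"
        using v w L M by (auto simp: S_def divide_le_eq mult_ac)
    qed
    ultimately have "norm ((\<Psi> v - c * Ln v) - (\<Psi> w - c * Ln w)) \<le> \<epsilon> * L * M / r * norm (v - w)"
      by (rule field_differentiable_bound)
    also have "\<dots> \<le> \<epsilon> * L * M / r * (2 * r)"
      using \<epsilon> L M r v w by (intro mult_left_mono order.trans[OF norm_triangle_ineq4]) auto
    also have "\<dots> = \<eta>" using r L M by (simp add: \<epsilon>_def)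
    finally show ?thesis .
  qed
  then show ?thesis using R by blast
qed

lemma sector_point:
  assumes "\<bar>\<theta>\<bar> < pi / 2" "r > 0"
  shows "Ln (rcis r \<theta>) = Complex (ln r) \<theta>" "norm (rcis r \<theta>) = r" "Re (rcis r \<theta>) = r * cos \<theta>"
    "cos \<theta> > 0"
proof -
  have "rcis r \<theta> = exp (Complex (ln r) \<theta>)"
    using assms by (simp add: complex_eq_iff Re_exp Im_exp)
  moreover have "Ln (exp (Complex (ln r) \<theta>)) = Complex (ln r) \<theta>"
    by (rule Ln_exp) (use assms pi_gt_zero in auto)
  ultimately show "Ln (rcis r \<theta>) = Complex (ln r) \<theta>" by simp
  show "cos \<theta> > 0" using assms by (intro cos_gt_zero_pi) auto
qed (use assms in auto)

text \<open>A function \<open>\<Psi>\<close> on the half-plane that behaves like \<open>(i/\<nu>) ln v\<close> at the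
  boundary point \<open>0\<close> in non-tangential directions.  It maps into \<open>V\<close>, and the last
  assumption says that \<open>\<Psi> v\<close> is close to the complement of \<open>V\<close> when \<open>v\<close> is close to the
  imaginary axis.\<close>

locale repelling_log_chart =
  fixes \<Psi> :: "complex \<Rightarrow> complex" and V :: "complex set" and \<nu> K \<rho>\<^sub>0 :: real
  assumes hol: "\<Psi> holomorphic_on right_half_plane"
    and \<nu>: "\<nu> > 0"
    and Im_deriv: "\<And>v. Re v > 0 \<Longrightarrow> Im (deriv \<Psi> v) \<ge> 0"
    and lim: "\<And>M. M > 1 \<Longrightarrow>
          ((\<lambda>v. v * deriv \<Psi> v) \<longlongrightarrow> \<i> / of_real \<nu>) (at 0 within {v. norm v < M * Re v})"
    and into: "\<And>v. Re v > 0 \<Longrightarrow> \<Psi> v \<in> V"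
    and up: "\<And>w t. w \<in> V \<Longrightarrow> t \<ge> 0 \<Longrightarrow> w + \<i> * of_real t \<in> V"
    and K: "K > 0" and \<rho>\<^sub>0: "\<rho>\<^sub>0 > 0"
    and room: "\<And>v d. Re v > 0 \<Longrightarrow> norm v < \<rho>\<^sub>0 \<Longrightarrow> d > 0 \<Longrightarrow> ball (\<Psi> v) d \<subseteq> V \<Longrightarrow>
          d \<le> K * Re v * norm (deriv \<Psi> v)"
begin

lemma Im_mono_Re:
  assumes "0 < x" "x \<le> x'"
  shows "Im (\<Psi> (Complex x y)) \<le> Im (\<Psi> (Complex x' y))"
proof (rule DERIV_nonneg_imp_nondecreasing[OF assms(2)])
  fix u assume u: "x \<le> u" "u \<le> x'"
  have "(\<Psi> has_field_derivative deriv \<Psi> (Complex u y)) (at (Complex u y))"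
    using holomorphic_derivI[OF hol open_right_half_plane] u assms by auto
  then have "(\<Psi> has_derivative (\<lambda>h. deriv \<Psi> (Complex u y) * h)) (at (Complex u y))"
    by (simp add: has_field_derivative_def)
  moreover have "((\<lambda>s. Complex s y) has_derivative of_real) (at u)"
  proof -
    have "((\<lambda>s. of_real s + Complex 0 y) has_derivative of_real) (at u)"
      by (auto intro!: derivative_eq_intros)
    moreover have "(\<lambda>s. of_real s + Complex 0 y) = (\<lambda>s. Complex s y)"
      by (simp add: complex_eq_iff fun_eq_iff)
    ultimately show ?thesis by simp
  qed
  ultimately have "((\<lambda>s. \<Psi> (Complex s y)) has_derivative
      (\<lambda>h. deriv \<Psi> (Complex u y) * of_real h)) (at u)"
    by (rule has_derivative_compose[rotated])
  then have "((\<lambda>s. Im (\<Psi> (Complex s y))) has_derivative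
      (\<lambda>h. Im (deriv \<Psi> (Complex u y) * of_real h))) (at u)"
    by (rule has_derivative_Im)
  then have "((\<lambda>s. Im (\<Psi> (Complex s y))) has_derivative (\<lambda>h. h * Im (deriv \<Psi> (Complex u y)))) (at u)"
    by (simp add: mult.commute)
  moreover have "(\<lambda>h. h * Im (deriv \<Psi> (Complex u y))) = (*) (Im (deriv \<Psi> (Complex u y)))"
    by (simp add: fun_eq_iff mult.commute)
  ultimately have "((\<lambda>s. Im (\<Psi> (Complex s y))) has_real_derivative Im (deriv \<Psi> (Complex u y))) (at u)"
    by (simp add: has_field_derivative_def)
  then show "\<exists>d. ((\<lambda>s. Im (\<Psi> (Complex s y))) has_real_derivative d) (at u) \<and> d \<ge> 0"
    using Im_deriv[of "Complex u y"] u assms by auto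
qed

text \<open>\<open>in_image_W_iff\<close> will identify these abscissas with the points that lie in
  the image of every \<phi>_t.\<close>

definition lines :: "real set" where
  "lines = {x. \<forall>y. Complex x y \<in> V}"

lemma below_not_in:
  assumes "Complex x y \<notin> V" "y' \<le> y"
  shows "Complex x y' \<notin> V"
proof
  assume "Complex x y' \<in> V"
  then have "Complex x y' + \<i> * of_real (y - y') \<in> V" using assms by (intro up) auto
  moreover have "Complex x y' + \<i> * of_real (y - y') = Complex x y" by (simp add: complex_eq_iff)
  ultimately show False using assms by simp
qed

text \<open>Moving \<open>v\<close> horizontally to abscissa \<rho> raises Im \<Psi> and ends in a
  fixed cone, since |Im v| < \<rho>. This transfers upper bounds from the cone to unrestricted
  approach.\<close>

lemma Im_le_on_half_disc:
  assumes "Re v > 0" "norm v < \<rho>"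
  shows "\<exists>w. Im (\<Psi> v) \<le> Im (\<Psi> w) \<and> norm w < 2 * Re w \<and> \<rho> \<le> norm w \<and> norm w \<le> 2 * \<rho>"
proof (intro exI conjI)
  let ?w = "Complex \<rho> (Im v)"
  have b: "Re v < \<rho>" "\<bar>Im v\<bar> < \<rho>" "\<rho> > 0"
    using assms complex_Re_le_cmod[of v] abs_Im_le_cmod[of v] by linarith+
  show "Im (\<Psi> v) \<le> Im (\<Psi> ?w)"
    using Im_mono_Re[of "Re v" \<rho> "Im v"] assms(1) b by simp
  have "(norm ?w)\<^sup>2 = \<rho>\<^sup>2 + (Im v)\<^sup>2" by (simp add: cmod_power2)
  moreover have "(Im v)\<^sup>2 < \<rho>\<^sup>2" using b by (intro abs_le_square_iff[THEN iffD1] power2_strict_mono) auto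
  moreover have "(2 * \<rho>)\<^sup>2 = 4 * \<rho>\<^sup>2" by simp
  ultimately have "(norm ?w)\<^sup>2 < (2 * \<rho>)\<^sup>2" using zero_le_power2[of "Im v"] by linarith
  then have *: "norm ?w < 2 * \<rho>" by (rule power_less_imp_less_base) (use b in simp)
  then show "norm ?w < 2 * Re ?w" "norm ?w \<le> 2 * \<rho>" by auto
  show "\<rho> \<le> norm ?w" using complex_Re_le_cmod[of ?w] by simp
qed

lemma Re_half_disc_interval: "is_interval ((\<lambda>v. Re (\<Psi> v)) ` (right_half_plane \<inter> ball 0 \<rho>))"
proof -
  have "connected (right_half_plane \<inter> ball 0 \<rho>)"
    by (intro convex_connected convex_Int convex_right_half_plane convex_ball)
  moreover have "continuous_on (right_half_plane \<inter> ball 0 \<rho>) (\<lambda>v. Re (\<Psi> v))"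
    by (intro continuous_intros holomorphic_on_imp_continuous_on holomorphic_on_subset[OF hol]) auto
  ultimately show ?thesis
    by (simp add: is_interval_connected_1 connected_continuous_image)
qed

text \<open>Choosing the angle \<open>\<theta>\<close> close to \<open>\<pi>/2\<close>, the points of \<open>V\<close> over \<open>r e\<^sup>\<plusminus>\<^sup>i\<^sup>\<theta>\<close> are close to
  points outside \<open>V\<close>.  Everything below these is outside \<open>V\<close> as well, and the image of
  a small half-disc is caught between the two half-lines.\<close>

lemma walls:
  assumes \<delta>: "0 < \<delta>" "8 * \<nu> * \<delta> < pi"
  shows "\<exists>xl xr \<rho>. \<rho> > 0 \<and> xl \<notin> lines \<and> xr \<notin> lines \<and> xr - xl \<le> pi / \<nu> + 4 * \<delta> \<and>
           (\<forall>v. 0 < Re v \<longrightarrow> norm v < \<rho> \<longrightarrow> xl < Re (\<Psi> v) \<and> Re (\<Psi> v) < xr)"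
proof -
  \<comment> \<open>\<open>s\<close> is the gap between \<theta> and pi/2. The first bound puts
    \<theta>/\<nu> within \<delta> of pi/(2\<nu>); the second makes K cos \<theta> * 2/\<nu> at most
    \<delta>/2, which contradicts \<open>room\<close>.\<close>
  define s where "s = min (\<nu> * \<delta> / 2) (\<nu> * \<delta> / (4 * K))"
  have s: "0 < s" "s \<le> \<nu> * \<delta> / 2" "s \<le> \<nu> * \<delta> / (4 * K)" "s < pi / 8"
  proof -
    have "s \<le> \<nu> * \<delta> / 2" by (simp add: s_def)
    then show "s < pi / 8" using \<delta> \<nu> pi_gt_zero mult_pos_pos[OF \<nu> \<delta>(1)] by linarith
  qed (use \<nu> \<delta> K in \<open>auto simp: s_def\<close>)
  define \<theta> where "\<theta> = pi / 2 - s"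
  have \<theta>: "\<bar>\<theta>\<bar> < pi / 2" "\<bar>-\<theta>\<bar> < pi / 2" "0 < \<theta>" using s by (auto simp: \<theta>_def)
  have cos: "cos \<theta> = sin s" "0 < cos \<theta>"
    using sector_point(4)[OF \<theta>(1), of 1] by (auto simp: \<theta>_def cos_diff)
  have cs: "cos \<theta> \<le> s" using s cos sin_x_le_x[of s] by simp
  have th: "pi / 2 / \<nu> - \<delta> \<le> \<theta> / \<nu>" "\<theta> / \<nu> \<le> pi / 2 / \<nu>"
    using s \<nu> \<delta> by (auto simp: \<theta>_def field_simps)
  define M where "M = 2 / cos \<theta>"
  have M: "M \<ge> 2" using cos(2) by (simp add: M_def field_simps)
  define c where "c = \<i> / of_real \<nu>"
  have cln: "Re (c * Ln u) = - Im (Ln u) / \<nu>" "Im (c * Ln u) = Re (Ln u) / \<nu>" for u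
    using \<nu> by (auto simp: c_def Re_divide Im_divide power2_eq_square)
  note limM = lim[of M, folded c_def]
  \<comment> \<open>Passing from radius r to 2r/Q lowers ln|v|/\<nu> by 4\<delta>. After an error
    \<delta> this is a drop of 3\<delta>, while the missing points found below lie less than
    2\<delta> under \<Psi> \<open>v0\<close>.\<close>
  define Q where "Q = 2 * exp (4 * \<nu> * \<delta>)"
  have Q: "Q \<ge> 2" "ln (Q / 2) = 4 * \<nu> * \<delta>" using \<nu> \<delta> by (auto simp: Q_def)
  obtain R1 where R1: "R1 > 0"
    and R1': "\<And>r v w. 0 < r \<Longrightarrow> r < R1 \<Longrightarrow> norm v < M * Re v \<Longrightarrow> norm w < M * Re w \<Longrightarrow>
           norm v \<le> r \<Longrightarrow> norm w \<le> r \<Longrightarrow> r \<le> 2 * Q * norm v \<Longrightarrow> r \<le> 2 * Q * norm w \<Longrightarrow>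
           norm ((\<Psi> v - c * Ln v) - (\<Psi> w - c * Ln w)) \<le> \<delta>"
    using log_comparison[OF hol limM, of "2 * Q" \<delta>] M Q \<delta> by auto
  obtain R2 where R2: "R2 > 0"
    and R2': "\<And>v. norm v < M * Re v \<Longrightarrow> v \<noteq> 0 \<Longrightarrow> norm v < R2 \<Longrightarrow> norm (v * deriv \<Psi> v - c) < 1 / (2 * \<nu>)"
    using limM M \<nu> unfolding Lim_within by (auto simp: dist_norm elim!: allE[of _ "1 / (2 * \<nu>)"])
  define r where "r = min R1 (min R2 \<rho>\<^sub>0) / 2"
  have r: "0 < r" "r < R1" "r < R2" "r < \<rho>\<^sub>0" using R1 R2 \<rho>\<^sub>0 by (auto simp: r_def)
  have cmp: "\<bar>Re (\<Psi> v) + Im (Ln v) / \<nu> - (Re (\<Psi> w) + Im (Ln w) / \<nu>)\<bar> \<le> \<delta>"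
      "\<bar>Im (\<Psi> v) - Re (Ln v) / \<nu> - (Im (\<Psi> w) - Re (Ln w) / \<nu>)\<bar> \<le> \<delta>"
    if "norm v < M * Re v" "norm w < M * Re w"
      "norm v \<le> r" "norm w \<le> r" "r \<le> 2 * Q * norm v" "r \<le> 2 * Q * norm w" for v w
  proof -
    have "norm ((\<Psi> v - c * Ln v) - (\<Psi> w - c * Ln w)) \<le> \<delta>"
      by (rule R1'[OF r(1,2) that])
    then have "\<bar>Re ((\<Psi> v - c * Ln v) - (\<Psi> w - c * Ln w))\<bar> \<le> \<delta>"
      "\<bar>Im ((\<Psi> v - c * Ln v) - (\<Psi> w - c * Ln w))\<bar> \<le> \<delta>"
      using abs_Re_le_cmod abs_Im_le_cmod order.trans by blast+
    then show "\<bar>Re (\<Psi> v) + Im (Ln v) / \<nu> - (Re (\<Psi> w) + Im (Ln w) / \<nu>)\<bar> \<le> \<delta>"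
      "\<bar>Im (\<Psi> v) - Re (Ln v) / \<nu> - (Im (\<Psi> w) - Re (Ln w) / \<nu>)\<bar> \<le> \<delta>"
      by (simp_all only: minus_complex.sel cln)
  qed
  have coneM: "norm v < M * Re v" if "norm v < 2 * Re v" for v
  proof -
    have "Re v > 0" using that norm_ge_zero[of v] by linarith
    then have "2 * Re v \<le> M * Re v" using M by (intro mult_right_mono) auto
    then show ?thesis using that by linarith
  qed
  \<comment> \<open>A \<delta>-ball inside \<open>V\<close> would give \<delta> <= K cos \<theta> |v
    \<Psi>'(v)| with |v \<Psi>'(v)| < 2/\<nu>, too small by the choice of \<open>s\<close>.\<close>
  have missing: "\<exists>e. e \<notin> V \<and> norm (e - \<Psi> v) < \<delta>"
    if v: "v = rcis r t" and t: "t = \<theta> \<or> t = - \<theta>" for v t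
  proof (rule ccontr)
    assume "\<nexists>e. e \<notin> V \<and> norm (e - \<Psi> v) < \<delta>"
    then have sub: "ball (\<Psi> v) \<delta> \<subseteq> V" by (auto simp: dist_norm norm_minus_commute)
    have nv: "norm v = r" "Re v = r * cos \<theta>" using v t r by auto
    have "v \<noteq> 0" using nv r by auto
    have "norm v < M * Re v" using nv r cos by (simp add: M_def)
    from R2'[OF this \<open>v \<noteq> 0\<close>] nv r
    have "norm (v * deriv \<Psi> v - c) < 1 / (2 * \<nu>)" by simp
    moreover have "norm c = 1 / \<nu>" using \<nu> by (simp add: c_def norm_divide)
    ultimately have "norm (v * deriv \<Psi> v) < 1 / \<nu> + 1 / (2 * \<nu>)"
      using norm_triangle_sub[of "v * deriv \<Psi> v" c] by linarith
    then have "norm (v * deriv \<Psi> v) < 2 / \<nu>"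
      using \<nu> by (simp add: field_simps)
    then have "r * norm (deriv \<Psi> v) < 2 / \<nu>" by (simp add: norm_mult nv)
    moreover have "\<delta> \<le> K * Re v * norm (deriv \<Psi> v)"
      by (rule room[OF _ _ \<delta>(1) sub]) (use nv r cos in auto)
    then have "\<delta> \<le> K * cos \<theta> * (r * norm (deriv \<Psi> v))" by (simp add: nv mult_ac)
    ultimately have "\<delta> < K * cos \<theta> * (2 / \<nu>)"
      using K cos by (meson mult_strict_left_mono mult_pos_pos le_less_trans)
    also have "\<dots> \<le> K * s * (2 / \<nu>)"
      using K \<nu> cs by (intro mult_right_mono mult_left_mono) auto
    also have "\<dots> \<le> K * (\<nu> * \<delta> / (4 * K)) * (2 / \<nu>)"
      using K \<nu> s by (intro mult_right_mono mult_left_mono) auto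
    also have "\<dots> = \<delta> / 2" using K \<nu> by simp
    finally show False using \<delta> by simp
  qed
  define v0 where "v0 = complex_of_real r"
  \<comment> \<open>Since Re (c Ln u) = -arg u / \<nu>, the negative argument belongs to the right
    edge.\<close>
  define vr where "vr = rcis r (- \<theta>)"
  define vl where "vl = rcis r \<theta>"
  obtain er where er: "er \<notin> V" "norm (er - \<Psi> vr) < \<delta>" using missing[OF vr_def] by auto
  obtain el where el: "el \<notin> V" "norm (el - \<Psi> vl) < \<delta>" using missing[OF vl_def] by auto
  have rq: "r \<le> 2 * Q * r"
    using r Q by (simp add: mult_le_cancel_right1)
  have v0: "norm v0 = r" "norm v0 < 2 * Re v0" "Ln v0 = of_real (ln r)" using r by (auto simp: v0_def Ln_of_real)
  have vr: "norm vr = r" "norm vr < M * Re vr" "Ln vr = Complex (ln r) (- \<theta>)"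
    using sector_point[OF \<theta>(2) r(1)] cos r by (auto simp: vr_def M_def)
  have vl: "norm vl = r" "norm vl < M * Re vl" "Ln vl = Complex (ln r) \<theta>"
    using sector_point[OF \<theta>(1) r(1)] cos r by (auto simp: vl_def M_def)
  have cr: "\<bar>Re (\<Psi> vr) - \<theta> / \<nu> - Re (\<Psi> v0)\<bar> \<le> \<delta>" "\<bar>Im (\<Psi> vr) - Im (\<Psi> v0)\<bar> \<le> \<delta>"
    using cmp[OF vr(2) coneM[OF v0(2)]] rq vr v0 by auto
  have cl: "\<bar>Re (\<Psi> vl) + \<theta> / \<nu> - Re (\<Psi> v0)\<bar> \<le> \<delta>" "\<bar>Im (\<Psi> vl) - Im (\<Psi> v0)\<bar> \<le> \<delta>"
    using cmp[OF vl(2) coneM[OF v0(2)]] rq vl v0 by auto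
  have er': "\<bar>Re er - Re (\<Psi> vr)\<bar> < \<delta>" "\<bar>Im er - Im (\<Psi> vr)\<bar> < \<delta>"
    using er(2) abs_Re_le_cmod[of "er - \<Psi> vr"] abs_Im_le_cmod[of "er - \<Psi> vr"] by auto
  have el': "\<bar>Re el - Re (\<Psi> vl)\<bar> < \<delta>" "\<bar>Im el - Im (\<Psi> vl)\<bar> < \<delta>"
    using el(2) abs_Re_le_cmod[of "el - \<Psi> vl"] abs_Im_le_cmod[of "el - \<Psi> vl"] by auto
  define \<rho> where "\<rho> = r / Q"
  have \<rho>: "\<rho> > 0" using r Q by (simp add: \<rho>_def)
  have low: "Im (\<Psi> v) \<le> Im (\<Psi> v0) - 3 * \<delta>" if v: "Re v > 0" "norm v < \<rho>" for v
  proof -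
    obtain w where w: "Im (\<Psi> v) \<le> Im (\<Psi> w)" "norm w < 2 * Re w" "\<rho> \<le> norm w" "norm w \<le> 2 * \<rho>"
      using Im_le_on_half_disc[OF v] by blast
    have w0: "w \<noteq> 0" using w \<rho> by auto
    have wr: "norm w \<le> r"
    proof -
      have "2 * \<rho> \<le> Q * \<rho>" using Q \<rho> by (intro mult_right_mono) auto
      then show ?thesis using w(4) Q by (simp add: \<rho>_def)
    qed
    have rw: "r \<le> 2 * Q * norm w"
    proof -
      have "r = Q * \<rho>" using Q by (simp add: \<rho>_def)
      also have "\<dots> \<le> Q * norm w" using w Q by (intro mult_left_mono) auto
      also have "\<dots> \<le> 2 * Q * norm w" using Q by simp
      finally show ?thesis .
    qed
    have "\<bar>Im (\<Psi> w) - ln (norm w) / \<nu> - (Im (\<Psi> v0) - ln r / \<nu>)\<bar> \<le> \<delta>"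
      using cmp(2)[OF coneM[OF w(2)] coneM[OF v0(2)] wr _ rw] v0 rq w0 by (simp add: Re_Ln)
    moreover have "ln (norm w) \<le> ln r - 4 * \<nu> * \<delta>"
    proof -
      have "ln (norm w) \<le> ln (r / (Q / 2))" using w w0 by (intro ln_mono) (auto simp: \<rho>_def mult.commute)
      also have "\<dots> = ln r - ln (Q / 2)" using r Q ln_div[of r "Q / 2"] by simp
      finally show ?thesis using Q by simp
    qed
    then have "ln (norm w) / \<nu> \<le> ln r / \<nu> - 4 * \<delta>" using \<nu> by (simp add: field_simps)
    ultimately show ?thesis using w(1) by linarith
  qed
  \<comment> \<open>The complement of \<open>V\<close> is closed downwards, so a missing point above
    \<Psi> v on the same vertical line would make \<Psi> v missing too.\<close>
  have no: "Re (\<Psi> v) \<noteq> Re e" if v: "Re v > 0" "norm v < \<rho>"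
      and e: "e \<notin> V" "Im e > Im (\<Psi> v0) - 3 * \<delta>" for v e
  proof
    assume "Re (\<Psi> v) = Re e"
    moreover have "Complex (Re e) (Im (\<Psi> v)) \<notin> V"
      by (rule below_not_in[of _ "Im e"]) (use e low[OF v] in auto)
    ultimately show False using into[OF v(1)] by (metis complex.collapse)
  qed
  \<comment> \<open>A reference point of the small half-disc known to lie between the two walls. The
    abscissas over the half-disc form an interval that avoids both walls, so all of them lie
    between.\<close>
  define v1 where "v1 = complex_of_real (\<rho> / 2)"
  have v1: "Re v1 > 0" "norm v1 < \<rho>" using \<rho> by (auto simp: v1_def)
  have Rv1: "\<bar>Re (\<Psi> v1) - Re (\<Psi> v0)\<bar> \<le> \<delta>"
  proof -
    have n1: "norm v1 = \<rho> / 2" using \<rho> by (simp add: v1_def)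
    have "norm v1 < 2 * Re v1" "r \<le> 2 * Q * norm v1"
      using \<rho> Q n1 by (auto simp: v1_def \<rho>_def)
    moreover have "Im (Ln v1) = 0"
      unfolding v1_def using \<rho> by (subst Ln_of_real) auto
    moreover have "norm v1 \<le> r"
      using divide_left_mono[of 1 "2 * Q" r] Q r n1 by (simp add: \<rho>_def mult.commute)
    ultimately show ?thesis
      using cmp(1)[of v1 v0] coneM[of v1] coneM[OF v0(2)] v0 rq by simp
  qed
  \<comment> \<open>Here 8 \<nu> \<delta> < pi enters: the half-width must exceed the errors made at
    \<open>v1\<close>, at the edge point and at the missing point, each at most \<delta>.\<close>
  have big: "\<theta> / \<nu> > 3 * \<delta>"
  proof -
    have "pi / 2 / \<nu> > 4 * \<delta>" using \<delta> \<nu> by (simp add: field_simps)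
    then show ?thesis using th by linarith
  qed
  have nl: "Re el \<notin> lines" "Re er \<notin> lines"
    using el(1) er(1) unfolding lines_def by (metis (mono_tags) complex.collapse mem_Collect_eq)+
  have "Re el < Re (\<Psi> v) \<and> Re (\<Psi> v) < Re er" if v: "0 < Re v" "norm v < \<rho>" for v
  proof -
    let ?J = "(\<lambda>v. Re (\<Psi> v)) ` (right_half_plane \<inter> ball 0 \<rho>)"
    have J: "Re (\<Psi> v) \<in> ?J" "Re (\<Psi> v1) \<in> ?J" using v v1 by auto
    have nJ: "Re er \<notin> ?J" "Re el \<notin> ?J"
    proof -
      have "Im er > Im (\<Psi> v0) - 3 * \<delta>" using er'(2) cr(2) \<delta> by linarith
      then show "Re er \<notin> ?J" using no er(1) by fastforce
      have "Im el > Im (\<Psi> v0) - 3 * \<delta>" using el'(2) cl(2) \<delta> by linarith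
      then show "Re el \<notin> ?J" using no el(1) by fastforce
    qed
    have "Re el < Re (\<Psi> v1)" "Re (\<Psi> v1) < Re er"
      using Rv1 el'(1) er'(1) cl(1) cr(1) big by linarith+
    moreover have "x \<in> ?J" if "a \<in> ?J" "b \<in> ?J" "a \<le> x" "x \<le> b" for a b x
      using Re_half_disc_interval[of \<rho>] that unfolding is_interval_1 by blast
    ultimately show ?thesis using J nJ by (meson le_less_linear less_imp_le)
  qed
  moreover have "Re er - Re el \<le> pi / \<nu> + 4 * \<delta>"
  proof -
    have "Re er - Re el \<le> 2 * (\<theta> / \<nu>) + 4 * \<delta>" using er'(1) el'(1) cr(1) cl(1) by linarith
    also have "2 * (\<theta> / \<nu>) \<le> 2 * (pi / 2 / \<nu>)" using th by (intro mult_left_mono) auto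
    finally show ?thesis by simp
  qed
  ultimately show ?thesis using \<rho> nl by blast
qed

end

section \<open>Filling the strip and locating its edges\<close>

context repelling_log_chart
begin

text \<open>The counterpart of \<open>walls\<close>: by \<open>log_comparison\<close> on one circle,
  the arc between the arguments -\<theta> and \<theta> close to -pi/2 and pi/2 already spans almost
  the width pi/\<nu>, centred at the abscissa of \<Psi> r.\<close>

lemma spread:
  assumes \<delta>: "\<delta> > 0"
  shows "\<exists>R>0. \<forall>r. 0 < r \<longrightarrow> r < R \<longrightarrow>
           (\<exists>v w. 0 < Re v \<and> norm v = r \<and> 0 < Re w \<and> norm w = r \<and>
              Re (\<Psi> w) \<le> Re (\<Psi> (of_real r)) - pi / (2 * \<nu>) + \<delta> \<and>
              Re (\<Psi> (of_real r)) + pi / (2 * \<nu>) - \<delta> \<le> Re (\<Psi> v))"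
proof -
  define s where "s = min (\<nu> * \<delta> / 2) (pi / 4)"
  have s: "0 < s" "s \<le> \<nu> * \<delta> / 2" "s < pi / 2" 
  proof -
    have "s \<le> pi / 4" by (simp add: s_def)
    then show "s < pi / 2" using pi_gt_zero by linarith
  qed (use \<nu> \<delta> in \<open>auto simp: s_def\<close>)
  define \<theta> where "\<theta> = pi / 2 - s"
  have \<theta>: "\<bar>\<theta>\<bar> < pi / 2" "\<bar>-\<theta>\<bar> < pi / 2" "0 < \<theta>" using s by (auto simp: \<theta>_def)
  have cos: "0 < cos \<theta>" using sector_point(4)[OF \<theta>(1), of 1] by simp
  have th: "pi / (2 * \<nu>) - \<delta> / 2 \<le> \<theta> / \<nu>"
    using s \<nu> by (auto simp: \<theta>_def field_simps)
  define M where "M = 2 / cos \<theta>"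
  have M: "M \<ge> 2" using cos by (simp add: M_def field_simps)
  define c where "c = \<i> / of_real \<nu>"
  have cln: "Re (c * Ln u) = - Im (Ln u) / \<nu>" for u
    using \<nu> by (auto simp: c_def Re_divide power2_eq_square)
  obtain R where R: "R > 0"
    and R': "\<And>r v w. 0 < r \<Longrightarrow> r < R \<Longrightarrow> norm v < M * Re v \<Longrightarrow> norm w < M * Re w \<Longrightarrow>
           norm v \<le> r \<Longrightarrow> norm w \<le> r \<Longrightarrow> r \<le> 1 * norm v \<Longrightarrow> r \<le> 1 * norm w \<Longrightarrow>
           norm ((\<Psi> v - c * Ln v) - (\<Psi> w - c * Ln w)) \<le> \<delta> / 2"
  proof -
    have "M > 1" "M > 0" "(1::real) > 0" "\<delta> / 2 > 0" using M \<delta> by auto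
    then show ?thesis using log_comparison[OF hol lim[of M, folded c_def], of 1 "\<delta> / 2"] that by blast
  qed
  have "\<exists>v w. 0 < Re v \<and> norm v = r \<and> 0 < Re w \<and> norm w = r \<and>
              Re (\<Psi> w) \<le> Re (\<Psi> (of_real r)) - pi / (2 * \<nu>) + \<delta> \<and>
              Re (\<Psi> (of_real r)) + pi / (2 * \<nu>) - \<delta> \<le> Re (\<Psi> v)" if r: "0 < r" "r < R" for r
  proof -
    have *: "\<bar>Re (\<Psi> (rcis r t)) + t / \<nu> - Re (\<Psi> (of_real r))\<bar> \<le> \<delta> / 2" if t: "t = \<theta> \<or> t = - \<theta>" for t
    proof -
      have t2: "\<bar>t\<bar> < pi / 2" using t \<theta> by auto
      have "norm (rcis r t) < M * Re (rcis r t)"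
        using r cos t by (auto simp: M_def)
      moreover have "norm (of_real r :: complex) < M * Re (of_real r)"
        using M r mult_right_mono[OF M, of r] by simp
      ultimately have "norm ((\<Psi> (rcis r t) - c * Ln (rcis r t)) - (\<Psi> (of_real r) - c * Ln (of_real r))) \<le> \<delta> / 2"
        using R'[OF r] r by simp
      then have "\<bar>Re ((\<Psi> (rcis r t) - c * Ln (rcis r t)) - (\<Psi> (of_real r) - c * Ln (of_real r)))\<bar> \<le> \<delta> / 2"
        using abs_Re_le_cmod order.trans by blast
      moreover have "Im (Ln (rcis r t)) = t" "Im (Ln (of_real r :: complex)) = 0"
        using sector_point(1)[OF t2 r(1)] r by (auto simp: Ln_of_real)
      ultimately show ?thesis by (simp only: minus_complex.sel cln)
    qed
    show ?thesis
    proof (intro exI conjI)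
      show "0 < Re (rcis r (- \<theta>))" "norm (rcis r (- \<theta>)) = r" "0 < Re (rcis r \<theta>)" "norm (rcis r \<theta>) = r"
        using cos r by auto
      show "Re (\<Psi> (rcis r \<theta>)) \<le> Re (\<Psi> (of_real r)) - pi / (2 * \<nu>) + \<delta>"
        using *[of \<theta>] th by linarith
      show "Re (\<Psi> (of_real r)) + pi / (2 * \<nu>) - \<delta> \<le> Re (\<Psi> (rcis r (- \<theta>)))"
        using *[of "- \<theta>", OF disjI2[OF refl]] th by linarith
    qed
  qed
  then show ?thesis using R by blast
qed

text \<open>On the positive axis each halving of the radius changes ln|v|/\<nu> by -2\<eta> with
  error at most \<eta>, so Im \<Psi> drops by at least \<eta>. \<open>Im_le_on_half_disc\<close>
  extends the divergence to the whole half-disc.\<close>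

lemma Im_tends_to_minus_infinity:
  "\<exists>\<rho>>0. \<forall>v. 0 < Re v \<longrightarrow> norm v < \<rho> \<longrightarrow> Im (\<Psi> v) \<le> B"
proof -
  define c where "c = \<i> / of_real \<nu>"
  define \<eta> where "\<eta> = ln 2 / (2 * \<nu>)"
  have \<eta>: "\<eta> > 0" "ln 2 / \<nu> = 2 * \<eta>" using \<nu> by (auto simp: \<eta>_def)
  have cln: "Im (c * Ln u) = ln (norm u) / \<nu>" if "u \<noteq> 0" for u
    using \<nu> that by (auto simp: c_def Im_divide power2_eq_square Re_Ln)
  obtain R where R: "R > 0"
    and R': "\<And>r v w. 0 < r \<Longrightarrow> r < R \<Longrightarrow> norm v < 2 * Re v \<Longrightarrow> norm w < 2 * Re w \<Longrightarrow>
           norm v \<le> r \<Longrightarrow> norm w \<le> r \<Longrightarrow> r \<le> 2 * norm v \<Longrightarrow> r \<le> 2 * norm w \<Longrightarrow>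
           norm ((\<Psi> v - c * Ln v) - (\<Psi> w - c * Ln w)) \<le> \<eta>"
    using log_comparison[OF hol lim[of 2, folded c_def], of 2 \<eta>] \<eta> by auto
  have cmp: "Im (\<Psi> v) \<le> Im (\<Psi> (of_real r)) + ln (norm v) / \<nu> - ln r / \<nu> + \<eta>"
    if "0 < r" "r < R" "norm v < 2 * Re v" "norm v \<le> r" "r \<le> 2 * norm v" for v r
  proof -
    have "norm ((\<Psi> v - c * Ln v) - (\<Psi> (of_real r) - c * Ln (of_real r))) \<le> \<eta>"
      by (rule R'[of r]) (use that in auto)
    then have "\<bar>Im ((\<Psi> v - c * Ln v) - (\<Psi> (of_real r) - c * Ln (of_real r)))\<bar> \<le> \<eta>"
      using abs_Im_le_cmod order.trans by blast
    moreover have "Im (c * Ln v) = ln (norm v) / \<nu>" "Im (c * Ln (of_real r)) = ln r / \<nu>"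
      using cln[of v] cln[of "of_real r"] that by (force simp del: times_complex.sel)+
    ultimately have "\<bar>Im (\<Psi> v) - ln (norm v) / \<nu> - (Im (\<Psi> (of_real r)) - ln r / \<nu>)\<bar> \<le> \<eta>"
      by (simp only: minus_complex.sel)
    then show ?thesis by linarith
  qed
  define r where "r = (\<lambda>n::nat. R / 2 / 2 ^ n)"
  have r: "0 < r n" "r n < R" "r (Suc n) = r n / 2" for n
  proof -
    show "0 < r n" "r (Suc n) = r n / 2" using R by (auto simp: r_def)
    have "R / 2 / 2 ^ n \<le> R / 2 / 1" using R by (intro divide_left_mono) auto
    then show "r n < R" using R by (simp add: r_def)
  qed
  have dec: "Im (\<Psi> (of_real (r n))) \<le> Im (\<Psi> (of_real (r 0))) - real n * \<eta>" for n
  proof (induction n)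
    case (Suc n)
    have "Im (\<Psi> (of_real (r (Suc n)))) \<le> Im (\<Psi> (of_real (r n))) + ln (r n / 2) / \<nu> - ln (r n) / \<nu> + \<eta>"
      using cmp[of "r n" "of_real (r (Suc n))"] r[of n] r(1)[of "Suc n"]
      unfolding r(3) by simp
    moreover have "ln (r n / 2) / \<nu> = ln (r n) / \<nu> - 2 * \<eta>"
      using r(1)[of n] by (simp add: ln_divide_pos diff_divide_distrib \<eta>(2))
    ultimately show ?case using Suc by (simp add: algebra_simps)
  qed simp
  obtain n where n: "real n * \<eta> > Im (\<Psi> (of_real (r 0))) + \<eta> - B"
    using reals_Archimedean3[OF \<eta>(1)] by blast
  have "Im (\<Psi> v) \<le> B" if v: "0 < Re v" "norm v < r (Suc n)" for v
  proof -
    obtain w where w: "Im (\<Psi> v) \<le> Im (\<Psi> w)" "norm w < 2 * Re w" "r (Suc n) \<le> norm w" "norm w \<le> 2 * r (Suc n)"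
      using Im_le_on_half_disc[OF v] by blast
    have "Im (\<Psi> w) \<le> Im (\<Psi> (of_real (r n))) + ln (norm w) / \<nu> - ln (r n) / \<nu> + \<eta>"
      by (rule cmp) (use r[of n] w in auto)
    moreover have "ln (norm w) / \<nu> \<le> ln (r n) / \<nu>"
    proof -
      have "norm w > 0" using w(3) r(1)[of "Suc n"] by linarith
      then show ?thesis using w(4) r(3)[of n] \<nu> by (intro divide_right_mono ln_mono) auto
    qed
    ultimately show ?thesis using w(1) dec[of n] n by linarith
  qed
  then show ?thesis using r(1) by blast
qed

text \<open>\<open>walls\<close> bounds the oscillation of the image from above and
  \<open>spread\<close> from below by nearly the same width, so the centres of the arcs converge.
  The missing abscissas are only known to come arbitrarily close to the edges, hence the quantified
  \<delta>.\<close>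

theorem limit_strip:
  "\<exists>a. {a<..<a + pi / \<nu>} \<subseteq> lines \<and>
     (\<forall>\<delta>>0. \<exists>xl xr \<rho>. \<rho> > 0 \<and> xl \<notin> lines \<and> xr \<notin> lines \<and>
        a - \<delta> < xl \<and> xl \<le> a \<and> a + pi / \<nu> \<le> xr \<and> xr < a + pi / \<nu> + \<delta> \<and>
        (\<forall>v. 0 < Re v \<longrightarrow> norm v < \<rho> \<longrightarrow> xl < Re (\<Psi> v) \<and> Re (\<Psi> v) < xr))"
proof -
  define X where "X = (\<lambda>n::nat. Re (\<Psi> (of_real (inverse (real (Suc n))))))"
  have evX: "\<exists>N. \<forall>n\<ge>N. inverse (real (Suc n)) < e" if "e > 0" for e :: real
    using LIMSEQ_inverse_real_of_nat that unfolding LIMSEQ_iff by auto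
  have trap: "\<exists>xl xr \<rho> N. \<rho> > 0 \<and> xl \<notin> lines \<and> xr \<notin> lines \<and> xr - xl \<le> pi / \<nu> + 4 * \<delta> \<and>
      (\<forall>v. 0 < Re v \<longrightarrow> norm v < \<rho> \<longrightarrow> xl < Re (\<Psi> v) \<and> Re (\<Psi> v) < xr) \<and>
      (\<forall>n\<ge>N. xl \<le> X n - pi / (2 * \<nu>) + \<delta> \<and> X n + pi / (2 * \<nu>) - \<delta> \<le> xr)"
    if \<delta>: "0 < \<delta>" "8 * \<nu> * \<delta> < pi" for \<delta>
  proof -
    obtain xl xr \<rho> where w: "\<rho> > 0" "xl \<notin> lines" "xr \<notin> lines" "xr - xl \<le> pi / \<nu> + 4 * \<delta>"
        "\<And>v. 0 < Re v \<Longrightarrow> norm v < \<rho> \<Longrightarrow> xl < Re (\<Psi> v) \<and> Re (\<Psi> v) < xr"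
      using walls[OF \<delta>] by blast
    obtain R where R: "R > 0" and Rs: "\<And>r. 0 < r \<Longrightarrow> r < R \<Longrightarrow>
           (\<exists>v w. 0 < Re v \<and> norm v = r \<and> 0 < Re w \<and> norm w = r \<and>
              Re (\<Psi> w) \<le> Re (\<Psi> (of_real r)) - pi / (2 * \<nu>) + \<delta> \<and>
              Re (\<Psi> (of_real r)) + pi / (2 * \<nu>) - \<delta> \<le> Re (\<Psi> v))"
      using spread[OF \<delta>(1)] by blast
    obtain N where N: "\<And>n. n \<ge> N \<Longrightarrow> inverse (real (Suc n)) < min R \<rho>"
      using evX[of "min R \<rho>"] R w(1) by auto
    have "xl \<le> X n - pi / (2 * \<nu>) + \<delta> \<and> X n + pi / (2 * \<nu>) - \<delta> \<le> xr" if "n \<ge> N" for n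
    proof -
      have r: "0 < inverse (real (Suc n))" "inverse (real (Suc n)) < R" "inverse (real (Suc n)) < \<rho>"
        using N[OF that] by auto
      obtain v u where vu: "0 < Re v" "norm v = inverse (real (Suc n))" "0 < Re u" "norm u = inverse (real (Suc n))"
          "Re (\<Psi> u) \<le> X n - pi / (2 * \<nu>) + \<delta>" "X n + pi / (2 * \<nu>) - \<delta> \<le> Re (\<Psi> v)"
        using Rs[OF r(1,2)] unfolding X_def by blast
      have "xl < Re (\<Psi> u)" "Re (\<Psi> v) < xr"
        using w(5)[OF vu(3)] w(5)[OF vu(1)] vu(2,4) r(3) by auto
      with vu show ?thesis by linarith
    qed
    with w show ?thesis by blast
  qed
  have piv: "pi / \<nu> = 2 * (pi / (2 * \<nu>))" "pi / \<nu> > 0" using \<nu> by auto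
  have "Cauchy X"
  proof (rule metric_CauchyI)
    fix e :: real assume e: "e > 0"
    \<comment> \<open>Two arcs of width pi/\<nu> - 2\<delta> between walls at distance at most
      pi/\<nu> + 4\<delta> have centres at most 6\<delta> apart. The second entry secures 8 \<nu>
      \<delta> < pi.\<close>
    define \<delta> where "\<delta> = min (e / 7) (pi / (9 * \<nu>))"
    have \<delta>: "0 < \<delta>" "8 * \<nu> * \<delta> < pi" "\<delta> \<le> e / 7"
    proof -
      have "\<nu> * \<delta> \<le> \<nu> * (pi / (9 * \<nu>))" using \<nu> by (intro mult_left_mono) (auto simp: \<delta>_def)
      also have "\<nu> * (pi / (9 * \<nu>)) = pi / 9" using \<nu> by simp
      finally show "8 * \<nu> * \<delta> < pi" using pi_gt_zero by linarith
    qed (use e \<nu> in \<open>auto simp: \<delta>_def\<close>)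
    obtain xl xr :: real and N where "xr - xl \<le> pi / \<nu> + 4 * \<delta>"
      and N: "\<And>n. n \<ge> N \<Longrightarrow> xl \<le> X n - pi / (2 * \<nu>) + \<delta> \<and> X n + pi / (2 * \<nu>) - \<delta> \<le> xr"
      using trap[OF \<delta>(1,2)] by blast
    then have "dist (X m) (X n) < e" if "m \<ge> N" "n \<ge> N" for m n
      using N[OF that(1)] N[OF that(2)] \<delta> piv e unfolding dist_real_def abs_less_iff by linarith
    then show "\<exists>N. \<forall>m\<ge>N. \<forall>n\<ge>N. dist (X m) (X n) < e" by blast
  qed
  then obtain x0 where x0: "X \<longlonglongrightarrow> x0" using Cauchy_convergent_iff convergent_def by blast
  define a where "a = x0 - pi / (2 * \<nu>)"
  have sub: "x \<in> lines" if x: "a < x" "x < a + pi / \<nu>" for x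
  proof -
    define \<delta> where "\<delta> = min (x - a) (a + pi / \<nu> - x) / 2"
    have "\<delta> \<le> (x - a) / 2" "\<delta> \<le> (a + pi / \<nu> - x) / 2" by (auto simp: \<delta>_def)
    then have \<delta>: "0 < \<delta>" "a + 2 * \<delta> \<le> x" "x \<le> a + pi / \<nu> - 2 * \<delta>"
      using x by (auto simp: \<delta>_def)
    \<comment> \<open>A half-disc so small that Im \<Psi> <= y there still has image points on both
      sides of x. One over x exists by connectedness and lies below height y; upward translation
      reaches y.\<close>
    have "Complex x y \<in> V" for y
    proof -
      obtain \<rho> where \<rho>: "\<rho> > 0" and low: "\<And>v. 0 < Re v \<Longrightarrow> norm v < \<rho> \<Longrightarrow> Im (\<Psi> v) \<le> y"
        using Im_tends_to_minus_infinity[of y] by blast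
      obtain R where R: "R > 0" and Rs: "\<And>r. 0 < r \<Longrightarrow> r < R \<Longrightarrow>
           (\<exists>v w. 0 < Re v \<and> norm v = r \<and> 0 < Re w \<and> norm w = r \<and>
              Re (\<Psi> w) \<le> Re (\<Psi> (of_real r)) - pi / (2 * \<nu>) + \<delta> \<and>
              Re (\<Psi> (of_real r)) + pi / (2 * \<nu>) - \<delta> \<le> Re (\<Psi> v))"
        using spread[OF \<delta>(1)] by blast
      obtain N where N: "\<And>n. n \<ge> N \<Longrightarrow> inverse (real (Suc n)) < min R \<rho>"
        using evX[of "min R \<rho>"] R \<rho> by auto
      obtain N' where N': "\<And>n. n \<ge> N' \<Longrightarrow> \<bar>X n - x0\<bar> < \<delta>"
        using x0 \<delta>(1) unfolding LIMSEQ_iff by (auto simp: dist_real_def)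
      define n where "n = max N N'"
      have r: "0 < inverse (real (Suc n))" "inverse (real (Suc n)) < R" "inverse (real (Suc n)) < \<rho>"
        using N[of n] by (auto simp: n_def)
      obtain v u where vu: "0 < Re v" "norm v = inverse (real (Suc n))" "0 < Re u" "norm u = inverse (real (Suc n))"
          "Re (\<Psi> u) \<le> X n - pi / (2 * \<nu>) + \<delta>" "X n + pi / (2 * \<nu>) - \<delta> \<le> Re (\<Psi> v)"
        using Rs[OF r(1,2)] unfolding X_def by blast
      have "\<bar>X n - x0\<bar> < \<delta>" using N'[of n] by (simp add: n_def)
      then have b: "Re (\<Psi> u) \<le> x" "x \<le> Re (\<Psi> v)"
        using vu(5,6) \<delta> piv unfolding a_def by linarith+
      have "Re (\<Psi> u) \<in> (\<lambda>v. Re (\<Psi> v)) ` (right_half_plane \<inter> ball 0 \<rho>)"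
           "Re (\<Psi> v) \<in> (\<lambda>v. Re (\<Psi> v)) ` (right_half_plane \<inter> ball 0 \<rho>)"
        using vu r(3) by auto
      then have "x \<in> (\<lambda>v. Re (\<Psi> v)) ` (right_half_plane \<inter> ball 0 \<rho>)"
        using Re_half_disc_interval[of \<rho>] b unfolding is_interval_1 by blast
      then obtain z where z: "0 < Re z" "norm z < \<rho>" "x = Re (\<Psi> z)" by auto
      have "\<Psi> z + \<i> * of_real (y - Im (\<Psi> z)) \<in> V" using low[OF z(1,2)] into[OF z(1)] by (intro up) auto
      moreover have "\<Psi> z + \<i> * of_real (y - Im (\<Psi> z)) = Complex x y" by (simp add: z(3) complex_eq_iff)
      ultimately show ?thesis by simp
    qed
    then show ?thesis by (simp add: lines_def)
  qed
  have "\<exists>xl xr \<rho>. \<rho> > 0 \<and> xl \<notin> lines \<and> xr \<notin> lines \<and>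
        a - \<delta> < xl \<and> xl \<le> a \<and> a + pi / \<nu> \<le> xr \<and> xr < a + pi / \<nu> + \<delta> \<and>
        (\<forall>v. 0 < Re v \<longrightarrow> norm v < \<rho> \<longrightarrow> xl < Re (\<Psi> v) \<and> Re (\<Psi> v) < xr)" if d: "\<delta> > 0" for \<delta>
  proof -
    define d where "d = min (\<delta> / 7) (pi / (9 * \<nu>))"
    have dd: "0 < d" "8 * \<nu> * d < pi" "d \<le> \<delta> / 7" "d \<le> pi / \<nu> / 9"
    proof -
      have "\<nu> * d \<le> \<nu> * (pi / (9 * \<nu>))" using \<nu> by (intro mult_left_mono) (auto simp: d_def)
      also have "\<nu> * (pi / (9 * \<nu>)) = pi / 9" using \<nu> by simp
      finally show "8 * \<nu> * d < pi" using pi_gt_zero by linarith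
      have "d \<le> pi / (9 * \<nu>)" by (simp add: d_def)
      then show "d \<le> pi / \<nu> / 9" by (simp add: mult.commute)
    qed (use d \<nu> in \<open>auto simp: d_def\<close>)
    obtain xl xr \<rho> N where w: "\<rho> > 0" "xl \<notin> lines" "xr \<notin> lines" "xr - xl \<le> pi / \<nu> + 4 * d"
      "\<And>v. 0 < Re v \<Longrightarrow> norm v < \<rho> \<Longrightarrow> xl < Re (\<Psi> v) \<and> Re (\<Psi> v) < xr"
      and N: "\<And>n. n \<ge> N \<Longrightarrow> xl \<le> X n - pi / (2 * \<nu>) + d \<and> X n + pi / (2 * \<nu>) - d \<le> xr"
      using trap[OF dd(1,2)] by blast
    have "xl \<le> x0 - pi / (2 * \<nu>) + d"
      by (rule LIMSEQ_le_const[of "\<lambda>n. X n - pi / (2 * \<nu>) + d"])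
         (use N in \<open>auto intro!: tendsto_intros x0\<close>)
    moreover have "x0 + pi / (2 * \<nu>) - d \<le> xr"
      by (rule LIMSEQ_le_const2[of "\<lambda>n. X n + pi / (2 * \<nu>) - d"])
         (use N in \<open>auto intro!: tendsto_intros x0\<close>)
    \<comment> \<open>No wall can stand inside the open strip; the approximate positions then decide
      on which side each one lies.\<close>
    moreover have "xl \<le> a \<or> a + pi / \<nu> \<le> xl" "xr \<le> a \<or> a + pi / \<nu> \<le> xr"
      using w(2,3) sub not_le by blast+
    ultimately have "a - \<delta> < xl" "xl \<le> a" "a + pi / \<nu> \<le> xr" "xr < a + pi / \<nu> + \<delta>"
    proof -
      define q where "q = pi / (2 * \<nu>)"
      have q: "pi / \<nu> = 2 * q" "q > 0" using \<nu> by (auto simp: q_def)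
      have a: "a = x0 - q" by (simp add: a_def q_def)
      note w4 = w(4)[unfolded q(1)] and dq = dd(4)[unfolded q(1)]
      assume "xl \<le> x0 - pi / (2 * \<nu>) + d" "x0 + pi / (2 * \<nu>) - d \<le> xr"
      then have 1: "xl \<le> x0 - q + d" and 2: "x0 + q - d \<le> xr" by (simp_all add: q_def)
      assume 3: "xl \<le> a \<or> a + pi / \<nu> \<le> xl" and 4: "xr \<le> a \<or> a + pi / \<nu> \<le> xr"
      show xl: "xl \<le> a" using 3 1 dq q(2) unfolding a q(1) by linarith
      show xr: "a + pi / \<nu> \<le> xr" using 4 2 dq q(2) unfolding a q(1) by linarith
      show "xr < a + pi / \<nu> + \<delta>" using w4 xl dd(1,3) d unfolding q(1) by linarith
      show "a - \<delta> < xl" using w4 xr dd(1,3) d unfolding q(1) by linarith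
    qed
    then show ?thesis using w by blast
  qed
  with sub show ?thesis by (intro exI[of _ a]) auto
qed

end

subsection \<open>The generator at a repelling fixed point\<close>

lemma radius_in_stolz_region:
  assumes "\<sigma> \<in> unit_circle" "0 \<le> s" "s < 1"
  shows "of_real s * \<sigma> \<in> stolz_region \<sigma> 2" "norm (\<sigma> - of_real s * \<sigma>) = 1 - s" "norm (of_real s * \<sigma>) = s"
proof -
  have "\<sigma> - of_real s * \<sigma> = of_real (1 - s) * \<sigma>" by (simp add: algebra_simps)
  then show *: "norm (\<sigma> - of_real s * \<sigma>) = 1 - s" "norm (of_real s * \<sigma>) = s"
    using assms by (simp_all add: norm_mult del: of_real_diff)
  show "of_real s * \<sigma> \<in> stolz_region \<sigma> 2"
    using assms unfolding stolz_region_def by (simp add: *)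
qed

text \<open>Mean value inequality for f(z) - d z on a radial segment, whose outer endpoint is then
  sent to \<sigma>; the radial limit of \<open>f\<close> supplies the boundary value.\<close>

lemma radial_angular_derivative:
  assumes f: "f holomorphic_on unit_disc" and \<sigma>: "\<sigma> \<in> unit_circle"
    and f1: "nontangential_limit f \<sigma> \<sigma>" and f2: "nontangential_limit (deriv f) \<sigma> d"
  shows "((\<lambda>r. (\<sigma> - f (of_real r * \<sigma>)) / of_real (1 - r)) \<longlongrightarrow> \<sigma> * d) (at_left 1)"
proof (rule tendstoI)
  fix e :: real assume e: "e > 0"
  have "((deriv f) \<longlongrightarrow> d) (at \<sigma> within stolz_region \<sigma> 2)"
    using f2 unfolding nontangential_limit_def by simp
  then obtain \<delta> where \<delta>: "\<delta> > 0"
    and d: "\<And>z. z \<in> stolz_region \<sigma> 2 \<Longrightarrow> z \<noteq> \<sigma> \<Longrightarrow> dist z \<sigma> < \<delta> \<Longrightarrow> dist (deriv f z) d < e / 2"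
    using e unfolding Lim_within by (auto elim!: allE[of _ "e / 2"])
  define I where "I = {max 0 (1 - \<delta>)<..<1}"
  define S where "S = (\<lambda>s. of_real s * \<sigma>) ` I"
  have I: "0 \<le> s" "s < 1" "1 - s < \<delta>" if "s \<in> I" for s using that by (auto simp: I_def)
  have "linear (\<lambda>s. of_real s * \<sigma>)" by (auto intro!: linearI simp: algebra_simps scaleR_conv_of_real)
  then have S: "convex S" unfolding S_def I_def by (intro convex_linear_image) auto
  have bd: "norm ((f x - d * x) - (f y - d * y)) \<le> e / 2 * norm (x - y)" if "x \<in> S" "y \<in> S" for x y
  proof (rule field_differentiable_bound[OF S _ _ that])
    fix z assume "z \<in> S"
    then obtain s where s: "s \<in> I" "z = of_real s * \<sigma>" by (auto simp: S_def)
    note R = radius_in_stolz_region[OF \<sigma> I(1,2)[OF s(1)], folded s(2)]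
    have z: "z \<in> stolz_region \<sigma> 2" "z \<in> unit_disc" "z \<noteq> \<sigma>" "dist z \<sigma> < \<delta>"
      using R I[OF s(1)] by (auto simp: dist_norm norm_minus_commute stolz_region_def)
    have "(f has_field_derivative deriv f z) (at z within S)"
      using holomorphic_derivI[OF f open_ball z(2)] .
    then show "((\<lambda>x. f x - d * x) has_field_derivative deriv f z - d) (at z within S)"
      by (auto intro!: derivative_eq_intros)
    show "norm (deriv f z - d) \<le> e / 2" using d[OF z(1,3,4)] by (simp add: dist_norm)
  qed
  have tend: "((\<lambda>s. of_real s * \<sigma>) \<longlongrightarrow> \<sigma>) (at_left 1)"
    by (rule tendsto_eq_intros refl | simp)+
  have evI: "\<forall>\<^sub>F s in at_left 1. s \<in> I"
    unfolding I_def using \<delta> by (intro eventually_at_leftI[of "max 0 (1 - \<delta>)"]) auto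
  have "filterlim (\<lambda>s. of_real s * \<sigma>) (at \<sigma> within stolz_region \<sigma> 2) (at_left 1)"
    unfolding filterlim_at
  proof
    show "\<forall>\<^sub>F s in at_left 1. of_real s * \<sigma> \<in> stolz_region \<sigma> 2 \<and> of_real s * \<sigma> \<noteq> \<sigma>"
    proof (rule eventually_mono[OF evI])
      fix s assume s: "s \<in> I"
      note R = radius_in_stolz_region[OF \<sigma> I(1,2)[OF s]]
      have "of_real s * \<sigma> \<noteq> \<sigma>" using R(2) I(2)[OF s] by (metis diff_self less_irrefl norm_zero right_minus_eq)
      with R(1) show "of_real s * \<sigma> \<in> stolz_region \<sigma> 2 \<and> of_real s * \<sigma> \<noteq> \<sigma>" ..
    qed
  qed (rule tend)
  then have fl: "((\<lambda>s. f (of_real s * \<sigma>)) \<longlongrightarrow> \<sigma>) (at_left 1)"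
    by (rule filterlim_compose[rotated]) (use f1 in \<open>simp add: nontangential_limit_def\<close>)
  show "\<forall>\<^sub>F r in at_left 1. dist ((\<sigma> - f (of_real r * \<sigma>)) / of_real (1 - r)) (\<sigma> * d) < e"
  proof (rule eventually_mono[OF evI])
    fix r assume r: "r \<in> I"
    have "norm ((f (of_real r * \<sigma>) - d * (of_real r * \<sigma>)) - (\<sigma> - d * \<sigma>))
        \<le> e / 2 * norm (of_real r * \<sigma> - \<sigma>)"
    proof (rule tendsto_le[of "at_left (1::real)"])
      show "((\<lambda>s. norm ((f (of_real r * \<sigma>) - d * (of_real r * \<sigma>)) - (f (of_real s * \<sigma>) - d * (of_real s * \<sigma>))))
          \<longlongrightarrow> norm ((f (of_real r * \<sigma>) - d * (of_real r * \<sigma>)) - (\<sigma> - d * \<sigma>))) (at_left 1)"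
        by (intro tendsto_intros fl tend)
      show "((\<lambda>s. e / 2 * norm (of_real r * \<sigma> - of_real s * \<sigma>)) \<longlongrightarrow> e / 2 * norm (of_real r * \<sigma> - \<sigma>)) (at_left 1)"
        by (intro tendsto_intros tend)
      show "\<forall>\<^sub>F s in at_left 1. norm ((f (of_real r * \<sigma>) - d * (of_real r * \<sigma>)) - (f (of_real s * \<sigma>) - d * (of_real s * \<sigma>)))
          \<le> e / 2 * norm (of_real r * \<sigma> - of_real s * \<sigma>)"
        by (rule eventually_mono[OF evI], rule bd) (use r in \<open>auto simp: S_def\<close>)
    qed auto
    moreover have "(f (of_real r * \<sigma>) - d * (of_real r * \<sigma>)) - (\<sigma> - d * \<sigma>)
        = - ((\<sigma> - f (of_real r * \<sigma>)) - of_real (1 - r) * (\<sigma> * d))"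
      by (simp add: algebra_simps)
    ultimately have "norm ((\<sigma> - f (of_real r * \<sigma>)) - of_real (1 - r) * (\<sigma> * d)) \<le> e / 2 * (1 - r)"
      using radius_in_stolz_region(2)[OF \<sigma> I(1,2)[OF r]] by (simp only: norm_minus_cancel norm_minus_commute)
    moreover have r1: "1 - r > 0" using I[OF r] by simp
    moreover have "(\<sigma> - f (of_real r * \<sigma>)) / of_real (1 - r) - \<sigma> * d
        = ((\<sigma> - f (of_real r * \<sigma>)) - of_real (1 - r) * (\<sigma> * d)) / of_real (1 - r)"
      using r1 by (simp add: field_simps)
    ultimately have "norm ((\<sigma> - f (of_real r * \<sigma>)) / of_real (1 - r) - \<sigma> * d) \<le> e / 2"
      by (simp only: norm_divide norm_of_real) (simp add: divide_le_eq)
    then show "dist ((\<sigma> - f (of_real r * \<sigma>)) / of_real (1 - r)) (\<sigma> * d) < e"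
      using e by (simp add: dist_norm)
  qed
qed

lemma right_derivative_nonneg:
  assumes "(y has_real_derivative D) (at 0 within {0..})" "\<And>t. t \<ge> 0 \<Longrightarrow> y 0 \<le> y t"
  shows "D \<ge> 0"
proof (rule tendsto_lowerbound)
  show "((\<lambda>t. (y t - y 0) / (t - 0)) \<longlongrightarrow> D) (at 0 within {0..})"
    using assms(1) by (simp add: has_field_derivative_iff)
  show "\<forall>\<^sub>F t in at 0 within {0..}. 0 \<le> (y t - y 0) / (t - 0)"
    unfolding eventually_at_filter using assms(2) by (intro always_eventually) auto
  show "at (0::real) within {0..} \<noteq> bot"
    by (simp add: at_within_Ici_at_right)
qed

text \<open>\<open>G\<close> is the infinitesimal generator. Both final cases obtain it by pulling
  back the linear vector field of the model under \<open>h\<close>, through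
  \<open>flow_from_linearization\<close>.\<close>

locale disc_flow =
  fixes \<phi> :: "real \<Rightarrow> complex \<Rightarrow> complex" and G :: "complex \<Rightarrow> complex"
  assumes semigroup: "holomorphic_semigroup \<phi>"
    and G_hol: "G holomorphic_on unit_disc"
    and flow: "\<And>z t. z \<in> unit_disc \<Longrightarrow> t \<ge> 0 \<Longrightarrow>
          ((\<lambda>s. \<phi> s z) has_vector_derivative G (\<phi> t z)) (at t within {0..})"
begin

lemma \<phi>_hol: "t \<ge> 0 \<Longrightarrow> \<phi> t holomorphic_on unit_disc"
  and \<phi>_sub: "t \<ge> 0 \<Longrightarrow> \<phi> t ` unit_disc \<subseteq> unit_disc"
  and \<phi>_0: "z \<in> unit_disc \<Longrightarrow> \<phi> 0 z = z"
  using semigroup unfolding holomorphic_semigroup_def by blast+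

lemma \<phi>_in: "t \<ge> 0 \<Longrightarrow> z \<in> unit_disc \<Longrightarrow> \<phi> t z \<in> unit_disc"
  using \<phi>_sub by blast

lemma Re_cayley_flow_derivative:
  assumes \<omega>: "\<omega> \<in> unit_circle" and z: "z \<in> unit_disc" and t: "t \<ge> 0"
  shows "((\<lambda>s. exp (- c * s) * Re (cayley \<omega> (\<phi> s z))) has_real_derivative
           exp (- c * t) * (Re (2 * \<omega> / (\<omega> - \<phi> t z)\<^sup>2 * G (\<phi> t z)) - c * Re (cayley \<omega> (\<phi> t z))))
         (at t within {0..})"
proof -
  have "\<phi> t z \<noteq> \<omega>" using disc_ne_circle[OF \<phi>_in[OF t z] \<omega>] .
  then have "(cayley \<omega> has_field_derivative 2 * \<omega> / (\<omega> - \<phi> t z)\<^sup>2) (at (\<phi> t z) within (\<lambda>s. \<phi> s z) ` {0..})"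
    by (rule cayley_field_derivative)
  from field_vector_diff_chain_within[OF flow[OF z t] this]
  have "((\<lambda>s. cayley \<omega> (\<phi> s z)) has_vector_derivative G (\<phi> t z) * (2 * \<omega> / (\<omega> - \<phi> t z)\<^sup>2)) (at t within {0..})"
    by (simp add: o_def)
  from bounded_linear.has_vector_derivative[OF bounded_linear_Re this]
  have "((\<lambda>s. Re (cayley \<omega> (\<phi> s z))) has_real_derivative Re (2 * \<omega> / (\<omega> - \<phi> t z)\<^sup>2 * G (\<phi> t z))) (at t within {0..})"
    by (simp only: has_real_derivative_iff_has_vector_derivative mult.commute[of "G (\<phi> t z)"])
  moreover have "((\<lambda>s. exp (- c * s)) has_real_derivative exp (- c * t) * (- c)) (at t within {0..})"
    by (auto intro!: derivative_eq_intros)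
  ultimately show ?thesis
    by (rule DERIV_cong[OF DERIV_mult[rotated]]) (simp only: algebra_simps)
qed

text \<open>Both sides of \<open>J\<close> agree at t = 0, so the right derivative of their
  difference is nonnegative there. It is used with c = l at the repelling point and c = 0 at a
  boundary Denjoy-Wolff point.\<close>

lemma Re_generator_ge:
  assumes \<omega>: "\<omega> \<in> unit_circle" and z: "z \<in> unit_disc"
    and J: "\<And>t. t \<ge> 0 \<Longrightarrow> Re (cayley \<omega> z) \<le> exp (- c * t) * Re (cayley \<omega> (\<phi> t z))"
  shows "c * Re (cayley \<omega> z) \<le> Re (2 * \<omega> / (\<omega> - z)\<^sup>2 * G z)"
  using right_derivative_nonneg[OF Re_cayley_flow_derivative[OF \<omega> z order.refl, of c]] J \<phi>_0[OF z]
  by simp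

end

locale repelling_flow = disc_flow +
  fixes \<sigma> :: complex and l :: real
  assumes repelling: "repelling_fixed_point \<phi> \<sigma> l"
begin

lemma \<sigma>: "\<sigma> \<in> unit_circle" and l: "l < 0"
  using repelling unfolding repelling_fixed_point_def by auto

lemma radial_quotient:
  assumes "t \<ge> 0"
  shows "((\<lambda>r. norm (\<sigma> - \<phi> t (of_real r * \<sigma>)) / (1 - r)) \<longlongrightarrow> exp (- l * t)) (at_left 1)"
    "((\<lambda>r. \<phi> t (of_real r * \<sigma>)) \<longlongrightarrow> \<sigma>) (at_left 1)"
proof -
  have *: "((\<lambda>r. (\<sigma> - \<phi> t (of_real r * \<sigma>)) / of_real (1 - r)) \<longlongrightarrow> \<sigma> * of_real (exp (- l * t))) (at_left 1)"
    using repelling assms unfolding repelling_fixed_point_def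
    by (intro radial_angular_derivative \<phi>_hol) auto
  from tendsto_norm[OF this]
  have "((\<lambda>r. norm ((\<sigma> - \<phi> t (of_real r * \<sigma>)) / of_real (1 - r))) \<longlongrightarrow> exp (- l * t)) (at_left 1)"
    using \<sigma> by (simp add: norm_mult)
  moreover have "\<forall>\<^sub>F r in at_left 1. norm ((\<sigma> - \<phi> t (of_real r * \<sigma>)) / of_real (1 - r))
      = norm (\<sigma> - \<phi> t (of_real r * \<sigma>)) / (1 - r)"
    by (rule eventually_at_leftI[of 0]) (auto simp only: norm_divide norm_of_real, auto)
  ultimately show "((\<lambda>r. norm (\<sigma> - \<phi> t (of_real r * \<sigma>)) / (1 - r)) \<longlongrightarrow> exp (- l * t)) (at_left 1)"
    by (rule Lim_transform_eventually)
  have "((\<lambda>r. \<sigma> - (\<sigma> - \<phi> t (of_real r * \<sigma>)) / of_real (1 - r) * of_real (1 - r))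
      \<longlongrightarrow> \<sigma> - \<sigma> * of_real (exp (- l * t)) * of_real (1 - 1)) (at_left 1)"
    by (intro tendsto_intros *)
  then have "((\<lambda>r. \<sigma> - (\<sigma> - \<phi> t (of_real r * \<sigma>)) / of_real (1 - r) * of_real (1 - r)) \<longlongrightarrow> \<sigma>) (at_left 1)"
    by simp
  then show "((\<lambda>r. \<phi> t (of_real r * \<sigma>)) \<longlongrightarrow> \<sigma>) (at_left 1)"
    by (rule Lim_transform_eventually) (rule eventually_at_leftI[of 0], auto)
qed

lemma Julia_at_\<sigma>:
  assumes z: "z \<in> unit_disc" and t: "t \<ge> 0"
  shows "Re (cayley \<sigma> z) \<le> exp (- l * t) * Re (cayley \<sigma> (\<phi> t z))"
proof -
  define r where "r = (\<lambda>n::nat. 1 - inverse (real (Suc n)))"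
  have r: "0 \<le> r n" "r n < 1" for n by (auto simp: r_def field_simps)
  have "r \<longlonglongrightarrow> 1 - 0" unfolding r_def by (intro tendsto_intros LIMSEQ_inverse_real_of_nat)
  then have rl: "filterlim r (at_left 1) sequentially"
    unfolding filterlim_at using r by (auto intro!: always_eventually simp: less_imp_neq)
  define x where "x = (\<lambda>n. of_real (r n) * \<sigma>)"
  \<comment> \<open>From 1 - |\<phi>|^2 <= 2 |\<sigma> - \<phi>| and 1 - r^2 = (1 - r)(1 + r); the
    last factor tends to 1, so the dilation is the angular derivative.\<close>
  define \<alpha> where "\<alpha> = (\<lambda>n. norm (\<sigma> - \<phi> t (x n)) / (1 - r n) * (2 / (1 + r n)))"
  have x: "x n \<in> unit_disc" "norm (x n) = r n" for n
    using radius_in_stolz_region[OF \<sigma> r] r(2)[of n] by (auto simp: x_def)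
  have "1 - (norm (\<phi> t (x n)))\<^sup>2 \<le> \<alpha> n * (1 - (norm (x n))\<^sup>2)" for n
  proof -
    have f: "norm (\<phi> t (x n)) < 1" using \<phi>_in[OF t x(1)] by simp
    have "1 - (norm (\<phi> t (x n)))\<^sup>2 = (1 - norm (\<phi> t (x n))) * (1 + norm (\<phi> t (x n)))"
      by (simp add: power2_eq_square algebra_simps)
    also have "\<dots> \<le> norm (\<sigma> - \<phi> t (x n)) * 2"
      using f \<sigma> norm_triangle_ineq2[of \<sigma> "\<phi> t (x n)"] by (intro mult_mono) auto
    also have "\<dots> = \<alpha> n * ((1 - r n) * (1 + r n))"
      using r[of n] by (simp add: \<alpha>_def)
    also have "(1 - r n) * (1 + r n) = 1 - (norm (x n))\<^sup>2"
      by (simp add: x power2_eq_square algebra_simps)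
    finally show ?thesis .
  qed
  moreover have "\<alpha> \<longlonglongrightarrow> exp (- l * t) * (2 / (1 + 1))"
    unfolding \<alpha>_def x_def using \<open>r \<longlonglongrightarrow> 1 - 0\<close>
    by (intro tendsto_intros filterlim_compose[OF radial_quotient(1)[OF t] rl]) auto
  moreover have "x \<longlonglongrightarrow> \<sigma>"
    using tendsto_mult[OF tendsto_of_real[OF \<open>r \<longlonglongrightarrow> 1 - 0\<close>] tendsto_const[of \<sigma>]] by (simp add: x_def)
  moreover have "(\<lambda>n. \<phi> t (x n)) \<longlonglongrightarrow> \<sigma>"
    unfolding x_def by (rule filterlim_compose[OF radial_quotient(2)[OF t] rl])
  ultimately show ?thesis
    using Julia_inequality[OF \<phi>_hol[OF t] \<phi>_sub[OF t] \<sigma> z, of x \<alpha> "exp (- l * t)"] x(1) by simp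
qed

text \<open>The first term is the derivative of \<open>cayley \<sigma>\<close> along the flow. Hence
  \<open>Re q\<close> is the defect in Julia's inequality at \<sigma>, differentiated at t =
  0.\<close>

definition q :: "complex \<Rightarrow> complex" where
  "q z = 2 * \<sigma> / (\<sigma> - z)\<^sup>2 * G z - of_real l * cayley \<sigma> z"

lemma Re_q_nonneg: "z \<in> unit_disc \<Longrightarrow> Re (q z) \<ge> 0"
  using Re_generator_ge[OF \<sigma> _ Julia_at_\<sigma>, of z] by (simp add: q_def)

text \<open>Otherwise the flow would leave \<open>\<sigma>\<close> at a slower exponential rate than its angular
  derivative prescribes.\<close>

lemma Re_q_small:
  assumes \<epsilon>: "\<epsilon> > 0"
  shows "\<exists>z\<in>unit_disc. Re (q z) < \<epsilon> * Re (cayley \<sigma> z)"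
proof (rule ccontr)
  assume "\<not> ?thesis"
  then have ge: "\<epsilon> * Re (cayley \<sigma> z) \<le> Re (q z)" if "z \<in> unit_disc" for z
    using that by (auto simp: not_less)
  \<comment> \<open>Under the contrary assumption exp(-ct) times the Poisson kernel increases along
    orbits, so the kernel grows by at least exp c in unit time.\<close>
  define c where "c = l + \<epsilon>"
  have grow: "exp c * Re (cayley \<sigma> z) \<le> Re (cayley \<sigma> (\<phi> 1 z))" if z: "z \<in> unit_disc" for z
  proof -
    let ?y = "\<lambda>s. exp (- c * s) * Re (cayley \<sigma> (\<phi> s z))"
    have "?y 0 \<le> ?y 1"
    proof (rule DERIV_nonneg_imp_increasing_open[of 0 1 ?y])
      show "continuous_on {0..1} ?y"
        by (rule DERIV_continuous_on, rule DERIV_subset[OF Re_cayley_flow_derivative[OF \<sigma> z, of _ c]]) auto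
      fix t :: real assume t: "0 < t" "t < 1"
      have "Re (2 * \<sigma> / (\<sigma> - \<phi> t z)\<^sup>2 * G (\<phi> t z)) - c * Re (cayley \<sigma> (\<phi> t z)) \<ge> 0"
        using ge[OF \<phi>_in[of t z]] t z by (simp add: q_def c_def algebra_simps)
      moreover have "at t within {0..} = at t"
        using t by (intro at_within_interior) (auto simp: interior_real_atLeast)
      ultimately show "\<exists>d. (?y has_real_derivative d) (at t) \<and> 0 \<le> d"
        using Re_cayley_flow_derivative[OF \<sigma> z, of t c] t
        by (intro exI[of _ "exp (- c * t) * (Re (2 * \<sigma> / (\<sigma> - \<phi> t z)\<^sup>2 * G (\<phi> t z)) - c * Re (cayley \<sigma> (\<phi> t z)))"] conjI)
           (simp_all only: less_imp_le, simp)
    qed simp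
    then show ?thesis by (simp add: \<phi>_0[OF z] exp_minus field_simps)
  qed
  \<comment> \<open>Along the radius the kernel starts at (1 + r)/(1 - r) and ends below 2/|\<sigma>
    - \<phi>_1|; the angular derivative at \<sigma> lets the growth be at most exp l.\<close>
  have "exp c * (1 + 1) \<le> 2 / exp (- l * 1)"
  proof (rule tendsto_le[of "at_left (1::real)"])
    show "((\<lambda>r. 2 / (norm (\<sigma> - \<phi> 1 (of_real r * \<sigma>)) / (1 - r))) \<longlongrightarrow> 2 / exp (- l * 1)) (at_left 1)"
      by (intro tendsto_intros radial_quotient) auto
    show "((\<lambda>r. exp c * (1 + r)) \<longlongrightarrow> exp c * (1 + 1)) (at_left 1)"
      by (intro tendsto_intros)
    show "\<forall>\<^sub>F r in at_left 1. exp c * (1 + r) \<le> 2 / (norm (\<sigma> - \<phi> 1 (of_real r * \<sigma>)) / (1 - r))"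
    proof (rule eventually_at_leftI[of 0])
      fix r :: real assume r: "r \<in> {0<..<1}"
      define z where "z = of_real r * \<sigma>"
      have n: "norm (\<sigma> - z) = 1 - r" "norm z = r" "z \<in> unit_disc"
        using radius_in_stolz_region[OF \<sigma>, of r] r by (auto simp: z_def)
      have "Re (cayley \<sigma> z) = (1 + r) / (1 - r)"
        using r by (simp add: Re_cayley[OF \<sigma>] n power2_eq_square divide_simps) (simp add: algebra_simps)
      then have "exp c * ((1 + r) / (1 - r)) \<le> norm (cayley \<sigma> (\<phi> 1 z))"
        using grow[OF n(3)] complex_Re_le_cmod[of "cayley \<sigma> (\<phi> 1 z)"] by simp
      also have "\<dots> \<le> 2 / norm (\<sigma> - \<phi> 1 z)"
        unfolding cayley_def norm_divide using \<phi>_in[of 1 z] n(3) \<sigma>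
        by (intro divide_right_mono order.trans[OF norm_triangle_ineq]) auto
      finally show "exp c * (1 + r) \<le> 2 / (norm (\<sigma> - \<phi> 1 (of_real r * \<sigma>)) / (1 - r))"
        using r by (simp add: z_def field_simps)
    qed simp
  qed simp
  then have "exp c \<le> exp l" by (simp add: exp_minus field_simps)
  then show False using \<epsilon> by (simp add: c_def)
qed

lemma q_hol: "q holomorphic_on unit_disc" and cayley_hol: "cayley \<sigma> holomorphic_on unit_disc"
proof -
  have "\<sigma> - z \<noteq> 0" if "z \<in> unit_disc" for z using disc_ne_circle[OF that \<sigma>] by simp
  then show "cayley \<sigma> holomorphic_on unit_disc" "q holomorphic_on unit_disc"
    unfolding q_def[abs_def] cayley_def[abs_def] by (auto intro!: holomorphic_intros G_hol)
qed

text \<open>The measure representing the positive harmonic function \<open>Re q\<close> has no atom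
  at \<sigma>. The Harnack bound is taken from a base point where \<open>Re q\<close> is at most
  \<epsilon> times the Poisson kernel; in a Stolz region |\<sigma> - z| absorbs the blow-up of that
  bound.\<close>

lemma q_times_tendsto_0:
  "((\<lambda>z. q z * (\<sigma> - z)) \<longlongrightarrow> 0) (at \<sigma> within stolz_region \<sigma> M)"
proof (rule tendstoI)
  fix e :: real assume e: "e > 0"
  define m where "m = max M 1"
  \<comment> \<open>The limit of the final bound \<open>B\<close> is (8m + 2) \<epsilon>, strictly
    below e.\<close>
  define \<epsilon> where "\<epsilon> = e / (16 * m + 3)"
  have m: "m \<ge> 1" "m \<ge> M" by (auto simp: m_def)
  then have \<epsilon>: "\<epsilon> > 0" "(16 * m + 3) * \<epsilon> = e" using e by (auto simp: \<epsilon>_def)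
  obtain w where w: "w \<in> unit_disc" "Re (q w) < \<epsilon> * Re (cayley \<sigma> w)"
    using Re_q_small[OF \<epsilon>(1)] by blast
  \<comment> \<open>The added term makes the real part strictly positive, as
    \<open>norm_le_of_Re_pos\<close> requires, and at most doubles the bound at
    \<open>w\<close>.\<close>
  define p where "p = (\<lambda>z. q z + of_real \<epsilon> * cayley \<sigma> z)"
  have p: "p holomorphic_on unit_disc" "\<And>z. z \<in> unit_disc \<Longrightarrow> Re (p z) > 0"
    unfolding p_def using Re_cayley_pos[OF \<sigma>] Re_q_nonneg \<epsilon>(1)
    by (auto intro!: holomorphic_intros q_hol cayley_hol add_nonneg_pos)
  define N where "N = norm (\<sigma> - w)"
  have N: "N > 0" using disc_ne_circle[OF w(1) \<sigma>] by (simp add: N_def)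
  have w1: "1 - (norm w)\<^sup>2 > 0" using w by (simp add: abs_square_less_1)
  have pw: "Re (p w) \<le> 2 * \<epsilon> * (1 - (norm w)\<^sup>2) / N\<^sup>2"
    using w(2) by (simp add: p_def Re_cayley[OF \<sigma>] N_def)
  define B where "B = (\<lambda>z. norm (p w) * norm (\<sigma> - z) + 8 * \<epsilon> * m * ((norm (1 - cnj w * z))\<^sup>2 / N\<^sup>2) + 2 * \<epsilon>)"
  have bound: "norm (q z * (\<sigma> - z)) \<le> B z" if z: "z \<in> stolz_region \<sigma> M" for z
  proof -
    have zd: "z \<in> unit_disc" and zs: "norm (\<sigma> - z) < M * (1 - norm z)"
      using z by (auto simp: stolz_region_def)
    have z1: "1 - (norm z)\<^sup>2 > 0" using zd by (simp add: abs_square_less_1)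
    have "M * (1 - norm z) \<le> m * (1 - (norm z)\<^sup>2)"
    proof (rule mult_mono)
      have "(norm z)\<^sup>2 \<le> norm z" using zd by (simp add: power2_eq_square mult_left_le)
      then show "1 - norm z \<le> 1 - (norm z)\<^sup>2" by simp
    qed (use zd m in auto)
    then have zm: "norm (\<sigma> - z) / (1 - (norm z)\<^sup>2) \<le> m" using zs z1 by (simp add: divide_le_eq)
    define A where "A = (norm (1 - cnj w * z))\<^sup>2"
    have A: "A \<ge> 0" by (simp add: A_def)
    have "norm (p z) \<le> norm (p w) + 4 * Re (p w) * A / ((1 - (norm z)\<^sup>2) * (1 - (norm w)\<^sup>2))"
      unfolding A_def by (rule norm_le_of_Re_pos[OF p zd w(1)])
    also have "\<dots> \<le> norm (p w) + 4 * (2 * \<epsilon> * (1 - (norm w)\<^sup>2) / N\<^sup>2) * A / ((1 - (norm z)\<^sup>2) * (1 - (norm w)\<^sup>2))"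
      using pw A z1 w1 by (intro add_left_mono divide_right_mono mult_right_mono mult_left_mono) auto
    also have "4 * (2 * \<epsilon> * (1 - (norm w)\<^sup>2) / N\<^sup>2) * A / ((1 - (norm z)\<^sup>2) * (1 - (norm w)\<^sup>2))
        = 8 * \<epsilon> * (A / N\<^sup>2) / (1 - (norm z)\<^sup>2)"
    proof -
      have "4 * (2 * \<epsilon> * b / n) * a / (c * b) = 8 * \<epsilon> * (a / n) / c" if "b > 0" for a b c n :: real
        using that by (cases "c = 0"; cases "n = 0") (auto simp: field_simps)
      from this[OF w1] show ?thesis .
    qed
    finally have "norm (p z) * norm (\<sigma> - z) \<le> (norm (p w) + 8 * \<epsilon> * (A / N\<^sup>2) / (1 - (norm z)\<^sup>2)) * norm (\<sigma> - z)"
      by (intro mult_right_mono) auto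
    also have "\<dots> = norm (p w) * norm (\<sigma> - z) + 8 * \<epsilon> * (A / N\<^sup>2) * (norm (\<sigma> - z) / (1 - (norm z)\<^sup>2))"
      by (simp add: algebra_simps)
    also have "\<dots> \<le> norm (p w) * norm (\<sigma> - z) + 8 * \<epsilon> * (A / N\<^sup>2) * m"
      using \<epsilon>(1) A zm by (intro add_left_mono mult_left_mono) auto
    finally have 1: "norm (p z * (\<sigma> - z)) \<le> norm (p w) * norm (\<sigma> - z) + 8 * \<epsilon> * (A / N\<^sup>2) * m"
      by (simp add: norm_mult)
    have "q z * (\<sigma> - z) = p z * (\<sigma> - z) - of_real \<epsilon> * (\<sigma> + z)"
    proof -
      have "cayley \<sigma> z * (\<sigma> - z) = \<sigma> + z" using disc_ne_circle[OF zd \<sigma>] by (simp add: cayley_def)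
      then show ?thesis by (simp add: p_def distrib_right mult.assoc)
    qed
    then have "norm (q z * (\<sigma> - z)) \<le> norm (p z * (\<sigma> - z)) + \<epsilon> * norm (\<sigma> + z)"
      using norm_triangle_ineq4[of "p z * (\<sigma> - z)" "of_real \<epsilon> * (\<sigma> + z)"] \<epsilon>(1) by (simp add: norm_mult)
    also have "norm (\<sigma> + z) \<le> 2" using norm_triangle_ineq[of \<sigma> z] \<sigma> zd by simp
    finally show ?thesis using 1 \<epsilon>(1) by (simp add: B_def A_def mult_ac)
  qed
  \<comment> \<open>Therefore the quotient in \<open>B\<close> tends to 1 and the choice of
    \<open>w\<close>, which depends on \<epsilon>, drops out of the limit.\<close>
  have "norm (1 - cnj w * \<sigma>) = N"
  proof -
    have "cnj \<sigma> * \<sigma> = 1" using \<sigma> complex_norm_square[of \<sigma>] by (simp add: mult.commute)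
    then have "1 - cnj w * \<sigma> = cnj (\<sigma> - w) * \<sigma>" by (simp add: algebra_simps)
    then show ?thesis using \<sigma> by (simp add: norm_mult N_def del: complex_cnj_diff)
  qed
  then have "(B \<longlongrightarrow> norm (p w) * norm (\<sigma> - \<sigma>) + 8 * \<epsilon> * m * (N\<^sup>2 / N\<^sup>2) + 2 * \<epsilon>) (at \<sigma> within stolz_region \<sigma> M)"
    unfolding B_def using N by (auto intro!: tendsto_eq_intros)
  moreover have "norm (p w) * norm (\<sigma> - \<sigma>) + 8 * \<epsilon> * m * (N\<^sup>2 / N\<^sup>2) + 2 * \<epsilon> < e"
  proof -
    have "\<epsilon> * m > 0" using \<epsilon>(1) m by simp
    then show ?thesis using N \<epsilon> by (simp add: algebra_simps)
  qed
  ultimately have "\<forall>\<^sub>F z in at \<sigma> within stolz_region \<sigma> M. B z < e"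
    by (rule order_tendstoD)
  moreover have "\<forall>\<^sub>F z in at \<sigma> within stolz_region \<sigma> M. norm (q z * (\<sigma> - z)) \<le> B z"
    using bound by (simp add: eventually_at_filter)
  ultimately show "\<forall>\<^sub>F z in at \<sigma> within stolz_region \<sigma> M. dist (q z * (\<sigma> - z)) 0 < e"
    by eventually_elim simp
qed

text \<open>Solve the definition of \<open>q\<close> for \<open>G\<close>: the \<open>q\<close> term
  vanishes in the limit, and the Cayley term contributes l (\<sigma> + z), which tends to 2 l
  \<sigma>.\<close>

theorem generator_at_repelling_point:
  "((\<lambda>z. G z / (z - \<sigma>)) \<longlongrightarrow> of_real (- l)) (at \<sigma> within stolz_region \<sigma> M)"
proof (rule Lim_transform_eventually)
  have "\<sigma> \<noteq> 0" using \<sigma> by auto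
  have "((\<lambda>z. - (q z * (\<sigma> - z) + of_real l * (\<sigma> + z)) / (2 * \<sigma>)) \<longlongrightarrow>
      - (0 + of_real l * (\<sigma> + \<sigma>)) / (2 * \<sigma>)) (at \<sigma> within stolz_region \<sigma> M)"
    using \<open>\<sigma> \<noteq> 0\<close> by (intro tendsto_intros q_times_tendsto_0) auto
  then show "((\<lambda>z. - (q z * (\<sigma> - z) + of_real l * (\<sigma> + z)) / (2 * \<sigma>)) \<longlongrightarrow> of_real (- l))
      (at \<sigma> within stolz_region \<sigma> M)"
    using \<open>\<sigma> \<noteq> 0\<close> by simp
  have "- (q z * (\<sigma> - z) + of_real l * (\<sigma> + z)) / (2 * \<sigma>) = G z / (z - \<sigma>)" if "z \<noteq> \<sigma>" for z
  proof -
    have 1: "\<sigma> - z \<noteq> 0" "z - \<sigma> \<noteq> 0" using that by auto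
    have "q z * (\<sigma> - z) + of_real l * (\<sigma> + z) = 2 * \<sigma> * G z / (\<sigma> - z)"
    proof -
      have "2 * \<sigma> / d\<^sup>2 * g * d = 2 * \<sigma> * g / d" for d g :: complex
        by (cases "d = 0") (simp_all add: power2_eq_square)
      moreover have "cayley \<sigma> z * (\<sigma> - z) = \<sigma> + z" using 1 by (simp add: cayley_def)
      ultimately show ?thesis by (simp add: q_def left_diff_distrib mult.assoc del: times_divide_eq_left times_divide_eq_right)
    qed
    also have "\<dots> = - (2 * \<sigma> * (G z / (z - \<sigma>)))"
      using 1 by (simp add: divide_simps) (simp add: algebra_simps)
    finally show ?thesis using \<open>\<sigma> \<noteq> 0\<close> by simp
  qed
  then show "\<forall>\<^sub>F z in at \<sigma> within stolz_region \<sigma> M.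
      - (q z * (\<sigma> - z) + of_real l * (\<sigma> + z)) / (2 * \<sigma>) = G z / (z - \<sigma>)"
    by (simp add: eventually_at_filter)
qed

end

subsection \<open>The image of a petal in a linearizing coordinate\<close>

text \<open>\<open>E\<close> is the identity in the non-elliptic case and \<open>w \<mapsto> exp (i \<mu> w)\<close> in the elliptic
  case: in both cases the flow is \<open>w \<mapsto> w + it\<close> in the coordinate \<open>w\<close>.  The map \<open>\<kappa>\<close>
  uniformizes the disc (without the Denjoy-Wolff point, if that lies in the disc) by the
  half-plane, and \<open>\<Psi>\<close> is the Koenigs function in these coordinates.\<close>

locale uniformized_flow = repelling_flow +
  fixes h E \<kappa> \<Psi> :: "complex \<Rightarrow> complex" and s\<^sub>0 :: real
  assumes h_hol: "h holomorphic_on unit_disc" and h_inj: "inj_on h unit_disc"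
    and E_hol: "E holomorphic_on UNIV" and E_deriv: "\<And>w. deriv E w \<noteq> 0"
    and E_shift: "\<And>w w' u. E w = E w' \<Longrightarrow> E (w + u) = E (w' + u)"
    and E_lift: "\<And>\<gamma> w. path \<gamma> \<Longrightarrow> path_image \<gamma> \<subseteq> range E \<Longrightarrow> pathstart \<gamma> = E w \<Longrightarrow>
          \<exists>\<gamma>'. path \<gamma>' \<and> pathstart \<gamma>' = w \<and> (\<forall>t\<in>{0..1}. E (\<gamma>' t) = \<gamma> t)"
    and h_flow: "\<And>z t w. z \<in> unit_disc \<Longrightarrow> t \<ge> 0 \<Longrightarrow> E w = h z \<Longrightarrow> h (\<phi> t z) = E (w + \<i> * of_real t)"
    and h_back: "\<And>z t. z \<in> unit_disc \<Longrightarrow> t \<ge> 0 \<Longrightarrow> h (\<phi> t z) \<in> range E \<Longrightarrow> h z \<in> range E"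
    and s\<^sub>0: "s\<^sub>0 > 0" and \<kappa>_hol: "\<kappa> holomorphic_on {v. Re v > - s\<^sub>0}" and \<kappa>_0: "\<kappa> 0 = \<sigma>"
    and \<kappa>_disc: "\<And>v. Re v > - s\<^sub>0 \<Longrightarrow> \<kappa> v \<in> unit_disc \<longleftrightarrow> Re v > 0"
    and \<kappa>_deriv: "\<And>v. Re v > - s\<^sub>0 \<Longrightarrow> deriv \<kappa> v \<noteq> 0"
    and \<kappa>_lower: "\<And>v. Re v > 0 \<Longrightarrow> norm v < 1 \<Longrightarrow> Re v * norm (deriv \<kappa> v) \<le> 1 - (norm (\<kappa> v))\<^sup>2"
    and \<kappa>_upper: "\<And>v. Re v > 0 \<Longrightarrow> norm v < 1 \<Longrightarrow> 1 - (norm (\<kappa> v))\<^sup>2 \<le> 6 * Re v * norm (deriv \<kappa> v)"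
    and \<Psi>_hol: "\<Psi> holomorphic_on right_half_plane"
    and \<Psi>: "\<And>v. Re v > 0 \<Longrightarrow> E (\<Psi> v) = h (\<kappa> v)"
    and Re_G_\<kappa>: "\<And>v. Re v > 0 \<Longrightarrow> Re (G (\<kappa> v) / deriv \<kappa> v) \<ge> 0"
begin

section \<open>Generator and derivatives in the half-plane coordinate\<close>

lemma open_\<kappa>_domain: "open {v. Re v > - s\<^sub>0}"
  by (rule open_halfspace_Re_gt)

lemma \<kappa>_in: "Re v > 0 \<Longrightarrow> \<kappa> v \<in> unit_disc"
  using \<kappa>_disc[of v] s\<^sub>0 by auto

lemma \<kappa>_DERIV: "Re v > - s\<^sub>0 \<Longrightarrow> (\<kappa> has_field_derivative deriv \<kappa> v) (at v)"
  using holomorphic_derivI[OF \<kappa>_hol open_\<kappa>_domain] by auto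

lemma E_DERIV: "(E has_field_derivative deriv E w) (at w within S)"
  by (rule holomorphic_derivI[OF E_hol open_UNIV]) auto

lemma h_DERIV: "z \<in> unit_disc \<Longrightarrow> (h has_field_derivative deriv h z) (at z within S)"
  by (rule holomorphic_derivI[OF h_hol open_ball])

lemma \<Psi>_DERIV: "Re v > 0 \<Longrightarrow> (\<Psi> has_field_derivative deriv \<Psi> v) (at v)"
  using holomorphic_derivI[OF \<Psi>_hol open_right_half_plane] by auto

text \<open>The derivative of t -> h(\<phi>_t z) at 0 is computed through the flow and through w +
  it: in the coordinate w the generator is the constant i.\<close>

lemma deriv_h_G:
  assumes "z \<in> unit_disc" "E w = h z"
  shows "deriv h z * G z = \<i> * deriv E w"
proof -
  have "((\<lambda>t. \<phi> t z) has_vector_derivative G z) (at 0 within {0..})"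
    using flow[OF assms(1), of 0] \<phi>_0[OF assms(1)] by simp
  moreover have "(h has_field_derivative deriv h z) (at (\<phi> 0 z) within (\<lambda>t. \<phi> t z) ` {0..})"
    using h_DERIV[OF assms(1)] \<phi>_0[OF assms(1)] by simp
  ultimately have 1: "((\<lambda>t. h (\<phi> t z)) has_vector_derivative G z * deriv h z) (at 0 within {0..})"
    using field_vector_diff_chain_within by (fastforce simp: o_def)
  have "((\<lambda>t. w + \<i> * of_real t) has_vector_derivative \<i>) (at (0::real) within {0..})"
    by (auto intro!: derivative_eq_intros)
  moreover have "(E has_field_derivative deriv E w) (at (w + \<i> * of_real 0) within (\<lambda>t. w + \<i> * of_real t) ` {0::real..})"
    using E_DERIV[of w] by simp
  ultimately have "((\<lambda>t. E (w + \<i> * of_real t)) has_vector_derivative \<i> * deriv E w) (at (0::real) within {0..})"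
    using field_vector_diff_chain_within by (fastforce simp: o_def)
  then have 2: "((\<lambda>t. h (\<phi> t z)) has_vector_derivative \<i> * deriv E w) (at 0 within {0..})"
    by (rule has_vector_derivative_transform[rotated 2]) (use h_flow[OF assms(1) _ assms(2)] in auto)
  have "at (0::real) within {0..} \<noteq> bot" by (simp add: at_within_Ici_at_right)
  from vector_derivative_within[OF this 1] vector_derivative_within[OF this 2] show ?thesis
    by (simp add: mult.commute)
qed

lemma deriv_\<Psi>:
  assumes v: "Re v > 0"
  shows "deriv E (\<Psi> v) * deriv \<Psi> v = deriv h (\<kappa> v) * deriv \<kappa> v"
proof -
  have "((\<lambda>v. E (\<Psi> v)) has_field_derivative deriv E (\<Psi> v) * deriv \<Psi> v) (at v)"
    using DERIV_chain2[where f = E and g = \<Psi>, OF E_DERIV \<Psi>_DERIV[OF v]] .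
  moreover have "((\<lambda>v. h (\<kappa> v)) has_field_derivative deriv h (\<kappa> v) * deriv \<kappa> v) (at v)"
    by (rule DERIV_chain2[where f = h and g = \<kappa>, OF h_DERIV[OF \<kappa>_in[OF v]] \<kappa>_DERIV])
       (use v s\<^sub>0 in auto)
  then have "((\<lambda>v. E (\<Psi> v)) has_field_derivative deriv h (\<kappa> v) * deriv \<kappa> v) (at v)"
    by (rule has_field_derivative_transform_within_open[OF _ open_right_half_plane])
       (use v \<Psi> in auto)
  ultimately show ?thesis by (rule DERIV_unique)
qed

text \<open>In the coordinate v the generator is G(\<kappa> v)/\<kappa>'(v), and \<Psi> carries it
  to i. The nonvanishing derivative of \<open>E\<close> cancels from both sides.\<close>

lemma deriv_\<Psi>_G:
  assumes v: "Re v > 0"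
  shows "deriv \<Psi> v * G (\<kappa> v) = \<i> * deriv \<kappa> v" "G (\<kappa> v) \<noteq> 0" "deriv \<Psi> v \<noteq> 0"
proof -
  have "deriv E (\<Psi> v) * (deriv \<Psi> v * G (\<kappa> v)) = deriv E (\<Psi> v) * (\<i> * deriv \<kappa> v)"
  proof -
    have "deriv E (\<Psi> v) * (deriv \<Psi> v * G (\<kappa> v)) = deriv h (\<kappa> v) * deriv \<kappa> v * G (\<kappa> v)"
      unfolding deriv_\<Psi>[OF v, symmetric] by (simp only: mult.assoc)
    also have "\<dots> = (deriv h (\<kappa> v) * G (\<kappa> v)) * deriv \<kappa> v" by (simp only: mult_ac)
    also have "\<dots> = deriv E (\<Psi> v) * (\<i> * deriv \<kappa> v)"
      unfolding deriv_h_G[OF \<kappa>_in[OF v] \<Psi>[OF v]] by (simp only: mult_ac)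
    finally show ?thesis .
  qed
  then show "deriv \<Psi> v * G (\<kappa> v) = \<i> * deriv \<kappa> v" using E_deriv by simp
  moreover have "\<i> * deriv \<kappa> v \<noteq> 0" using \<kappa>_deriv[of v] v s\<^sub>0 by simp
  ultimately show "G (\<kappa> v) \<noteq> 0" "deriv \<Psi> v \<noteq> 0" by force+
qed

lemma isCont_deriv_\<kappa>_0: "isCont (deriv \<kappa>) 0"
  by (rule continuous_on_interior[OF holomorphic_on_imp_continuous_on[OF holomorphic_deriv[OF \<kappa>_hol open_\<kappa>_domain]]])
     (simp add: interior_open[OF open_\<kappa>_domain] s\<^sub>0)

text \<open>Near 0, |\<sigma> - \<kappa> v| < 2c |v| and |\<kappa>'| > c/2, while
  \<open>\<kappa>_lower\<close> compares Re v |\<kappa>'| with the boundary distance. This gives the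
  ratio 4M, doubled by 1 - n^2 <= 2(1 - n).\<close>

lemma \<kappa>_filterlim:
  assumes M: "M > 1"
  shows "filterlim \<kappa> (at \<sigma> within stolz_region \<sigma> (8 * M + 1)) (at 0 within {v. norm v < M * Re v})"
proof -
  let ?F = "at 0 within {v. norm v < M * Re v}"
  define c where "c = norm (deriv \<kappa> 0)"
  have c: "c > 0" using \<kappa>_deriv[of 0] s\<^sub>0 by (simp add: c_def)
  have D0: "(\<kappa> has_field_derivative deriv \<kappa> 0) (at 0)" using \<kappa>_DERIV[of 0] s\<^sub>0 by simp
  have cont: "(\<kappa> \<longlongrightarrow> \<sigma>) (at 0)"
    using DERIV_isCont[OF D0] by (simp add: isCont_def \<kappa>_0)
  have "((\<lambda>v. norm ((\<kappa> v - \<sigma>) / v)) \<longlongrightarrow> c) (at 0)"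
    unfolding c_def using D0 by (intro tendsto_norm) (simp add: has_field_derivative_iff \<kappa>_0)
  then have "\<forall>\<^sub>F v in at 0. norm ((\<kappa> v - \<sigma>) / v) < 2 * c"
    by (rule order_tendstoD) (use c in simp)
  moreover have "((\<lambda>v. norm (deriv \<kappa> v)) \<longlongrightarrow> c) (at 0)"
  proof -
    show ?thesis
      using isCont_deriv_\<kappa>_0 unfolding c_def isCont_def by (rule tendsto_norm)
  qed
  then have "\<forall>\<^sub>F v in at 0. norm (deriv \<kappa> v) > c / 2"
    by (rule order_tendstoD) (use c in simp)
  moreover have "\<forall>\<^sub>F v in at 0. norm (v :: complex) < 1"
    unfolding eventually_at by (rule exI[of _ 1]) (auto simp: dist_norm)
  ultimately have "\<forall>\<^sub>F v in at 0. norm ((\<kappa> v - \<sigma>) / v) < 2 * c \<and> norm (deriv \<kappa> v) > c / 2 \<and> norm v < 1"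
    by eventually_elim auto
  then have "\<forall>\<^sub>F v in ?F. norm ((\<kappa> v - \<sigma>) / v) < 2 * c \<and> norm (deriv \<kappa> v) > c / 2 \<and> norm v < 1"
    by (rule filter_leD[OF at_le, rotated]) auto
  moreover have "\<forall>\<^sub>F v in ?F. v \<noteq> 0 \<and> norm v < M * Re v" by (simp add: eventually_at_filter)
  ultimately have "\<forall>\<^sub>F v in ?F. \<kappa> v \<in> stolz_region \<sigma> (8 * M + 1) \<and> \<kappa> v \<noteq> \<sigma>"
  proof eventually_elim
    fix v assume v: "norm ((\<kappa> v - \<sigma>) / v) < 2 * c \<and> norm (deriv \<kappa> v) > c / 2 \<and> norm v < 1"
      and v2: "v \<noteq> 0 \<and> norm v < M * Re v"
    have "M * Re v > 0" using v2 norm_ge_zero[of v] by linarith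
    then have Rv: "Re v > 0" using M by (simp add: zero_less_mult_iff)
    have kd: "\<kappa> v \<in> unit_disc" by (rule \<kappa>_in[OF Rv])
    define n where "n = norm (\<kappa> v)"
    have n: "0 \<le> n" "n < 1" using kd by (auto simp: n_def)
    have "norm (\<sigma> - \<kappa> v) < 2 * c * norm v"
      using v v2 by (simp add: norm_divide norm_minus_commute divide_less_eq)
    also have "\<dots> \<le> 2 * c * (M * Re v)" using v2 c by (intro mult_left_mono) auto
    also have "\<dots> = 4 * M * (Re v * (c / 2))" by simp
    also have "\<dots> \<le> 4 * M * (Re v * norm (deriv \<kappa> v))"
      using v M Rv by (intro mult_left_mono) auto
    also have "\<dots> \<le> 4 * M * ((1 - n) * 2)"
    proof (rule mult_left_mono)
      have "Re v * norm (deriv \<kappa> v) \<le> 1 - n\<^sup>2" using \<kappa>_lower[OF Rv] v by (simp add: n_def)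
      also have "1 - n\<^sup>2 = (1 - n) * (1 + n)" by (simp add: power2_eq_square algebra_simps)
      also have "\<dots> \<le> (1 - n) * 2" using n by (intro mult_left_mono) auto
      finally show "Re v * norm (deriv \<kappa> v) \<le> (1 - n) * 2" .
    qed (use M in simp)
    also have "\<dots> = 8 * M * (1 - n)" by simp
    also have "\<dots> \<le> (8 * M + 1) * (1 - n)" using n by (intro mult_right_mono) auto
    finally show "\<kappa> v \<in> stolz_region \<sigma> (8 * M + 1) \<and> \<kappa> v \<noteq> \<sigma>"
      using kd disc_ne_circle[OF kd \<sigma>] by (simp add: stolz_region_def n_def)
  qed
  moreover have "(\<kappa> \<longlongrightarrow> \<sigma>) ?F" by (rule tendsto_mono[OF at_le cont]) auto
  ultimately show ?thesis unfolding filterlim_at by blast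
qed

text \<open>\<Psi>' = i \<kappa>'/G(\<kappa>), with G(\<kappa> v) split into the quotient by
  \<kappa> v - \<sigma>, which tends to -l, and the difference quotient of \<kappa> at 0, which
  cancels \<kappa>'(0).\<close>

lemma \<Psi>_limit:
  assumes M: "M > 1"
  shows "((\<lambda>v. v * deriv \<Psi> v) \<longlongrightarrow> \<i> / of_real (- l)) (at 0 within {v. norm v < M * Re v})"
proof (rule Lim_transform_eventually)
  let ?F = "at 0 within {v. norm v < M * Re v}"
  have k0: "deriv \<kappa> 0 \<noteq> 0" using \<kappa>_deriv[of 0] s\<^sub>0 by simp
  have D0: "(\<kappa> has_field_derivative deriv \<kappa> 0) (at 0)" using \<kappa>_DERIV[of 0] s\<^sub>0 by simp
  have "((\<lambda>v. (\<kappa> v - \<sigma>) / v) \<longlongrightarrow> deriv \<kappa> 0) (at 0)"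
    using D0 by (simp add: has_field_derivative_iff \<kappa>_0)
  then have 1: "((\<lambda>v. (\<kappa> v - \<sigma>) / v) \<longlongrightarrow> deriv \<kappa> 0) ?F" by (rule tendsto_mono[OF at_le, rotated]) auto
  from isCont_deriv_\<kappa>_0 have 2: "(deriv \<kappa> \<longlongrightarrow> deriv \<kappa> 0) ?F"
    unfolding isCont_def by (rule tendsto_mono[OF at_le, rotated]) auto
  have 3: "((\<lambda>v. G (\<kappa> v) / (\<kappa> v - \<sigma>)) \<longlongrightarrow> of_real (- l)) ?F"
    by (rule filterlim_compose[OF generator_at_repelling_point \<kappa>_filterlim[OF M]])
  have "((\<lambda>v. \<i> * deriv \<kappa> v / (G (\<kappa> v) / (\<kappa> v - \<sigma>) * ((\<kappa> v - \<sigma>) / v))) \<longlongrightarrow>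
      \<i> * deriv \<kappa> 0 / (of_real (- l) * deriv \<kappa> 0)) ?F"
    using l k0 by (intro tendsto_intros 1 2 3) auto
  then show "((\<lambda>v. \<i> * deriv \<kappa> v / (G (\<kappa> v) / (\<kappa> v - \<sigma>) * ((\<kappa> v - \<sigma>) / v))) \<longlongrightarrow> \<i> / of_real (- l)) ?F"
    using k0 by simp
  have "\<i> * deriv \<kappa> v / (G (\<kappa> v) / (\<kappa> v - \<sigma>) * ((\<kappa> v - \<sigma>) / v)) = v * deriv \<Psi> v"
    if "v \<noteq> 0" "norm v < M * Re v" for v
  proof -
    have "M * Re v > 0" using that norm_ge_zero[of v] by linarith
    then have Rv: "Re v > 0" using M by (simp add: zero_less_mult_iff)
    have "\<kappa> v - \<sigma> \<noteq> 0" using disc_ne_circle[OF \<kappa>_in[OF Rv] \<sigma>] by simp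
    then show ?thesis
      using deriv_\<Psi>_G[OF Rv] that(1) by (simp add: field_simps)
  qed
  then show "\<forall>\<^sub>F v in ?F. \<i> * deriv \<kappa> v / (G (\<kappa> v) / (\<kappa> v - \<sigma>) * ((\<kappa> v - \<sigma>) / v)) = v * deriv \<Psi> v"
    by (simp add: eventually_at_filter)
qed

text \<open>On a ball that \<open>E\<close> maps into the image of \<open>h\<close>, the inverse of
  \<open>h\<close> after \<open>E\<close> is a map to the disc whose derivative at \<Psi> v is
  \<kappa>'/\<Psi>'. Schwarz-Pick bounds the radius by (1 - |\<kappa>|^2) |\<Psi>'/\<kappa>'|, and
  \<open>\<kappa>_upper\<close> finishes.\<close>

lemma room_near_imaginary_axis:
  assumes v: "Re v > 0" "norm v < 1" and d: "d > 0" and sub: "ball (\<Psi> v) d \<subseteq> E -` h ` unit_disc"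
  shows "d \<le> 6 * Re v * norm (deriv \<Psi> v)"
proof -
  obtain g where g: "g holomorphic_on h ` unit_disc"
    "\<And>z. z \<in> unit_disc \<Longrightarrow> deriv h z * deriv g (h z) = 1" "\<And>z. z \<in> unit_disc \<Longrightarrow> g (h z) = z"
    using holomorphic_has_inverse[OF h_hol open_ball h_inj] by blast
  have op: "open (h ` unit_disc)" by (rule open_mapping_thm3[OF h_hol open_ball h_inj])
  have "(g \<circ> E) holomorphic_on ball (\<Psi> v) d"
    by (rule holomorphic_on_compose_gen[OF holomorphic_on_subset[OF E_hol] g(1)]) (use sub in auto)
  moreover have "(g \<circ> E) ` ball (\<Psi> v) d \<subseteq> unit_disc"
    using sub g(3) by (fastforce simp: subset_iff)
  ultimately have "norm (deriv (g \<circ> E) (\<Psi> v)) * d \<le> 1 - (norm ((g \<circ> E) (\<Psi> v)))\<^sup>2"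
    using d by (rule Schwarz_Pick_deriv_ball)
  moreover have k: "\<kappa> v \<in> unit_disc" by (rule \<kappa>_in[OF v(1)])
  moreover have "(g has_field_derivative deriv g (h (\<kappa> v))) (at (E (\<Psi> v)))"
    using holomorphic_derivI[OF g(1) op, of "h (\<kappa> v)"] k by (simp add: \<Psi>[OF v(1)])
  then have "deriv (g \<circ> E) (\<Psi> v) = deriv g (h (\<kappa> v)) * deriv E (\<Psi> v)"
    by (intro DERIV_imp_deriv DERIV_chain E_DERIV)
  ultimately have "norm (deriv g (h (\<kappa> v)) * deriv E (\<Psi> v)) * d \<le> 1 - (norm (\<kappa> v))\<^sup>2"
    by (simp add: \<Psi>[OF v(1)] g(3))
  also have "\<dots> \<le> 6 * Re v * norm (deriv \<kappa> v)" by (rule \<kappa>_upper[OF v])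
  finally have "norm (deriv g (h (\<kappa> v)) * deriv E (\<Psi> v)) * d * norm (deriv \<Psi> v)
      \<le> 6 * Re v * norm (deriv \<kappa> v) * norm (deriv \<Psi> v)"
    by (intro mult_right_mono) auto
  moreover have "deriv g (h (\<kappa> v)) * deriv E (\<Psi> v) * deriv \<Psi> v = deriv \<kappa> v"
    using deriv_\<Psi>[OF v(1)] g(2)[OF k] by (metis mult.assoc mult.commute mult.left_neutral)
  then have "norm (deriv g (h (\<kappa> v)) * deriv E (\<Psi> v)) * norm (deriv \<Psi> v) = norm (deriv \<kappa> v)"
    by (metis norm_mult)
  ultimately have "norm (deriv \<kappa> v) * d \<le> norm (deriv \<kappa> v) * (6 * Re v * norm (deriv \<Psi> v))"
    by (simp add: mult_ac)
  moreover have "norm (deriv \<kappa> v) > 0" using \<kappa>_deriv[of v] v s\<^sub>0 by simp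
  ultimately show ?thesis by (simp only: mult_le_cancel_left_pos)
qed

sublocale chart: repelling_log_chart \<Psi> "E -` h ` unit_disc" "- l" 6 1
proof
  fix v :: complex assume v: "Re v > 0"
  \<comment> \<open>So Im \<Psi>' is the real part of the inverse of the generator in the coordinate
    v, and inversion preserves the sign of the real part.\<close>
  have "deriv \<Psi> v = \<i> / (G (\<kappa> v) / deriv \<kappa> v)"
    using deriv_\<Psi>_G[OF v] by (simp add: field_simps)
  then have "Im (deriv \<Psi> v) = Re (inverse (G (\<kappa> v) / deriv \<kappa> v))"
    by (simp add: divide_inverse)
  then show "0 \<le> Im (deriv \<Psi> v)" using Re_G_\<kappa>[OF v] by (simp only: inverse_complex.sel) simp
  show "\<Psi> v \<in> E -` h ` unit_disc" using \<Psi>[OF v] \<kappa>_in[OF v] by auto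
next
  fix w :: complex and t :: real assume "w \<in> E -` h ` unit_disc" "t \<ge> 0"
  then show "w + \<i> * of_real t \<in> E -` h ` unit_disc"
    using h_flow \<phi>_in by (metis (no_types, opaque_lifting) imageE imageI vimage_eq)
qed (use \<Psi>_hol l \<Psi>_limit room_near_imaginary_axis in auto)

section \<open>Petals and full vertical lines\<close>

abbreviation W :: "complex set" where
  "W \<equiv> \<Inter>t\<in>{0..}. \<phi> t ` unit_disc"

lemma W_subset: "W \<subseteq> unit_disc"
  using \<phi>_0 by force

lemma petal_subset_disc:
  assumes "petal \<phi> \<Delta>"
  shows "\<Delta> \<subseteq> unit_disc"
proof -
  have "\<Delta> \<subseteq> interior W" using assms unfolding petal_def by (rule in_components_subset)
  also have "\<dots> \<subseteq> W" by (rule interior_subset)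
  also note W_subset
  finally show ?thesis .
qed

text \<open>Points of \<open>W\<close> are those that can be traced backwards for all time, and
  tracing backwards means moving down in the coordinate w. Injectivity of \<open>h\<close> makes the
  converse exact.\<close>

lemma in_image_W_iff: "E w \<in> h ` W \<longleftrightarrow> Re w \<in> chart.lines"
proof
  assume "E w \<in> h ` W"
  then obtain \<zeta> where \<zeta>: "\<zeta> \<in> W" "E w = h \<zeta>" by auto
  have \<zeta>D: "\<zeta> \<in> unit_disc" using \<zeta>(1) W_subset by blast
  have "E (Complex (Re w) y) \<in> h ` unit_disc" for y
  proof (cases "y \<ge> Im w")
    case True
    have "E (w + \<i> * of_real (y - Im w)) = h (\<phi> (y - Im w) \<zeta>)"
      using h_flow[OF \<zeta>D _ \<zeta>(2), of "y - Im w"] True by simp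
    moreover have "w + \<i> * of_real (y - Im w) = Complex (Re w) y" by (simp add: complex_eq_iff)
    ultimately show ?thesis using \<phi>_in[OF _ \<zeta>D, of "y - Im w"] True by auto
  next
    case False
    define t where "t = Im w - y"
    have t: "t \<ge> 0" using False by (simp add: t_def)
    then have "\<zeta> \<in> \<phi> t ` unit_disc" using \<zeta>(1) by blast
    then obtain z where z: "z \<in> unit_disc" "\<zeta> = \<phi> t z" by blast
    \<comment> \<open>The preimage has some lift w', perhaps unrelated to w; \<open>E_shift\<close>
      shows that w - it is a lift of it as well.\<close>
    have "h z \<in> range E" using h_back[OF z(1) t] \<zeta>(2) z(2) by (metis rangeI)
    then obtain w' where w': "E w' = h z" by auto
    have "E (w' + \<i> * of_real t) = E w" using h_flow[OF z(1) t w'] \<zeta>(2) z(2) by simp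
    from E_shift[OF this, of "- \<i> * of_real t"] have "E (w - \<i> * of_real t) = h z" using w' by simp
    moreover have "w - \<i> * of_real t = Complex (Re w) y" by (simp add: complex_eq_iff t_def)
    ultimately show ?thesis using z(1) by auto
  qed
  then show "Re w \<in> chart.lines" by (simp add: chart.lines_def)
next
  assume "Re w \<in> chart.lines"
  then have L: "E (Complex (Re w) y) \<in> h ` unit_disc" for y by (simp add: chart.lines_def)
  from L[of "Im w"] obtain \<zeta> where \<zeta>: "\<zeta> \<in> unit_disc" "E w = h \<zeta>" by auto
  have "\<zeta> \<in> \<phi> t ` unit_disc" if t: "t \<ge> 0" for t
  proof -
    obtain z where z: "z \<in> unit_disc" "E (Complex (Re w) (Im w - t)) = h z" using L[of "Im w - t"] by auto
    have "Complex (Re w) (Im w - t) + \<i> * of_real t = w" by (simp add: complex_eq_iff)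
    then have "h (\<phi> t z) = h \<zeta>" using h_flow[OF z(1) t z(2)] \<zeta>(2) by simp
    then have "\<phi> t z = \<zeta>" using h_inj \<phi>_in[OF t z(1)] \<zeta>(1) by (auto dest: inj_onD)
    then show ?thesis using z(1) by auto
  qed
  then show "E w \<in> h ` W" using \<zeta>(2) by auto
qed

lemma open_E_image:
  assumes "open S"
  shows "open (E ` S)"
proof (rule open_mapping_thm[OF E_hol open_UNIV connected_UNIV assms subset_UNIV])
  show "\<not> E constant_on UNIV"
  proof
    assume "E constant_on UNIV"
    then obtain c where "E = (\<lambda>_. c)" by (auto simp: constant_on_def)
    then show False using E_deriv[of 0] by simp
  qed
qed

text \<open>The petal has a point near \<sigma>, whose coordinate lies between the walls. Paths in
  the image of the petal lift to curves over \<open>chart.lines\<close>, which cannot cross a wall.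
  Conversely, the image of the full strip is connected, lies in the image of \<open>W\<close> and
  meets the petal, so maximality of the component applies.\<close>

theorem image_of_petal:
  assumes pet: "petal \<phi> \<Delta>" and fr: "\<sigma> \<in> frontier \<Delta>" and ran: "h ` \<Delta> \<subseteq> range E"
  shows "\<exists>a. h ` \<Delta> = E ` {w. a < Re w \<and> Re w < a + pi / (- l)} \<and>
     (\<forall>\<delta>>0. \<exists>xl xr. (\<exists>y. E (Complex xl y) \<notin> h ` unit_disc) \<and> (\<exists>y. E (Complex xr y) \<notin> h ` unit_disc) \<and>
        a - \<delta> < xl \<and> xl \<le> a \<and> a + pi / (- l) \<le> xr \<and> xr < a + pi / (- l) + \<delta>)"
proof -
  obtain a where a: "{a<..<a + pi / (- l)} \<subseteq> chart.lines"
    and wall: "\<And>\<delta>. \<delta> > 0 \<Longrightarrow> \<exists>xl xr \<rho>. \<rho> > 0 \<and> xl \<notin> chart.lines \<and> xr \<notin> chart.lines \<and>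
        a - \<delta> < xl \<and> xl \<le> a \<and> a + pi / (- l) \<le> xr \<and> xr < a + pi / (- l) + \<delta> \<and>
        (\<forall>v. 0 < Re v \<longrightarrow> norm v < \<rho> \<longrightarrow> xl < Re (\<Psi> v) \<and> Re (\<Psi> v) < xr)"
    using chart.limit_strip by blast
  define b where "b = a + pi / (- l)"
  define S where "S = {w. a < Re w \<and> Re w < b}"
  have comp: "\<Delta> \<in> components (interior W)" using pet by (simp add: petal_def)
  have \<Delta>: "open \<Delta>" "connected \<Delta>" "\<Delta> \<subseteq> interior W" "\<Delta> \<noteq> {}"
    using comp open_components[OF open_interior] in_components_connected in_components_subset in_components_nonempty
    by blast+
  have \<Delta>W: "\<Delta> \<subseteq> W" using \<Delta>(3) interior_subset by blast
  have \<Delta>D: "\<Delta> \<subseteq> unit_disc" by (rule petal_subset_disc[OF pet])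
  define P where "P = h ` \<Delta>"
  have P: "open P" "connected P" "P \<noteq> {}"
    unfolding P_def using \<Delta> \<Delta>D
    by (auto intro!: open_mapping_thm3 connected_continuous_image holomorphic_on_imp_continuous_on
          holomorphic_on_subset[OF h_hol] inj_on_subset[OF h_inj])
  have P_lines: "Re w \<in> chart.lines" if "E w \<in> P" for w
    using that \<Delta>W in_image_W_iff[of w] unfolding P_def by blast
  have contE: "continuous_on UNIV E" by (rule holomorphic_on_imp_continuous_on[OF E_hol])
  have lifted: "E w \<in> E ` S" if w: "E w \<in> P" for w
  proof -
    have "open (E -` P)" using contE P(1) by (simp add: continuous_on_open_vimage)
    then obtain s where s: "s > 0" "ball w s \<subseteq> E -` P" using w by (meson openE vimageI)
    \<comment> \<open>The precision of the walls is the radius s of a ball about w that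
      \<open>E\<close> maps into \<open>P\<close>; this is what later excludes the gap between a
      wall and its edge.\<close>
    obtain xl xr \<rho> where x: "\<rho> > 0" "xl \<notin> chart.lines" "xr \<notin> chart.lines"
        "a - s < xl" "xl \<le> a" "b \<le> xr" "xr < b + s"
      and \<rho>: "\<And>v. 0 < Re v \<Longrightarrow> norm v < \<rho> \<Longrightarrow> xl < Re (\<Psi> v) \<and> Re (\<Psi> v) < xr"
      using wall[OF s(1)] unfolding b_def by blast
    define r where "r = min \<rho> s\<^sub>0"
    have r: "r > 0" using x(1) s\<^sub>0 by (simp add: r_def)
    have br: "ball 0 r \<subseteq> {v. Re v > - s\<^sub>0}"
    proof
      fix v :: complex assume "v \<in> ball 0 r"
      then have "norm v < s\<^sub>0" by (simp add: r_def)
      then show "v \<in> {v. Re v > - s\<^sub>0}" using abs_Re_le_cmod[of v] by auto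
    qed
    \<comment> \<open>The image of this ball is a full neighbourhood of \<sigma>, so it meets
      \<Delta>; \<open>\<kappa>_disc\<close> then puts the parameter in the right
      half-plane.\<close>
    have "open (\<kappa> ` ball 0 r)"
    proof (rule open_mapping_thm[of \<kappa> "ball 0 r"])
      show "\<kappa> holomorphic_on ball 0 r" by (rule holomorphic_on_subset[OF \<kappa>_hol br])
      show "\<not> \<kappa> constant_on ball 0 r"
      proof
        assume "\<kappa> constant_on ball 0 r"
        then obtain c where c: "\<And>v. v \<in> ball 0 r \<Longrightarrow> \<kappa> v = c" by (auto simp: constant_on_def)
        have "((\<lambda>_. c) has_field_derivative 0) (at 0)" by simp
        then have "(\<kappa> has_field_derivative 0) (at 0)"
          by (rule has_field_derivative_transform_within_open[where S = "ball 0 r"]) (use c r in auto)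
        then show False using \<kappa>_deriv[of 0] s\<^sub>0 by (simp add: DERIV_imp_deriv)
      qed
    qed auto
    moreover have "\<sigma> \<in> \<kappa> ` ball 0 r" using r \<kappa>_0 by force
    moreover have "\<sigma> \<in> closure \<Delta>" using fr by (simp add: frontier_def)
    ultimately have "\<kappa> ` ball 0 r \<inter> \<Delta> \<noteq> {}"
      using open_Int_closure_eq_empty by blast
    then obtain v where v: "norm v < r" "\<kappa> v \<in> \<Delta>" by auto
    have "v \<in> ball 0 r" using v(1) by simp
    then have "- s\<^sub>0 < Re v" using br by blast
    then have Rv: "Re v > 0" using \<kappa>_disc[of v] v(2) \<Delta>D by blast
    have start: "xl < Re (\<Psi> v)" "Re (\<Psi> v) < xr" using \<rho>[OF Rv] v(1) by (auto simp: r_def)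
    have Pv: "E (\<Psi> v) \<in> P" using v(2) \<Psi>[OF Rv] by (simp add: P_def)
    have "path_connected P" using P connected_open_path_connected by blast
    then obtain \<gamma> where \<gamma>: "path \<gamma>" "path_image \<gamma> \<subseteq> P" "pathstart \<gamma> = E (\<Psi> v)" "pathfinish \<gamma> = E w"
      using Pv w unfolding path_connected_def by blast
    obtain \<gamma>' where g': "path \<gamma>'" "pathstart \<gamma>' = \<Psi> v" "\<And>t. t \<in> {0..1} \<Longrightarrow> E (\<gamma>' t) = \<gamma> t"
      using E_lift[OF \<gamma>(1) _ \<gamma>(3)] \<gamma>(2) ran unfolding P_def by blast
    define T where "T = (\<lambda>t. Re (\<gamma>' t)) ` {0..1}"
    have "connected T" unfolding T_def
      using g'(1) by (intro connected_continuous_image continuous_intros) (auto simp: path_def)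
    moreover have "T \<subseteq> chart.lines"
    proof -
      have "E (\<gamma>' t) \<in> P" if "t \<in> {0..1}" for t
        using g'(3)[OF that] \<gamma>(2) that unfolding path_image_def by auto
      then show ?thesis unfolding T_def using P_lines by blast
    qed
    moreover have "Re (\<Psi> v) \<in> T" using g'(2) unfolding T_def pathstart_def by force
    moreover have "Re (\<gamma>' 1) \<in> T" unfolding T_def by auto
    ultimately have fin: "xl < Re (\<gamma>' 1)" "Re (\<gamma>' 1) < xr"
      using start x(2,3) unfolding connected_iff_interval by (meson less_imp_le not_le subsetD)+
    have Ew: "E (\<gamma>' 1) = E w" using g'(3)[of 1] \<gamma>(4) by (simp add: pathfinish_def)
    \<comment> \<open>The lifted path may end at another lift of \<open>E w\<close>;
      \<open>E_shift\<close> transports the ball about w to that endpoint.\<close>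
    have near: "x \<in> chart.lines" if "\<bar>x - Re (\<gamma>' 1)\<bar> < s" for x
    proof -
      have "w + of_real (x - Re (\<gamma>' 1)) \<in> ball w s" using that by (simp add: dist_norm del: of_real_diff)
      then have "E (w + of_real (x - Re (\<gamma>' 1))) \<in> P" using s(2) by blast
      then have "E (\<gamma>' 1 + of_real (x - Re (\<gamma>' 1))) \<in> P" using E_shift[OF Ew] by simp
      from P_lines[OF this] show ?thesis by simp
    qed
    have "a < Re (\<gamma>' 1)"
    proof (rule ccontr)
      assume "\<not> a < Re (\<gamma>' 1)"
      then show False using near[of xl] x(2,4) fin(1) by (auto simp: abs_if split: if_splits)
    qed
    moreover have "Re (\<gamma>' 1) < b"
    proof (rule ccontr)
      assume "\<not> Re (\<gamma>' 1) < b"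
      then show False using near[of xr] x(3,7) fin(2) by (auto simp: abs_if split: if_splits)
    qed
    ultimately have "\<gamma>' 1 \<in> S" by (simp add: S_def)
    then show ?thesis using Ew by (metis imageI)
  qed
  have PQ: "P \<subseteq> E ` S"
  proof
    fix p assume p: "p \<in> P"
    then have "p \<in> range E" using ran by (auto simp: P_def)
    then show "p \<in> E ` S" using lifted p by auto
  qed
  have S: "open S" "connected S"
  proof -
    have "S = {w. a < Re w} \<inter> {w. Re w < b}" by (auto simp: S_def)
    then show "open S" "connected S"
      by (auto intro!: convex_connected convex_Int convex_halfspace_Re_gt convex_halfspace_Re_lt
            open_Int open_halfspace_Re_gt open_halfspace_Re_lt)
  qed
  have Q: "open (E ` S)" "connected (E ` S)" "E ` S \<subseteq> h ` W"
  proof -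
    show "open (E ` S)" by (rule open_E_image[OF S(1)])
    show "connected (E ` S)"
      by (rule connected_continuous_image[OF continuous_on_subset[OF contE] S(2)]) auto
    show "E ` S \<subseteq> h ` W" using a in_image_W_iff unfolding S_def b_def by auto
  qed
  have "E ` S \<subseteq> P"
  proof -
    obtain g where g: "g holomorphic_on h ` unit_disc" "\<And>z. z \<in> unit_disc \<Longrightarrow> g (h z) = z"
      using holomorphic_has_inverse[OF h_hol open_ball h_inj] by metis
    \<comment> \<open>Maximality concerns subsets of the disc, so the image of the strip is first
      pulled back by the inverse of \<open>h\<close>.\<close>
    define C where "C = unit_disc \<inter> h -` (E ` S)"
    have "E ` S \<subseteq> h ` unit_disc" using Q(3) image_mono[OF W_subset, of h] by (rule order.trans)
    moreover have "h ` (unit_disc \<inter> h -` T) = T" if "T \<subseteq> h ` unit_disc" for T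
      using that by blast
    ultimately have hC: "h ` C = E ` S" unfolding C_def by simp
    have CW: "C \<subseteq> W"
    proof
      fix z assume z: "z \<in> C"
      then have "h z \<in> h ` W" using Q(3) by (auto simp: C_def)
      then obtain z' where "z' \<in> W" "h z = h z'" by auto
      then show "z \<in> W" using z W_subset h_inj unfolding C_def by (metis IntD1 inj_onD subsetD)
    qed
    have "open C" unfolding C_def
      by (rule continuous_open_preimage[OF holomorphic_on_imp_continuous_on[OF h_hol] open_ball Q(1)])
    then have CI: "C \<subseteq> interior W" using CW by (simp add: interior_maximal)
    have "C = g ` h ` C" using g(2) by (force simp: C_def)
    then have "C = g ` (E ` S)" by (simp only: hC)
    then have "connected C"
      using Q(2) by (simp only:) (rule connected_continuous_image[OF holomorphic_on_imp_continuous_on[OF holomorphic_on_subset[OF g(1)]]],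
        use \<open>E ` S \<subseteq> h ` unit_disc\<close> in auto)
    moreover have "\<Delta> \<inter> C \<noteq> {}"
    proof -
      obtain z where z: "z \<in> \<Delta>" using \<Delta>(4) by blast
      then have "h z \<in> E ` S" using PQ by (auto simp: P_def)
      then have "z \<in> C" using z \<Delta>D unfolding C_def by (intro IntI vimageI2) auto
      then show ?thesis using z by blast
    qed
    ultimately have "C \<subseteq> \<Delta>" using components_maximal[OF comp _ CI] by simp
    then show ?thesis unfolding P_def hC[symmetric] by blast
  qed
  with PQ have "h ` \<Delta> = E ` S" by (simp add: P_def)
  moreover have "\<exists>xl xr. (\<exists>y. E (Complex xl y) \<notin> h ` unit_disc) \<and> (\<exists>y. E (Complex xr y) \<notin> h ` unit_disc) \<and>
        a - \<delta> < xl \<and> xl \<le> a \<and> a + pi / (- l) \<le> xr \<and> xr < a + pi / (- l) + \<delta>" if "\<delta> > 0" for \<delta>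
    using wall[OF that] unfolding chart.lines_def by (simp only: mem_Collect_eq not_all vimage_eq) blast
  ultimately show ?thesis unfolding S_def b_def by blast
qed

end

subsection \<open>The non-elliptic case\<close>

text \<open>Chain rule for the inverse of \<open>h\<close>: differentiability of orbits in t is
  inherited from the explicit linear flow.\<close>

lemma flow_from_linearization:
  assumes h: "h holomorphic_on unit_disc" "inj_on h unit_disc"
    and \<phi>: "\<And>s. s \<ge> 0 \<Longrightarrow> \<phi> s z \<in> unit_disc" and t: "t \<ge> (0::real)"
    and d: "((\<lambda>s. h (\<phi> s z)) has_vector_derivative d) (at t within {0..})"
  shows "((\<lambda>s. \<phi> s z) has_vector_derivative d / deriv h (\<phi> t z)) (at t within {0..})"
proof -
  obtain g where g: "g holomorphic_on h ` unit_disc"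
    "\<And>z. z \<in> unit_disc \<Longrightarrow> deriv h z * deriv g (h z) = 1" "\<And>z. z \<in> unit_disc \<Longrightarrow> g (h z) = z"
    using holomorphic_has_inverse[OF h(1) open_ball h(2)] by blast
  have "open (h ` unit_disc)" by (rule open_mapping_thm3[OF h(1) open_ball h(2)])
  then have "(g has_field_derivative deriv g (h (\<phi> t z))) (at (h (\<phi> t z)) within (\<lambda>s. h (\<phi> s z)) ` {0..})"
    using holomorphic_derivI[OF g(1)] \<phi>[OF t] by blast
  from field_vector_diff_chain_within[OF d this]
  have "((\<lambda>s. g (h (\<phi> s z))) has_vector_derivative d * deriv g (h (\<phi> t z))) (at t within {0..})"
    by (simp add: o_def)
  moreover have "deriv g (h (\<phi> t z)) = 1 / deriv h (\<phi> t z)"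
    using g(2)[OF \<phi>[OF t]] by (metis nonzero_mult_div_cancel_left mult_zero_left zero_neq_one)
  ultimately have "((\<lambda>s. g (h (\<phi> s z))) has_vector_derivative d / deriv h (\<phi> t z)) (at t within {0..})"
    by simp
  then show ?thesis
    by (rule has_vector_derivative_transform[rotated 2]) (use t g(3) \<phi> in auto)
qed

lemma tendsto_Denjoy_Wolff_point:
  assumes "denjoy_wolff_point \<phi> \<tau>" "z \<in> unit_disc"
  shows "((\<lambda>s. \<phi> s z) \<longlongrightarrow> \<tau>) at_top"
proof -
  have "compact {z} \<and> {z} \<subseteq> unit_disc" using assms(2) by simp
  then have "uniform_limit {z} \<phi> (\<lambda>_. \<tau>) at_top"
    using assms(1) unfolding denjoy_wolff_point_def by blast
  then show ?thesis by (rule tendsto_uniform_limitI) simp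
qed

text \<open>Wolff's lemma: the orbit x_n = \<phi>_(nt)(0) tends to \<tau>, and along a subsequence
  the modulus does not decrease in the next step. There the dilation coefficient may be taken to be
  1.\<close>

lemma Julia_at_Denjoy_Wolff_point:
  assumes sg: "holomorphic_semigroup \<phi>" and dw: "denjoy_wolff_point \<phi> \<tau>"
    and \<tau>: "\<tau> \<in> unit_circle" and z: "z \<in> unit_disc" and t: "t \<ge> 0"
  shows "Re (cayley \<tau> z) \<le> Re (cayley \<tau> (\<phi> t z))"
proof (cases "t = 0")
  case True
  then show ?thesis using sg z by (simp add: holomorphic_semigroup_def)
next
  case False
  then have t: "t > 0" using t by simp
  have \<phi>: "\<phi> s holomorphic_on unit_disc" "\<phi> s ` unit_disc \<subseteq> unit_disc" if "s \<ge> 0" for s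
    using sg that unfolding holomorphic_semigroup_def by blast+
  have \<phi>0: "\<phi> s 0 \<in> unit_disc" if "s \<ge> 0" for s
  proof -
    have "\<phi> s 0 \<in> \<phi> s ` unit_disc" by (rule imageI) simp
    then show ?thesis using \<phi>(2)[OF that] by blast
  qed
  define x where "x = (\<lambda>n::nat. \<phi> (real n * t) 0)"
  have xd: "x n \<in> unit_disc" for n unfolding x_def using t by (intro \<phi>0) auto
  have xS: "\<phi> t (x n) = x (Suc n)" for n
  proof -
    have "\<phi> (t + real n * t) 0 = \<phi> t (\<phi> (real n * t) 0)"
      using sg t unfolding holomorphic_semigroup_def by auto
    then show ?thesis by (simp add: x_def algebra_simps)
  qed
  have "((\<lambda>s. \<phi> s 0) \<longlongrightarrow> \<tau>) at_top" by (rule tendsto_Denjoy_Wolff_point[OF dw]) simp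
  moreover have "filterlim (\<lambda>n. real n * t) at_top sequentially"
    using t by (intro filterlim_at_top_mult_tendsto_pos[OF tendsto_const] filterlim_real_sequentially)
  ultimately have xl: "x \<longlonglongrightarrow> \<tau>" unfolding x_def by (rule filterlim_compose)
  have nl: "(\<lambda>n. norm (x n)) \<longlonglongrightarrow> 1" using tendsto_norm[OF xl] \<tau> by simp
  \<comment> \<open>If the modulus decreased from some index on, it would stay bounded away from
    1.\<close>
  have "infinite {n. norm (x n) \<le> norm (x (Suc n))}"
  proof
    assume "finite {n. norm (x n) \<le> norm (x (Suc n))}"
    then obtain N where N: "\<And>n. norm (x n) \<le> norm (x (Suc n)) \<Longrightarrow> n \<le> N"
      unfolding finite_nat_set_iff_bounded_le by auto
    have "norm (x (Suc N + k)) \<le> norm (x (Suc N))" for k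
    proof (induction k)
      case (Suc k)
      have "\<not> norm (x (Suc N + k)) \<le> norm (x (Suc (Suc N + k)))" using N[of "Suc N + k"] by auto
      then show ?case using Suc by simp
    qed simp
    then have "1 \<le> norm (x (Suc N))"
      by (intro LIMSEQ_le_const2[OF nl]) (metis le_Suc_ex)
    then show False using xd[of "Suc N"] by simp
  qed
  from infinite_enumerate[OF this]
  obtain r :: "nat \<Rightarrow> nat" where r: "strict_mono r" "\<And>n. norm (x (r n)) \<le> norm (x (Suc (r n)))"
    by blast
  have "Re (cayley \<tau> z) \<le> 1 * Re (cayley \<tau> (\<phi> t z))"
  proof (rule Julia_inequality[where x = "x \<circ> r" and \<alpha> = "\<lambda>_. 1"])
    show "\<phi> t holomorphic_on unit_disc" "\<phi> t ` unit_disc \<subseteq> unit_disc" using \<phi> t by auto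
    show "(x \<circ> r) n \<in> unit_disc" for n using xd by simp
    show "(x \<circ> r) \<longlonglongrightarrow> \<tau>" by (rule LIMSEQ_subseq_LIMSEQ[OF xl r(1)])
    have "((\<lambda>n. x (Suc n)) \<circ> r) \<longlonglongrightarrow> \<tau>" by (rule LIMSEQ_subseq_LIMSEQ[OF LIMSEQ_Suc[OF xl] r(1)])
    then show "(\<lambda>n. \<phi> t ((x \<circ> r) n)) \<longlonglongrightarrow> \<tau>" by (simp add: o_def xS)
    show "1 - (norm (\<phi> t ((x \<circ> r) n)))\<^sup>2 \<le> 1 * (1 - (norm ((x \<circ> r) n))\<^sup>2)" for n
      using r(2)[of n] by (simp add: xS power_mono)
  qed (use \<tau> z in auto)
  then show ?thesis by simp
qed

text \<open>The half-plane is attached to the disc so that \<open>\<tau>\<close> corresponds to infinity and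
  \<open>\<sigma>\<close> to \<open>0\<close>.\<close>

lemma boundary_case:
  assumes sg: "holomorphic_semigroup \<phi>" and dw: "denjoy_wolff_point \<phi> \<tau>"
    and \<tau>: "\<tau> \<in> unit_circle" and rep: "repelling_fixed_point \<phi> \<sigma> l" and ne: "\<sigma> \<noteq> \<tau>"
    and h: "h holomorphic_on unit_disc" "inj_on h unit_disc"
    and hflow: "\<And>t z. t \<ge> 0 \<Longrightarrow> z \<in> unit_disc \<Longrightarrow> h (\<phi> t z) = h z + \<i> * of_real t"
    and pet: "petal \<phi> \<Delta>" and fr: "\<sigma> \<in> frontier \<Delta>"
  shows "\<exists>z\<^sub>0. h ` \<Delta> = (+) z\<^sub>0 ` vertical_strip (- (pi / l)) \<and>
           maximal_strip (h ` unit_disc) z\<^sub>0 (- (pi / l))"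
proof -
  have \<phi>D: "\<phi> t z \<in> unit_disc" if "t \<ge> 0" "z \<in> unit_disc" for t z
    using sg that unfolding holomorphic_semigroup_def by blast
  have \<sigma>: "\<sigma> \<in> unit_circle" and l: "l < 0" using rep unfolding repelling_fixed_point_def by auto
  have dh: "deriv h z \<noteq> 0" if "z \<in> unit_disc" for z
    using holomorphic_injective_imp_regular[OF h(1) open_ball h(2)] that by simp
  define G where "G = (\<lambda>z. \<i> / deriv h z)"
  interpret F: repelling_flow \<phi> G \<sigma> l
  proof
    show "G holomorphic_on unit_disc"
      unfolding G_def by (intro holomorphic_intros holomorphic_deriv[OF h(1)] dh) auto
    fix z :: complex and t :: real assume z: "z \<in> unit_disc" and t: "t \<ge> 0"
    have "((\<lambda>s. h z + \<i> * of_real s) has_vector_derivative \<i>) (at t within {0..})"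
      by (auto intro!: derivative_eq_intros)
    then have "((\<lambda>s. h (\<phi> s z)) has_vector_derivative \<i>) (at t within {0..})"
      by (rule has_vector_derivative_transform[rotated 2]) (use t z hflow in auto)
    then show "((\<lambda>s. \<phi> s z) has_vector_derivative G (\<phi> t z)) (at t within {0..})"
      unfolding G_def by (intro flow_from_linearization[OF h _ t] \<phi>D z)
  qed (use sg rep in auto)
  \<comment> \<open>The Cayley transform at \<tau> sends the disc to the half-plane and \<tau> to
    infinity; the boundary point \<sigma> goes to the imaginary number c. Below, \<kappa> is the
    inverse of z -> cayley \<tau> z - c, whose only pole -1 - c has real part -1.\<close>
  define c where "c = cayley \<tau> \<sigma>"
  have Rc: "Re c = 0" unfolding c_def using Re_cayley[OF \<tau>, of \<sigma>] \<sigma> by simp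
  define u where "u = (\<lambda>v. v + c + 1)"
  have u: "u v \<noteq> 0" if "Re v > - 1" for v
  proof
    assume "u v = 0"
    then have "Re (u v) = 0" by simp
    then show False using that Rc by (simp add: u_def)
  qed
  define \<kappa> where "\<kappa> = (\<lambda>v. \<tau> * (v + c - 1) / u v)"
  have D\<kappa>: "(\<kappa> has_field_derivative 2 * \<tau> / (u v)\<^sup>2) (at v)" if "Re v > - 1" for v
    unfolding \<kappa>_def u_def using u[OF that]
    by (auto intro!: derivative_eq_intros simp: u_def power2_eq_square algebra_simps)
  have d\<kappa>: "deriv \<kappa> v = 2 * \<tau> / (u v)\<^sup>2" if "Re v > - 1" for v
    by (rule DERIV_imp_deriv[OF D\<kappa>[OF that]])
  have n\<kappa>: "1 - (norm (\<kappa> v))\<^sup>2 = 4 * Re v / (norm (u v))\<^sup>2" if "Re v > - 1" for v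
  proof -
    have "(norm (u v))\<^sup>2 - (norm (v + c - 1))\<^sup>2 = 4 * Re v"
      unfolding u_def using Rc by (simp only: cmod_power2) (simp add: power2_eq_square algebra_simps)
    moreover have "(norm (\<kappa> v))\<^sup>2 = (norm (v + c - 1))\<^sup>2 / (norm (u v))\<^sup>2"
      using \<tau> by (simp add: \<kappa>_def norm_divide norm_mult power_divide)
    moreover have "(norm (u v))\<^sup>2 \<noteq> 0" using u[OF that] by simp
    ultimately show ?thesis by (metis diff_divide_distrib divide_self)
  qed
  have nd: "norm (deriv \<kappa> v) = 2 / (norm (u v))\<^sup>2" if "Re v > - 1" for v
    using \<tau> by (simp add: d\<kappa>[OF that] norm_divide norm_mult norm_power)
  have \<kappa>D: "\<kappa> v \<in> unit_disc \<longleftrightarrow> Re v > 0" if "Re v > - 1" for v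
  proof -
    have "\<kappa> v \<in> unit_disc \<longleftrightarrow> 1 - (norm (\<kappa> v))\<^sup>2 > 0" by (simp add: abs_square_less_1)
    also have "\<dots> \<longleftrightarrow> Re v > 0" using n\<kappa>[OF that] u[OF that] by (simp add: zero_less_divide_iff)
    finally show ?thesis .
  qed
  interpret U: uniformized_flow \<phi> G \<sigma> l h "\<lambda>w. w" \<kappa> "\<lambda>v. h (\<kappa> v)" 1
  proof
    show \<kappa>h: "\<kappa> holomorphic_on {v. Re v > - 1}"
      by (rule holomorphic_onI) (use D\<kappa> in \<open>auto simp: field_differentiable_def intro: has_field_derivative_at_within\<close>)
    show "\<kappa> 0 = \<sigma>"
    proof -
      have "\<tau> - \<sigma> \<noteq> 0" "\<tau> \<noteq> 0" using ne \<tau> by auto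
      then have 1: "c - 1 = 2 * \<sigma> / (\<tau> - \<sigma>)" "c + 1 = 2 * \<tau> / (\<tau> - \<sigma>)"
        by (simp_all add: c_def cayley_def field_simps)
      show ?thesis using \<open>\<tau> - \<sigma> \<noteq> 0\<close> \<open>\<tau> \<noteq> 0\<close> by (simp add: \<kappa>_def u_def 1)
    qed
    have "\<kappa> holomorphic_on right_half_plane" by (rule holomorphic_on_subset[OF \<kappa>h]) auto
    then have "(h \<circ> \<kappa>) holomorphic_on right_half_plane"
      by (rule holomorphic_on_compose_gen[OF _ h(1)]) (use \<kappa>D in auto)
    then show "(\<lambda>v. h (\<kappa> v)) holomorphic_on right_half_plane" by (simp add: o_def)
  next
    fix v :: complex assume v: "Re v > 0"
    then have v1: "Re v > - 1" by simp
    have t0: "\<tau> \<noteq> 0" using \<tau> by auto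
    have kd: "\<kappa> v \<in> unit_disc" using \<kappa>D[OF v1] v by simp
    \<comment> \<open>As cayley \<tau> (\<kappa> v) = v + c, the generator in the coordinate v is
      the derivative of the Cayley transform along the flow.\<close>
    have "\<tau> - \<kappa> v = 2 * \<tau> / u v"
      using u[OF v1] by (simp add: \<kappa>_def field_simps) (simp add: u_def algebra_simps)
    then have "2 * \<tau> / (\<tau> - \<kappa> v)\<^sup>2 * G (\<kappa> v) = G (\<kappa> v) / deriv \<kappa> v"
      using t0 u[OF v1] by (simp add: d\<kappa>[OF v1] power_divide power2_eq_square)
    moreover have "0 * Re (cayley \<tau> (\<kappa> v)) \<le> Re (2 * \<tau> / (\<tau> - \<kappa> v)\<^sup>2 * G (\<kappa> v))"
      by (rule F.Re_generator_ge[OF \<tau> kd]) (use Julia_at_Denjoy_Wolff_point[OF sg dw \<tau> kd] in simp)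
    ultimately show "Re (G (\<kappa> v) / deriv \<kappa> v) \<ge> 0" by simp
  next
    fix v :: complex assume v: "- 1 < Re v"
    show "deriv \<kappa> v \<noteq> 0" using \<tau> u[OF v] by (auto simp: d\<kappa>[OF v])
    show "\<kappa> v \<in> unit_disc \<longleftrightarrow> 0 < Re v" by (rule \<kappa>D[OF v])
  next
    fix v :: complex assume v: "0 < Re v" "norm v < 1"
    then have v1: "Re v > - 1" by simp
    \<comment> \<open>Here 1 - |\<kappa>|^2 equals 2 Re v |\<kappa>'|, which lies between the two
      required bounds.\<close>
    define n where "n = (norm (u v))\<^sup>2"
    have "Re v / n \<ge> 0" using v by (simp add: n_def)
    moreover have "Re v * (2 / n) = 2 * (Re v / n)" "4 * Re v / n = 4 * (Re v / n)"
      "6 * Re v * (2 / n) = 12 * (Re v / n)" by simp_all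
    ultimately show "Re v * norm (deriv \<kappa> v) \<le> 1 - (norm (\<kappa> v))\<^sup>2"
       "1 - (norm (\<kappa> v))\<^sup>2 \<le> 6 * Re v * norm (deriv \<kappa> v)"
      unfolding nd[OF v1] n\<kappa>[OF v1] n_def[symmetric] by linarith+
  next
    fix \<gamma> :: "real \<Rightarrow> complex" and w assume "path \<gamma>" "pathstart \<gamma> = w"
    then show "\<exists>\<gamma>'. path \<gamma>' \<and> pathstart \<gamma>' = w \<and> (\<forall>t\<in>{0..1}. \<gamma>' t = \<gamma> t)" by blast
  qed (use h hflow in auto)
  define \<rho> where "\<rho> = - (pi / l)"
  have \<rho>: "\<rho> > 0" "pi / (- l) = \<rho>" using l by (auto simp: \<rho>_def divide_less_0_iff)
  have "h ` \<Delta> \<subseteq> range (\<lambda>w. w)" by simp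
  from U.image_of_petal[OF pet fr this]
  obtain a where a: "h ` \<Delta> = {w. a < Re w \<and> Re w < a + \<rho>}"
    and wall: "\<And>\<delta>. \<delta> > 0 \<Longrightarrow> \<exists>xl xr. (\<exists>y. Complex xl y \<notin> h ` unit_disc) \<and> (\<exists>y. Complex xr y \<notin> h ` unit_disc) \<and>
        a - \<delta> < xl \<and> xl \<le> a \<and> a + \<rho> \<le> xr \<and> xr < a + \<rho> + \<delta>"
    unfolding \<rho>(2) image_ident by blast
  have strip: "(+) z ` vertical_strip r = {w. Re z < Re w \<and> Re w < Re z + r}" for z r
  proof (intro set_eqI iffI)
    fix w assume "w \<in> {w. Re z < Re w \<and> Re w < Re z + r}"
    then have "w - z \<in> vertical_strip r" by (simp add: vertical_strip_def)
    then have "z + (w - z) \<in> (+) z ` vertical_strip r" by (rule imageI)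
    then show "w \<in> (+) z ` vertical_strip r" by simp
  qed (auto simp: vertical_strip_def)
  have eq: "h ` \<Delta> = (+) (of_real a) ` vertical_strip \<rho>"
    using a by (simp add: strip)
  have \<Delta>D: "\<Delta> \<subseteq> unit_disc" by (rule U.petal_subset_disc[OF pet])
  have "maximal_strip (h ` unit_disc) (of_real a) \<rho>"
    unfolding maximal_strip_def
  proof (intro conjI notI)
    show "strip_in (h ` unit_disc) (of_real a) \<rho>"
      unfolding strip_in_def eq[symmetric] using \<rho> \<Delta>D by auto
    assume "\<exists>z\<^sub>1 r. strip_in (h ` unit_disc) z\<^sub>1 r \<and>
      (+) (of_real a) ` vertical_strip \<rho> \<subset> (+) z\<^sub>1 ` vertical_strip r"
    then obtain z1 r where zr: "(+) z1 ` vertical_strip r \<subseteq> h ` unit_disc"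
      "(+) (of_real a) ` vertical_strip \<rho> \<subset> (+) z1 ` vertical_strip r"
      unfolding strip_in_def by blast
    have inU: "Complex x y \<in> h ` unit_disc" if "Re z1 < x" "x < Re z1 + r" for x y
      using zr(1) that unfolding strip by auto
    have "Complex (a + \<rho> / 2) 0 \<in> (+) (of_real a) ` vertical_strip \<rho>"
      unfolding strip using \<rho>(1) by simp
    then have "Complex (a + \<rho> / 2) 0 \<in> (+) z1 ` vertical_strip r"
      using psubset_imp_subset[OF zr(2)] by blast
    then have mid: "Re z1 < a + \<rho> / 2" "a + \<rho> / 2 < Re z1 + r" unfolding strip by auto
    \<comment> \<open>A strip reaching beyond the edge would contain a whole line over a missing
      abscissa: the walls are taken with \<delta> equal to the overshoot.\<close>
    have "a \<le> Re z1"
    proof (rule ccontr)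
      assume "\<not> a \<le> Re z1"
      then obtain x where "\<exists>y. Complex x y \<notin> h ` unit_disc" "Re z1 < x" "x \<le> a"
        using wall[of "a - Re z1"] by auto
      then show False using inU[of x] mid \<rho>(1) by auto
    qed
    moreover have "Re z1 + r \<le> a + \<rho>"
    proof (rule ccontr)
      assume "\<not> Re z1 + r \<le> a + \<rho>"
      then obtain x where "\<exists>y. Complex x y \<notin> h ` unit_disc" "a + \<rho> \<le> x" "x < Re z1 + r"
        using wall[of "Re z1 + r - (a + \<rho>)"] by auto
      then show False using inU[of x] mid \<rho>(1) by auto
    qed
    ultimately have "(+) z1 ` vertical_strip r \<subseteq> (+) (of_real a) ` vertical_strip \<rho>"
      unfolding strip by auto
    then show False using zr(2) by blast
  qed
  then show ?thesis using eq unfolding \<rho>_def by blast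
qed

subsection \<open>The elliptic case\<close>

text \<open>Otherwise the inverse of \<open>h\<close> would be a bounded entire function, hence
  constant.\<close>

lemma univalent_image_ne_UNIV:
  assumes h: "h holomorphic_on unit_disc" "inj_on h unit_disc"
  shows "h ` unit_disc \<noteq> UNIV"
proof
  assume U: "h ` unit_disc = UNIV"
  obtain g where g: "g holomorphic_on h ` unit_disc" "\<And>z. z \<in> unit_disc \<Longrightarrow> g (h z) = z"
    using holomorphic_has_inverse[OF h(1) open_ball h(2)] by metis
  have "g w \<in> unit_disc" for w
  proof -
    have "w \<in> h ` unit_disc" using U by simp
    then show ?thesis using g(2) by auto
  qed
  then have "range g \<subseteq> unit_disc" by blast
  then have "bounded (range g)" using bounded_ball bounded_subset by blast
  then have "g constant_on UNIV" using g(1) U by (intro Liouville_theorem) auto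
  then obtain c where "\<And>w. g w = c" by (auto simp: constant_on_def)
  then show False using g(2)[of 0] g(2)[of "1/2"] by auto
qed

text \<open>exp(t\<mu> + i\<theta>) is exp(i\<mu>w) at w = \<theta>/\<mu> - it, and Re w = \<theta>
  k with k = Re(1/\<mu>). Sectors are thus images of vertical strips, with angles scaled by
  k.\<close>

lemma Spir_eq_image:
  assumes "Re \<mu> > 0"
  defines "k \<equiv> Re \<mu> / (norm \<mu>)\<^sup>2"
  shows "Spir \<mu> A \<theta>\<^sub>0 = (\<lambda>w. exp (\<i> * \<mu> * w)) ` {w. (\<theta>\<^sub>0 - A / 2) * k < Re w \<and> Re w < (\<theta>\<^sub>0 + A / 2) * k}"
    (is "_ = ?E ` ?S")
proof -
  have \<mu>: "\<mu> \<noteq> 0" using assms by auto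
  then have k: "k > 0" using assms by (simp add: k_def)
  have Rk: "Re (of_real \<theta> / \<mu>) = \<theta> * k" for \<theta>
    by (simp only: k_def Re_divide cmod_power2) simp
  have key: "\<i> * \<mu> * (of_real \<theta> / \<mu> - \<i> * of_real t) = of_real t * \<mu> + \<i> * of_real \<theta>" for \<theta> t
    using \<mu> by (simp add: algebra_simps)
  show ?thesis
  proof (intro set_eqI iffI)
    fix p assume "p \<in> Spir \<mu> A \<theta>\<^sub>0"
    then obtain t \<theta> where p: "p = exp (of_real t * \<mu> + \<i> * of_real \<theta>)"
      and \<theta>: "\<theta>\<^sub>0 - A / 2 < \<theta>" "\<theta> < \<theta>\<^sub>0 + A / 2" by (auto simp: Spir_def)
    define w where "w = of_real \<theta> / \<mu> - \<i> * of_real t"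
    have "\<i> * \<mu> * w = of_real t * \<mu> + \<i> * of_real \<theta>" unfolding w_def by (rule key)
    then have "p = ?E w" by (simp add: p)
    moreover have "w \<in> ?S" using \<theta> k Rk[of \<theta>] by (simp add: w_def mult_strict_right_mono)
    ultimately show "p \<in> ?E ` ?S" by blast
  next
    fix p assume "p \<in> ?E ` ?S"
    then obtain w where w: "p = ?E w" "(\<theta>\<^sub>0 - A / 2) * k < Re w" "Re w < (\<theta>\<^sub>0 + A / 2) * k" by auto
    define \<theta> where "\<theta> = Re w / k"
    define t where "t = - Im (w - of_real \<theta> / \<mu>)"
    have "w - of_real \<theta> / \<mu> = - \<i> * of_real t"
      using k Rk[of \<theta>] by (simp add: complex_eq_iff t_def \<theta>_def)
    then have "w = of_real \<theta> / \<mu> - \<i> * of_real t" by (simp add: algebra_simps)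
    then have "\<i> * \<mu> * w = of_real t * \<mu> + \<i> * of_real \<theta>" by (simp only: key)
    then have "p = exp (of_real t * \<mu> + \<i> * of_real \<theta>)" by (simp add: w(1))
    moreover have "\<theta> \<in> {\<theta>\<^sub>0 - A / 2<..<\<theta>\<^sub>0 + A / 2}"
      using w k by (simp add: \<theta>_def less_divide_eq divide_less_eq)
    ultimately show "p \<in> Spir \<mu> A \<theta>\<^sub>0" unfolding Spir_def by blast
  qed
qed

lemma Spir_shift: "Spir \<mu> A (\<theta> - 2 * pi * of_int n) = Spir \<mu> A \<theta>"
proof -
  have sub: "Spir \<mu> A \<theta> \<subseteq> Spir \<mu> A (\<theta> - 2 * pi * of_int n)" for \<theta> and n :: int
  proof
    fix p assume "p \<in> Spir \<mu> A \<theta>"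
    then obtain t s where p: "p = exp (of_real t * \<mu> + \<i> * of_real s)"
      and s: "\<theta> - A / 2 < s" "s < \<theta> + A / 2" by (auto simp: Spir_def)
    have "of_real t * \<mu> + \<i> * of_real s
        = (of_real t * \<mu> + \<i> * of_real (s - 2 * pi * of_int n)) + \<i> * (of_int n * (of_real pi * 2))"
      by (simp add: algebra_simps)
    then have "p = exp (of_real t * \<mu> + \<i> * of_real (s - 2 * pi * of_int n))"
      unfolding p by (simp only: exp_plus_2pin)
    moreover have "s - 2 * pi * of_int n \<in> {\<theta> - 2 * pi * of_int n - A / 2<..<\<theta> - 2 * pi * of_int n + A / 2}"
      using s by auto
    ultimately show "p \<in> Spir \<mu> A (\<theta> - 2 * pi * of_int n)" unfolding Spir_def by blast
  qed
  show ?thesis using sub[of \<theta> n] sub[of "\<theta> - 2 * pi * of_int n" "- n"] by auto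
qed

lemma Moebius_inverse_identities:
  fixes \<tau> \<xi> :: complex
  assumes \<tau>: "norm \<tau> < 1" and D: "1 + cnj \<tau> * \<xi> \<noteq> 0"
  defines "z \<equiv> (\<xi> + \<tau>) / (1 + cnj \<tau> * \<xi>)" and "k \<equiv> 1 - cnj \<tau> * \<tau>"
  shows "k \<noteq> 0" "1 - cnj \<tau> * z = k / (1 + cnj \<tau> * \<xi>)" "(z - \<tau>) / (1 - cnj \<tau> * z) = \<xi>"
proof -
  show k: "k \<noteq> 0" unfolding k_def using one_minus_cnj_mult_nonzero[of \<tau> \<tau>] \<tau> by simp
  show 1: "1 - cnj \<tau> * z = k / (1 + cnj \<tau> * \<xi>)"
    using D by (simp add: z_def k_def field_simps)
  have "z - \<tau> = \<xi> * k / (1 + cnj \<tau> * \<xi>)"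
    using D by (simp add: z_def k_def field_simps)
  then show "(z - \<tau>) / (1 - cnj \<tau> * z) = \<xi>" using k D by (simp add: 1)
qed

text \<open>The disc without \<open>\<tau>\<close> is covered by the half-plane through \<open>v \<mapsto> \<eta> e\<^sup>-\<^sup>v\<close>, followed by the
  automorphism that takes \<open>0\<close> to \<open>\<tau>\<close>; again \<open>0\<close> corresponds to \<open>\<sigma>\<close>.\<close>

lemma elliptic_case:
  assumes sg: "holomorphic_semigroup \<phi>" and dw: "denjoy_wolff_point \<phi> \<tau>"
    and \<tau>: "\<tau> \<in> unit_disc" and \<mu>: "Re \<mu> > 0" and rep: "repelling_fixed_point \<phi> \<sigma> l"
    and h: "h holomorphic_on unit_disc" "inj_on h unit_disc"
    and hflow: "\<And>t z. t \<ge> 0 \<Longrightarrow> z \<in> unit_disc \<Longrightarrow> h (\<phi> t z) = exp (- \<mu> * of_real t) * h z"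
    and pet: "petal \<phi> \<Delta>" and fr: "\<sigma> \<in> frontier \<Delta>"
  shows "\<exists>\<theta>\<^sub>0\<in>{-pi..<pi}.
              h ` \<Delta> = Spir \<mu> (- ((norm \<mu>)\<^sup>2 * pi / (l * Re \<mu>))) \<theta>\<^sub>0 \<and>
              maximal_spirallike_sector (h ` unit_disc) \<mu> (- ((norm \<mu>)\<^sup>2 * pi / (l * Re \<mu>))) \<theta>\<^sub>0"
proof -
  have \<phi>D: "\<phi> t z \<in> unit_disc" if "t \<ge> 0" "z \<in> unit_disc" for t z
    using sg that unfolding holomorphic_semigroup_def by blast
  have \<mu>0: "\<mu> \<noteq> 0" using \<mu> by auto
  have \<tau>1: "norm \<tau> < 1" using \<tau> by simp
  have \<sigma>: "\<sigma> \<in> unit_circle" and l: "l < 0" using rep unfolding repelling_fixed_point_def by auto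
  have dh: "deriv h z \<noteq> 0" if "z \<in> unit_disc" for z
    using holomorphic_injective_imp_regular[OF h(1) open_ball h(2)] that by simp
  have decay: "((\<lambda>s. exp (- \<mu> * of_real s) * c) \<longlongrightarrow> 0) at_top" for c
  proof -
    have "((\<lambda>s. exp (- (Re \<mu> * s))) \<longlongrightarrow> 0) at_top"
      by (rule filterlim_compose[OF exp_at_bot])
         (use \<mu> in \<open>simp add: filterlim_uminus_at_bot filterlim_tendsto_pos_mult_at_top[OF tendsto_const _ filterlim_ident]\<close>)
    then have "((\<lambda>s. exp (- \<mu> * of_real s)) \<longlongrightarrow> 0) at_top"
      by (intro tendsto_norm_zero_cancel[where f = "\<lambda>s. exp (- \<mu> * of_real s)"]) simp
    then show ?thesis by (rule tendsto_mult_left_zero)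
  qed
  \<comment> \<open>The orbit of 0 tends to \<tau>, while its image under \<open>h\<close> decays to
    0 by the linear model.\<close>
  have h\<tau>: "h \<tau> = 0"
  proof (rule tendsto_unique)
    have "isCont h \<tau>"
      using continuous_on_interior[OF holomorphic_on_imp_continuous_on[OF h(1)]] \<tau> by simp
    then show "((\<lambda>s. h (\<phi> s 0)) \<longlongrightarrow> h \<tau>) at_top"
      by (rule isCont_tendsto_compose) (rule tendsto_Denjoy_Wolff_point[OF dw], simp)
    show "((\<lambda>s. h (\<phi> s 0)) \<longlongrightarrow> 0) at_top"
      by (rule Lim_transform_eventually[OF decay[of "h 0"]])
         (use hflow[of _ 0] in \<open>auto intro!: eventually_at_top_linorderI[of 0]\<close>)
  qed simp
  have \<phi>\<tau>: "\<phi> t \<tau> = \<tau>" if "t \<ge> 0" for t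
    using inj_onD[OF h(2), of "\<phi> t \<tau>" \<tau>] hflow[OF that \<tau>] h\<tau> \<phi>D[OF that \<tau>] \<tau> by simp
  define G where "G = (\<lambda>z. - \<mu> * h z / deriv h z)"
  interpret F: repelling_flow \<phi> G \<sigma> l
  proof
    show "G holomorphic_on unit_disc"
      unfolding G_def by (intro holomorphic_intros h(1) holomorphic_deriv[OF h(1)] dh) auto
    fix z :: complex and t :: real assume z: "z \<in> unit_disc" and t: "t \<ge> 0"
    have "((\<lambda>x. exp (- \<mu> * x) * h z) has_field_derivative - \<mu> * (exp (- \<mu> * of_real t) * h z)) (at (of_real t))"
      by (auto intro!: derivative_eq_intros)
    then have "((\<lambda>s. exp (- \<mu> * of_real s) * h z) has_vector_derivative - \<mu> * (exp (- \<mu> * of_real t) * h z)) (at t within {0..})"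
      by (rule has_vector_derivative_real_field)
    then have "((\<lambda>s. exp (- \<mu> * of_real s) * h z) has_vector_derivative - \<mu> * h (\<phi> t z)) (at t within {0..})"
      by (simp only: hflow[OF t z])
    then have "((\<lambda>s. h (\<phi> s z)) has_vector_derivative - \<mu> * h (\<phi> t z)) (at t within {0..})"
      by (rule has_vector_derivative_transform[rotated 2]) (use t z hflow in auto)
    then show "((\<lambda>s. \<phi> s z) has_vector_derivative G (\<phi> t z)) (at t within {0..})"
      unfolding G_def by (intro flow_from_linearization[OF h _ t] \<phi>D z)
  qed (use sg rep in auto)
  define M where "M = (\<lambda>z. (z - \<tau>) / (1 - cnj \<tau> * z))"
  define \<eta> where "\<eta> = M \<sigma>"
  have "norm (cnj \<tau> * \<sigma>) < 1" using \<tau>1 \<sigma> by (simp add: norm_mult)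
  then have \<tau>\<sigma>: "1 - cnj \<tau> * \<sigma> \<noteq> 0" by (metis norm_one less_irrefl right_minus_eq)
  have \<eta>: "norm \<eta> = 1"
  proof -
    have "1 - (norm \<eta>)\<^sup>2 = 0"
      unfolding \<eta>_def M_def one_minus_norm_Moebius_sq[OF \<tau>\<sigma>] using \<sigma> by simp
    then show ?thesis using norm_ge_zero[of \<eta>] by (simp add: power2_eq_1_iff del: norm_ge_zero)
  qed
  define k where "k = 1 - cnj \<tau> * \<tau>"
  have k: "k = of_real (1 - (norm \<tau>)\<^sup>2)" "1 - (norm \<tau>)\<^sup>2 > 0" "norm k = 1 - (norm \<tau>)\<^sup>2"
  proof -
    show 1: "k = of_real (1 - (norm \<tau>)\<^sup>2)" using complex_norm_square[of \<tau>] by (simp add: k_def mult.commute)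
    show 2: "1 - (norm \<tau>)\<^sup>2 > 0" using \<tau>1 by (simp add: abs_square_less_1)
    show "norm k = 1 - (norm \<tau>)\<^sup>2" unfolding 1 using 2 by (simp only: norm_of_real)
  qed
  define \<xi> where "\<xi> = (\<lambda>v. \<eta> * exp (- v))"
  define D where "D = (\<lambda>v. 1 + cnj \<tau> * \<xi> v)"
  \<comment> \<open>The denominator \<open>D\<close> can vanish only where |\<tau>| exp(-Re v) = 1.
    This choice gives |\<tau>| \<open>exp s\<^sub>0\<close> < 1, with \<open>s\<^sub>0\<close> > 0
    because |\<tau>| < 1.\<close>
  define s\<^sub>0 where "s\<^sub>0 = ln (2 / (1 + norm \<tau>))"
  have s\<^sub>0: "s\<^sub>0 > 0" "exp s\<^sub>0 = 2 / (1 + norm \<tau>)"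
  proof -
    have "1 < 2 / (1 + norm \<tau>)" "0 < 2 / (1 + norm \<tau>)" using \<tau>1 by (auto simp: field_simps add_pos_nonneg)
    then show "s\<^sub>0 > 0" "exp s\<^sub>0 = 2 / (1 + norm \<tau>)" unfolding s\<^sub>0_def by (auto simp: ln_gt_zero)
  qed
  have n\<xi>: "norm (\<xi> v) = exp (- Re v)" for v using \<eta> by (simp add: \<xi>_def norm_mult)
  have D: "D v \<noteq> 0" if "Re v > - s\<^sub>0" for v
  proof
    assume "D v = 0"
    then have "cnj \<tau> * \<xi> v = - 1" by (simp add: D_def add_eq_0_iff)
    then have "norm (cnj \<tau> * \<xi> v) = 1" by simp
    then have "norm \<tau> * exp (- Re v) = 1" by (simp add: norm_mult n\<xi>)
    moreover have "norm \<tau> * exp (- Re v) \<le> norm \<tau> * exp s\<^sub>0"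
      using that by (intro mult_left_mono) auto
    moreover have "norm \<tau> * exp s\<^sub>0 < 1"
      unfolding s\<^sub>0(2) using \<tau>1 by (simp add: field_simps add_pos_nonneg)
    ultimately show False by simp
  qed
  define \<kappa> where "\<kappa> = (\<lambda>v. (\<xi> v + \<tau>) / D v)"
  have D\<kappa>: "(\<kappa> has_field_derivative - k * \<xi> v / (D v)\<^sup>2) (at v)" if "Re v > - s\<^sub>0" for v
  proof -
    have "(\<xi> has_field_derivative - \<xi> v) (at v)"
      unfolding \<xi>_def by (auto intro!: derivative_eq_intros)
    moreover have "(D has_field_derivative cnj \<tau> * (- \<xi> v)) (at v)"
      unfolding D_def by (auto intro!: derivative_eq_intros \<open>(\<xi> has_field_derivative - \<xi> v) (at v)\<close>)
    ultimately have "(\<kappa> has_field_derivative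
        ((- \<xi> v) * D v - (\<xi> v + \<tau>) * (cnj \<tau> * (- \<xi> v))) / (D v * D v)) (at v)"
      unfolding \<kappa>_def using D[OF that] by (auto intro!: derivative_eq_intros)
    moreover have "(- \<xi> v) * D v - (\<xi> v + \<tau>) * (cnj \<tau> * (- \<xi> v)) = - k * \<xi> v"
      by (simp add: D_def k_def algebra_simps)
    ultimately show ?thesis by (simp add: power2_eq_square)
  qed
  have d\<kappa>: "deriv \<kappa> v = - k * \<xi> v / (D v)\<^sup>2" if "Re v > - s\<^sub>0" for v
    by (rule DERIV_imp_deriv[OF D\<kappa>[OF that]])
  have nd: "norm (deriv \<kappa> v) = exp (- Re v) * (norm k / (norm (D v))\<^sup>2)" if "Re v > - s\<^sub>0" for v
    by (simp add: d\<kappa>[OF that] norm_divide norm_mult norm_power n\<xi>)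
  have n\<kappa>: "1 - (norm (\<kappa> v))\<^sup>2 = (1 - exp (- Re v) ^ 2) * (norm k / (norm (D v))\<^sup>2)" if "Re v > - s\<^sub>0" for v
    using one_minus_norm_Moebius_sq[of "- \<tau>" "\<xi> v"] D[OF that]
    by (simp add: \<kappa>_def D_def k(3) n\<xi>)
  have kD: "norm k / (norm (D v))\<^sup>2 > 0" if "Re v > - s\<^sub>0" for v
    using k D[OF that] by simp
  have \<kappa>D: "\<kappa> v \<in> unit_disc \<longleftrightarrow> Re v > 0" if "Re v > - s\<^sub>0" for v
  proof -
    have "\<kappa> v \<in> unit_disc \<longleftrightarrow> 1 - (norm (\<kappa> v))\<^sup>2 > 0" by (simp add: abs_square_less_1)
    also have "\<dots> \<longleftrightarrow> 1 - exp (- Re v) ^ 2 > 0"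
      unfolding n\<kappa>[OF that] using kD[OF that] by (simp only: zero_less_mult_iff) auto
    also have "\<dots> \<longleftrightarrow> Re v > 0" by (simp add: abs_square_less_1)
    finally show ?thesis .
  qed
  have inv: "1 - cnj \<tau> * \<kappa> v = k / D v" "M (\<kappa> v) = \<xi> v" if "Re v > - s\<^sub>0" for v
    using Moebius_inverse_identities(2,3)[OF \<tau>1, of "\<xi> v"] D[OF that]
    unfolding \<kappa>_def D_def M_def k_def by blast+
  have \<xi>0: "\<xi> v \<noteq> 0" for v using \<eta> by (auto simp: \<xi>_def)
  have \<kappa>h: "\<kappa> holomorphic_on {v. Re v > - s\<^sub>0}"
    by (rule holomorphic_onI) (use D\<kappa> in \<open>auto simp: field_differentiable_def intro: has_field_derivative_at_within\<close>)
  have sub: "right_half_plane \<subseteq> {v. Re v > - s\<^sub>0}" using s\<^sub>0(1) by auto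
  have "(h \<circ> \<kappa>) holomorphic_on right_half_plane"
    by (rule holomorphic_on_compose_gen[OF holomorphic_on_subset[OF \<kappa>h sub] h(1)]) (use \<kappa>D s\<^sub>0 in auto)
  moreover have "(h \<circ> \<kappa>) v \<noteq> 0" if "v \<in> right_half_plane" for v
  proof
    assume "(h \<circ> \<kappa>) v = 0"
    have v: "Re v > - s\<^sub>0" "Re v > 0" using that s\<^sub>0 by auto
    have "\<kappa> v = \<tau>" using \<open>(h \<circ> \<kappa>) v = 0\<close> h\<tau> inj_onD[OF h(2), of "\<kappa> v" \<tau>] \<kappa>D[OF v(1)] v(2) \<tau> by simp
    then have "\<xi> v = 0" using inv(2)[OF v(1)] by (simp add: M_def)
    then show False using \<xi>0 by simp
  qed
  moreover have "1 \<in> right_half_plane" by simp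
  \<comment> \<open>Since \<kappa> omits \<tau> on the half-plane, the function h(\<kappa> v) has no
    zero there, and convexity provides a holomorphic logarithm.\<close>
  ultimately obtain g where g: "g holomorphic_on right_half_plane"
    "\<And>v. v \<in> right_half_plane \<Longrightarrow> exp (g v) = (h \<circ> \<kappa>) v"
    using holomorphic_logarithm_exists[OF convex_right_half_plane open_right_half_plane] by metis
  define E where "E = (\<lambda>w. exp (\<i> * \<mu> * w))"
  define \<Psi> where "\<Psi> = (\<lambda>v. g v / (\<i> * \<mu>))"
  have E_Ln: "E (Ln z / (\<i> * \<mu>)) = z" if "z \<noteq> 0" for z using that \<mu>0 by (simp add: E_def)
  have rE: "range E = - {0}"
  proof -
    from E_Ln have "- {0} \<subseteq> range E" by (metis ComplD rangeI singletonI subsetI)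
    moreover have "range E \<subseteq> - {0}" by (auto simp: E_def)
    ultimately show ?thesis by blast
  qed
  have DE: "(E has_field_derivative \<i> * \<mu> * E w) (at w)" for w
    unfolding E_def by (auto intro!: derivative_eq_intros)
  have Eadd: "E (w + u) = E w * E u" for w u by (simp add: E_def exp_add distrib_left)
  interpret U: uniformized_flow \<phi> G \<sigma> l h E \<kappa> \<Psi> s\<^sub>0
  proof
    show "E holomorphic_on UNIV" unfolding E_def by (intro holomorphic_intros)
    show "deriv E w \<noteq> 0" for w using DERIV_imp_deriv[OF DE[of w]] \<mu>0 by (simp add: E_def)
    show "E (w + u) = E (w' + u)" if "E w = E w'" for w w' u using that by (simp add: Eadd)
    show "\<kappa> holomorphic_on {v. Re v > - s\<^sub>0}" by (rule \<kappa>h)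
    show "\<kappa> 0 = \<sigma>"
    proof -
      have "1 + cnj (- \<tau>) * \<sigma> \<noteq> 0" using \<tau>\<sigma> by simp
      from Moebius_inverse_identities(3)[OF _ this] \<tau>1
      show ?thesis by (simp add: \<kappa>_def D_def \<xi>_def \<eta>_def M_def)
    qed
    show "\<Psi> holomorphic_on right_half_plane"
      unfolding \<Psi>_def using \<mu>0 by (intro holomorphic_intros g) auto
    show "E (\<Psi> v) = h (\<kappa> v)" if "Re v > 0" for v
      using g(2)[of v] that \<mu>0 by (simp add: E_def \<Psi>_def)
  next
    fix \<gamma> :: "real \<Rightarrow> complex" and w
    assume \<gamma>: "path \<gamma>" "path_image \<gamma> \<subseteq> range E" "pathstart \<gamma> = E w"
    have "path_image \<gamma> \<subseteq> - {0}" using \<gamma>(2) rE by simp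
    moreover have "pathstart \<gamma> = exp (\<i> * \<mu> * w)" using \<gamma>(3) by (simp add: E_def)
    ultimately obtain \<gamma>' where g': "path \<gamma>'" "pathstart \<gamma>' = \<i> * \<mu> * w"
        "\<And>t. t \<in> {0..1} \<Longrightarrow> exp (\<gamma>' t) = \<gamma> t"
      using covering_space_lift_path_strong[OF covering_space_exp_punctured_plane UNIV_I \<gamma>(1)] by metis
    show "\<exists>\<gamma>'. path \<gamma>' \<and> pathstart \<gamma>' = w \<and> (\<forall>t\<in>{0..1}. E (\<gamma>' t) = \<gamma> t)"
    proof (intro exI conjI ballI)
      show "path (\<lambda>t. \<gamma>' t / (\<i> * \<mu>))"
        using g'(1) \<mu>0 unfolding path_def by (intro continuous_intros) auto
      show "pathstart (\<lambda>t. \<gamma>' t / (\<i> * \<mu>)) = w" using g'(2) \<mu>0 by (simp add: pathstart_def)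
      show "E (\<gamma>' t / (\<i> * \<mu>)) = \<gamma> t" if "t \<in> {0..1}" for t
        using g'(3)[OF that] \<mu>0 by (simp add: E_def)
    qed
  next
    fix z w :: complex and t :: real assume "z \<in> unit_disc" "t \<ge> 0" "E w = h z"
    moreover have "\<i> * \<mu> * (\<i> * of_real t) = - \<mu> * of_real t" by (simp add: algebra_simps)
    then have "E (\<i> * of_real t) = exp (- \<mu> * of_real t)" by (simp only: E_def)
    ultimately show "h (\<phi> t z) = E (w + \<i> * of_real t)" by (simp add: Eadd hflow)
  next
    fix z :: complex and t :: real assume "z \<in> unit_disc" "t \<ge> 0" "h (\<phi> t z) \<in> range E"
    then show "h z \<in> range E" by (simp add: rE hflow)
  next
    fix v :: complex assume v: "- s\<^sub>0 < Re v"
    show "\<kappa> v \<in> unit_disc \<longleftrightarrow> 0 < Re v" by (rule \<kappa>D[OF v])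
    show "deriv \<kappa> v \<noteq> 0" using nd[OF v] kD[OF v] by auto
  next
    fix v :: complex assume v: "0 < Re v" "norm v < 1"
    then have v1: "Re v > - s\<^sub>0" using s\<^sub>0 by simp
    define x where "x = Re v"
    have x: "0 < x" "x < 1" using v abs_Re_le_cmod[of v] by (auto simp: x_def)
    have e0: "exp (- x) < 1" "exp (- x) > 0" using x by auto
    have e1: "1 - exp (- x) \<ge> x * exp (- x)"
    proof -
      have "(1 + x) * exp (- x) \<le> exp x * exp (- x)" by (intro mult_right_mono) auto
      then show ?thesis by (simp add: exp_minus algebra_simps)
    qed
    have "exp (- x) ^ 2 \<le> exp (- x)"
      using e0 mult_left_mono[of "exp (- x)" 1 "exp (- x)"] by (simp add: power2_eq_square)
    then have lo: "x * exp (- x) \<le> 1 - exp (- x) ^ 2" using e1 by linarith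
    \<comment> \<open>Origin of the constant 6: 1 - exp(-2x) <= 2x, and 1 <= 3 exp(-x) for x <
      1.\<close>
    have "exp x \<le> 3" using x exp_le order.trans[of "exp x" "exp 1" 3] by simp
    then have "1 \<le> 3 * exp (- x)" by (simp add: exp_minus field_simps)
    then have "2 * x * 1 \<le> 2 * x * (3 * exp (- x))" using x by (intro mult_left_mono) auto
    moreover have "1 - exp (- x) ^ 2 \<le> 2 * x"
      using exp_ge_add_one_self[of "- (2 * x)"] by (simp add: power2_eq_square exp_add[symmetric])
    ultimately have up: "1 - exp (- x) ^ 2 \<le> 6 * x * exp (- x)" by simp
    note kD' = less_imp_le[OF kD[OF v1]]
    show "Re v * norm (deriv \<kappa> v) \<le> 1 - (norm (\<kappa> v))\<^sup>2"
      unfolding nd[OF v1] n\<kappa>[OF v1] x_def[symmetric] mult.assoc[symmetric]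
      by (intro mult_right_mono lo kD')
    show "1 - (norm (\<kappa> v))\<^sup>2 \<le> 6 * Re v * norm (deriv \<kappa> v)"
      unfolding nd[OF v1] n\<kappa>[OF v1] x_def[symmetric] mult.assoc[symmetric]
      by (intro mult_right_mono up kD')
  next
    fix v :: complex assume v: "0 < Re v"
    then have v1: "Re v > - s\<^sub>0" using s\<^sub>0 by simp
    define z where "z = \<kappa> v"
    have z: "z \<in> unit_disc" using \<kappa>D[OF v1] v by (simp add: z_def)
    have Mz: "M z = \<xi> v" using inv(2)[OF v1] by (simp add: z_def)
    have k0: "k \<noteq> 0" using k by auto
    have den: "1 - cnj \<tau> * z \<noteq> 0" using inv(1)[OF v1] k0 D[OF v1] by (simp add: z_def)
    have "(M has_field_derivative k / (1 - cnj \<tau> * z)\<^sup>2) (at z)"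
      unfolding M_def k_def using den
      by (auto intro!: derivative_eq_intros simp: power2_eq_square algebra_simps)
    moreover have "k / (1 - cnj \<tau> * z)\<^sup>2 = - \<xi> v / deriv \<kappa> v"
      using inv(1)[OF v1] k0 D[OF v1] \<xi>0[of v]
      by (simp add: z_def d\<kappa>[OF v1] power2_eq_square)
    ultimately have DM: "(M has_field_derivative - \<xi> v / deriv \<kappa> v) (at z)" by simp
    have z0: "\<phi> 0 z = z" by (rule F.\<phi>_0[OF z])
    have "((\<lambda>s. M (\<phi> s z)) has_vector_derivative G z * (- \<xi> v / deriv \<kappa> v)) (at 0 within {0..})"
      using field_vector_diff_chain_within[OF F.flow[OF z order.refl], of M "- \<xi> v / deriv \<kappa> v"]
        has_field_derivative_at_within[OF DM] by (simp add: z0 o_def)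
    \<comment> \<open>The Schwarz lemma at \<tau> replaces Julia: |M(\<phi>_s z)| never exceeds its
      initial value, so the real part of this function is smallest at s = 0. Its derivative there is
      |\<xi>|^2 times the real part sought.\<close>
    then have "((\<lambda>s. - cnj (\<xi> v) * M (\<phi> s z)) has_vector_derivative
        - cnj (\<xi> v) * (G z * (- \<xi> v / deriv \<kappa> v))) (at 0 within {0..})"
      by (rule has_vector_derivative_mult_right)
    from bounded_linear.has_vector_derivative[OF bounded_linear_Re this]
    have "((\<lambda>s. Re (- cnj (\<xi> v) * M (\<phi> s z))) has_real_derivative
        Re (- cnj (\<xi> v) * (G z * (- \<xi> v / deriv \<kappa> v)))) (at 0 within {0..})"
      by (simp only: has_real_derivative_iff_has_vector_derivative)
    then have "0 \<le> Re (- cnj (\<xi> v) * (G z * (- \<xi> v / deriv \<kappa> v)))"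
    proof (rule right_derivative_nonneg)
      fix t :: real assume t: "t \<ge> 0"
      have "norm (M (\<phi> t z)) \<le> norm (M z)"
        using Schwarz_Pick[OF F.\<phi>_hol[OF t] F.\<phi>_sub[OF t] z \<tau>] by (simp add: \<phi>\<tau>[OF t] M_def)
      then have "norm (cnj (\<xi> v) * M (\<phi> t z)) \<le> (norm (\<xi> v))\<^sup>2"
        by (simp add: norm_mult Mz power2_eq_square mult_left_mono)
      then have "Re (cnj (\<xi> v) * M (\<phi> t z)) \<le> (norm (\<xi> v))\<^sup>2"
        using complex_Re_le_cmod order.trans by blast
      moreover have "Re (cnj (\<xi> v) * M (\<phi> 0 z)) = (norm (\<xi> v))\<^sup>2"
        using complex_norm_square[of "\<xi> v"] by (simp only: z0 Mz mult.commute) (metis Re_complex_of_real of_real_power)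
      ultimately show "Re (- cnj (\<xi> v) * M (\<phi> 0 z)) \<le> Re (- cnj (\<xi> v) * M (\<phi> t z))"
        by (simp only: mult_minus_left uminus_complex.sel)
    qed
    also have "- cnj (\<xi> v) * (G z * (- \<xi> v / deriv \<kappa> v)) = of_real ((norm (\<xi> v))\<^sup>2) * (G z / deriv \<kappa> v)"
      using complex_norm_square[of "\<xi> v"] by (simp add: mult_ac)
    also have "Re \<dots> = (norm (\<xi> v))\<^sup>2 * Re (G z / deriv \<kappa> v)"
      by (simp only: times_complex.sel Re_complex_of_real Im_complex_of_real)
    finally have "0 \<le> (norm (\<xi> v))\<^sup>2 * Re (G z / deriv \<kappa> v)" .
    moreover have "(norm (\<xi> v))\<^sup>2 > 0" using \<xi>0[of v] by simp
    ultimately show "0 \<le> Re (G (\<kappa> v) / deriv \<kappa> v)"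
      unfolding z_def by (simp only: zero_le_mult_iff) linarith
  qed (use h s\<^sub>0 in auto)
  define V where "V = h ` unit_disc"
  have "V \<noteq> UNIV" unfolding V_def by (rule univalent_image_ne_UNIV[OF h])
  then obtain w\<^sub>0 where w\<^sub>0: "w\<^sub>0 \<notin> V" by auto
  have "0 \<in> V" unfolding V_def using h\<tau> \<tau> by force
  with w\<^sub>0 have not_all: "\<exists>w. w \<noteq> 0 \<and> w \<notin> V" by metis
  have comp: "\<Delta> \<in> components (interior U.W)" using pet by (simp add: petal_def)
  have \<Delta>W: "\<Delta> \<subseteq> U.W" by (rule order.trans[OF in_components_subset[OF comp] interior_subset])
  have ran: "h ` \<Delta> \<subseteq> range E"
  proof -
    \<comment> \<open>Otherwise a ball about 0 lies in the image of \<open>W\<close>. Every nonzero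
      w flows into it, and membership depends only on the abscissa of a lift, so only 0 could be
      missing from \<open>V\<close>.\<close>
    have "0 \<notin> h ` \<Delta>"
    proof
      assume 0: "0 \<in> h ` \<Delta>"
      have "open \<Delta>" by (rule open_components[OF open_interior comp])
      then have "open (h ` \<Delta>)"
        using U.petal_subset_disc[OF pet] by (intro open_mapping_thm3 holomorphic_on_subset[OF h(1)] inj_on_subset[OF h(2)])
      then obtain r where r: "r > 0" "ball 0 r \<subseteq> h ` \<Delta>" using 0 openE by blast
      have "w \<in> V" if w: "w \<noteq> 0" for w
      proof -
        obtain \<omega> where \<omega>: "w = E \<omega>" using E_Ln[OF w] by metis
        have "\<forall>\<^sub>F s in at_top. norm (exp (- \<mu> * of_real s) * w) < r"
          using tendstoD[OF decay[of w] r(1)] by (simp add: dist_norm)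
        then obtain s where s: "norm (exp (- \<mu> * of_real s) * w) < r"
          using eventually_happens by force
        have "\<i> * \<mu> * (\<i> * of_real s) = - \<mu> * of_real s" by (simp add: algebra_simps)
        then have "E (\<omega> + \<i> * of_real s) = exp (- \<mu> * of_real s) * w" by (simp only: Eadd \<omega> mult.commute) (simp only: E_def)
        then have "E (\<omega> + \<i> * of_real s) \<in> ball 0 r" using s by simp
        moreover have "ball 0 r \<subseteq> h ` U.W" using r(2) image_mono[OF \<Delta>W, of h] by (rule order.trans)
        ultimately have "E (\<omega> + \<i> * of_real s) \<in> h ` U.W" by (rule subsetD[rotated])
        then have "E \<omega> \<in> h ` U.W" by (simp only: U.in_image_W_iff) simp
        with image_mono[OF U.W_subset, of h] show ?thesis unfolding V_def \<omega> by (rule subsetD)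
      qed
      then show False using not_all by blast
    qed
    then show ?thesis by (auto simp: rE)
  qed
  define \<rho> where "\<rho> = pi / (- l)"
  have \<rho>: "\<rho> > 0" using l by (simp add: \<rho>_def divide_pos_neg)
  obtain a where a: "h ` \<Delta> = E ` {w. a < Re w \<and> Re w < a + \<rho>}"
    and wall: "\<And>\<delta>. \<delta> > 0 \<Longrightarrow> \<exists>xl xr. (\<exists>y. E (Complex xl y) \<notin> V) \<and> (\<exists>y. E (Complex xr y) \<notin> V) \<and>
        a - \<delta> < xl \<and> xl \<le> a \<and> a + \<rho> \<le> xr \<and> xr < a + \<rho> + \<delta>"
    using U.image_of_petal[OF pet fr ran] unfolding \<rho>_def V_def by blast
  have \<Delta>V: "h ` \<Delta> \<subseteq> V" unfolding V_def by (rule image_mono[OF U.petal_subset_disc[OF pet]])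
  define p where "p = Re \<mu> / (norm \<mu>)\<^sup>2"
  have p: "p > 0" using \<mu> \<mu>0 by (simp add: p_def)
  define A where "A = - ((norm \<mu>)\<^sup>2 * pi / (l * Re \<mu>))"
  have Ap: "A * p = \<rho>"
    using \<mu> \<mu>0 l by (simp add: A_def p_def \<rho>_def field_simps)
  have A: "A > 0" using Ap \<rho> p by (metis zero_less_mult_pos2)
  \<comment> \<open>\<open>E\<close> has period 2 pi/\<mu>, with real part 2 pi p. A wider strip
    would contain a lift of every nonzero number.\<close>
  have A2: "A \<le> 2 * pi"
  proof (rule ccontr)
    assume "\<not> A \<le> 2 * pi"
    then have big: "2 * pi * p < \<rho>" unfolding Ap[symmetric] using p by simp
    have "w \<in> V" if w: "w \<noteq> 0" for w
    proof -
      obtain \<omega> where \<omega>: "w = E \<omega>" using E_Ln[OF w] by metis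
      \<comment> \<open>Shifting by n periods brings the abscissa into (a, a + 2 pi p], which lies
        inside the strip.\<close>
      define n :: int where "n = \<lfloor>(a - Re \<omega>) / (2 * pi * p)\<rfloor> + 1"
      have pp: "2 * pi * p > 0" using p by simp
      have n1: "(a - Re \<omega>) / (2 * pi * p) < of_int n" and n2: "of_int n \<le> (a - Re \<omega>) / (2 * pi * p) + 1"
        unfolding n_def by linarith+
      have n: "a - Re \<omega> < of_int n * (2 * pi * p)" "of_int n * (2 * pi * p) \<le> a - Re \<omega> + 2 * pi * p"
        using mult_strict_right_mono[OF n1 pp] mult_right_mono[OF n2 less_imp_le[OF pp]] pp
        by (simp_all only: distrib_right) (simp_all add: p less_imp_neq[OF p, symmetric])
      define \<omega>' where "\<omega>' = \<omega> + of_real (2 * pi * of_int n) / \<mu>"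
      have "Re (of_real (2 * pi * of_int n) / \<mu>) = of_int n * (2 * pi * p)"
        by (simp only: p_def Re_divide cmod_power2) simp
      then have "a < Re \<omega>'" "Re \<omega>' < a + \<rho>"
        using n big
        unfolding \<omega>'_def plus_complex.sel by linarith+
      moreover have "E \<omega>' = w"
      proof -
        have "\<i> * \<mu> * \<omega>' = \<i> * \<mu> * \<omega> + \<i> * (of_int n * (of_real pi * 2))"
          using \<mu>0 by (simp add: \<omega>'_def distrib_left)
        then show ?thesis unfolding \<omega> E_def by (simp only: exp_plus_2pin)
      qed
      ultimately have "w \<in> h ` \<Delta>" unfolding a by blast
      then show ?thesis using \<Delta>V by blast
    qed
    then show False using not_all by blast
  qed
  note Sp = Spir_eq_image[OF \<mu>, folded p_def E_def]
  \<comment> \<open>The angle at the middle of the strip; subtracting 2 pi n moves it into the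
    prescribed interval without changing the sector.\<close>
  define \<theta>c where "\<theta>c = (a + \<rho> / 2) / p"
  define n :: int where "n = \<lfloor>(\<theta>c + pi) / (2 * pi)\<rfloor>"
  define \<theta>\<^sub>0 where "\<theta>\<^sub>0 = \<theta>c - 2 * pi * of_int n"
  have \<theta>\<^sub>0: "\<theta>\<^sub>0 \<in> {-pi..<pi}"
  proof -
    have "of_int n \<le> (\<theta>c + pi) / (2 * pi)" "(\<theta>c + pi) / (2 * pi) < of_int n + 1"
      unfolding n_def by linarith+
    then show ?thesis using pi_gt_zero by (simp add: \<theta>\<^sub>0_def field_simps)
  qed
  have eq: "h ` \<Delta> = Spir \<mu> A \<theta>\<^sub>0"
  proof -
    have "(\<theta>c - A / 2) * p = a" "(\<theta>c + A / 2) * p = a + \<rho>"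
    proof -
      have "\<theta>c * p = a + \<rho> / 2" using p by (simp add: \<theta>c_def)
      then show "(\<theta>c - A / 2) * p = a" "(\<theta>c + A / 2) * p = a + \<rho>"
        using Ap by (simp_all add: left_diff_distrib distrib_right)
    qed
    then show ?thesis unfolding \<theta>\<^sub>0_def Spir_shift Sp a by simp
  qed
  have "maximal_spirallike_sector V \<mu> A \<theta>\<^sub>0"
    unfolding maximal_spirallike_sector_def
  proof (intro conjI notI)
    show "spirallike_sector_in V \<mu> A \<theta>\<^sub>0"
      unfolding spirallike_sector_in_def eq[symmetric] using A A2 \<theta>\<^sub>0 \<Delta>V by simp
    assume "\<exists>b \<theta>\<^sub>1. spirallike_sector_in V \<mu> b \<theta>\<^sub>1 \<and> Spir \<mu> A \<theta>\<^sub>0 \<subset> Spir \<mu> b \<theta>\<^sub>1"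
    then obtain b \<theta>\<^sub>1 where b: "Spir \<mu> b \<theta>\<^sub>1 \<subseteq> V" "Spir \<mu> A \<theta>\<^sub>0 \<subset> Spir \<mu> b \<theta>\<^sub>1"
      unfolding spirallike_sector_in_def by blast
    define c d where "c = (\<theta>\<^sub>1 - b / 2) * p" and "d = (\<theta>\<^sub>1 + b / 2) * p"
    have Sb: "Spir \<mu> b \<theta>\<^sub>1 = E ` {w. c < Re w \<and> Re w < d}" unfolding Sp c_def d_def ..
    define \<omega> where "\<omega> = complex_of_real (a + \<rho> / 2)"
    have "E \<omega> \<in> h ` \<Delta>" unfolding a using \<rho> by (intro imageI) (simp add: \<omega>_def)
    then have "E \<omega> \<in> Spir \<mu> b \<theta>\<^sub>1" using b(2) eq by blast
    then obtain w1 where w1: "E \<omega> = E w1" "c < Re w1" "Re w1 < d" unfolding Sb by blast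
    \<comment> \<open>The larger sector may come with a different lift of the central point; s is
      the horizontal offset between the two lifts, and the strips are compared after removing
      it.\<close>
    define s where "s = Re w1 - (a + \<rho> / 2)"
    have shift: "E (w1 + (w - \<omega>)) = E w" for w using U.E_shift[OF w1(1), of "w - \<omega>"] by simp
    have inU: "E (Complex x y) \<in> V" if "c < x + s" "x + s < d" for x y
    proof -
      have "w1 + (Complex x y - \<omega>) \<in> {w. c < Re w \<and> Re w < d}" using that by (simp add: s_def \<omega>_def)
      then have "E (w1 + (Complex x y - \<omega>)) \<in> Spir \<mu> b \<theta>\<^sub>1" unfolding Sb by (rule imageI)
      then show ?thesis using b(1) by (auto simp: shift)
    qed
    have ca: "a + s \<le> c"
    proof (rule ccontr)
      assume "\<not> a + s \<le> c"
      then obtain x where "\<exists>y. E (Complex x y) \<notin> V" "c - s < x" "x \<le> a"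
        using wall[of "a + s - c"] by auto
      then show False using inU[of x] w1 \<rho> by (auto simp: s_def)
    qed
    have db: "d \<le> a + \<rho> + s"
    proof (rule ccontr)
      assume "\<not> d \<le> a + \<rho> + s"
      then obtain x where "\<exists>y. E (Complex x y) \<notin> V" "a + \<rho> \<le> x" "x < d - s"
        using wall[of "d - (a + \<rho> + s)"] by auto
      then show False using inU[of x] w1 \<rho> by (auto simp: s_def)
    qed
    have "Spir \<mu> b \<theta>\<^sub>1 \<subseteq> Spir \<mu> A \<theta>\<^sub>0"
      unfolding eq[symmetric] a Sb
    proof (rule image_subsetI)
      fix w assume w: "w \<in> {w. c < Re w \<and> Re w < d}"
      have "E (\<omega> + (w - w1)) = E w" using U.E_shift[OF w1(1), of "w - w1"] by simp
      moreover have "\<omega> + (w - w1) \<in> {w. a < Re w \<and> Re w < a + \<rho>}"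
        using w ca db by (simp add: \<omega>_def s_def)
      ultimately show "E w \<in> E ` {w. a < Re w \<and> Re w < a + \<rho>}" by (metis imageI)
    qed
    then show False using b(2) by blast
  qed
  then show ?thesis using \<theta>\<^sub>0 eq unfolding A_def V_def by blast
qed

text \<open>Non-tangential limits are unique, since \<tau> is a limit point of its Stolz region; but
  exp(-l) > 1 whereas |exp(-\<mu>)| <= 1.\<close>

lemma repelling_ne_Denjoy_Wolff_point:
  assumes "spectral_value \<phi> \<tau> \<mu>" "\<tau> \<in> unit_circle" "repelling_fixed_point \<phi> \<sigma> l"
  shows "\<sigma> \<noteq> \<tau>"
proof
  assume eq: "\<sigma> = \<tau>"
  have \<tau>: "\<tau> \<notin> unit_disc" using assms(2) by auto
  have "l < 0" using assms(3) by (simp add: repelling_fixed_point_def)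
  have "(deriv (\<phi> 1) \<longlongrightarrow> of_real (exp (- l * 1))) (at \<tau> within stolz_region \<tau> 2)"
    using assms(3) unfolding repelling_fixed_point_def nontangential_limit_def eq
    by (elim conjE allE[of _ 1]) simp
  moreover have "(deriv (\<phi> 1) \<longlongrightarrow> exp (- \<mu> * of_real 1)) (at \<tau> within stolz_region \<tau> 2)"
    using assms(1) \<tau> unfolding spectral_value_def nontangential_limit_def if_not_P[OF \<tau>]
    by (elim conjE allE[of _ 1]) simp
  moreover have "at \<tau> within stolz_region \<tau> 2 \<noteq> bot"
  proof -
    have "\<tau> islimpt stolz_region \<tau> 2"
      unfolding islimpt_approachable
    proof (intro allI impI)
      fix e :: real assume e: "e > 0"
      define s where "s = max 0 (1 - e / 2)"
      have s: "0 \<le> s" "s < 1" "1 - s < e" using e by (auto simp: s_def)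
      note R = radius_in_stolz_region[OF assms(2) s(1,2)]
      show "\<exists>x\<in>stolz_region \<tau> 2. x \<noteq> \<tau> \<and> dist x \<tau> < e"
        using R s by (intro bexI[of _ "of_real s * \<tau>"]) (auto simp: dist_norm norm_minus_commute)
    qed
    then show ?thesis by (simp add: trivial_limit_within)
  qed
  ultimately have "of_real (exp (- l * 1)) = exp (- \<mu> * of_real 1)" by (rule tendsto_unique[rotated])
  then have "norm (complex_of_real (exp (- l * 1))) = norm (exp (- \<mu> * of_real 1))" by simp
  then have "- l = - Re \<mu>" by (simp del: of_real_exp)
  moreover have "Re \<mu> \<ge> 0" using assms(1) \<tau> unfolding spectral_value_def by auto
  ultimately show False using \<open>l < 0\<close> by simp
qed

theorem theorem5p6:
  fixes \<phi> :: "real \<Rightarrow> complex \<Rightarrow> complex"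
    and h :: "complex \<Rightarrow> complex"
    and \<tau> \<mu> \<sigma> :: complex
    and \<Delta> :: "complex set"
    and l :: real
  assumes "holomorphic_semigroup \<phi>"
    and "\<not> holomorphic_group \<phi>"
    and "denjoy_wolff_point \<phi> \<tau>"
    and "spectral_value \<phi> \<tau> \<mu>"
    and "koenigs_function \<phi> \<tau> \<mu> h"
    and "hyperbolic_petal \<phi> \<Delta>"
    and "\<sigma> \<in> frontier \<Delta>"
    and "repelling_fixed_point \<phi> \<sigma> l"
  shows "(\<tau> \<in> unit_disc \<longrightarrow>
           (\<exists>\<theta>\<^sub>0\<in>{-pi..<pi}.
              h ` \<Delta> = Spir \<mu> (- ((norm \<mu>)\<^sup>2 * pi / (l * Re \<mu>))) \<theta>\<^sub>0 \<and>
              maximal_spirallike_sector (h ` unit_disc) \<mu> (- ((norm \<mu>)\<^sup>2 * pi / (l * Re \<mu>))) \<theta>\<^sub>0))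
       \<and> (\<tau> \<in> unit_circle \<longrightarrow>
           (\<exists>z\<^sub>0.
              h ` \<Delta> = (+) z\<^sub>0 ` vertical_strip (- (pi / l)) \<and>
              maximal_strip (h ` unit_disc) z\<^sub>0 (- (pi / l))))"
proof (intro conjI impI)
  have pet: "petal \<phi> \<Delta>" using assms(6) by (simp add: hyperbolic_petal_def)
  {
    assume \<tau>: "\<tau> \<in> unit_disc"
    then have \<mu>: "Re \<mu> > 0" using assms(4) unfolding spectral_value_def by (auto split: if_splits)
    have "holomorphic_model \<phi> UNIV h (\<lambda>t z. exp (- \<mu> * of_real t) * z)"
      using assms(5) \<tau> unfolding koenigs_function_def by simp
    then show "\<exists>\<theta>\<^sub>0\<in>{-pi..<pi}.
              h ` \<Delta> = Spir \<mu> (- ((norm \<mu>)\<^sup>2 * pi / (l * Re \<mu>))) \<theta>\<^sub>0 \<and>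
              maximal_spirallike_sector (h ` unit_disc) \<mu> (- ((norm \<mu>)\<^sup>2 * pi / (l * Re \<mu>))) \<theta>\<^sub>0"
      unfolding holomorphic_model_def
      by (intro elliptic_case[OF assms(1,3) \<tau> \<mu> assms(8) _ _ _ pet assms(7)]) auto
  next
    assume \<tau>: "\<tau> \<in> unit_circle"
    then have "\<tau> \<notin> unit_disc" by auto
    then have "\<exists>\<Omega>. holomorphic_model \<phi> \<Omega> h (\<lambda>t z. z + \<i> * of_real t)"
      using assms(5) unfolding koenigs_function_def by (auto split: if_splits)
    then show "\<exists>z\<^sub>0. h ` \<Delta> = (+) z\<^sub>0 ` vertical_strip (- (pi / l)) \<and>
              maximal_strip (h ` unit_disc) z\<^sub>0 (- (pi / l))"
      unfolding holomorphic_model_def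
      by (intro boundary_case[OF assms(1,3) \<tau> assms(8) repelling_ne_Denjoy_Wolff_point[OF assms(4) \<tau> assms(8)]
            _ _ _ pet assms(7)]) auto
  }
qed

end
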